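(* Consider the multivariate errors-in-variables model described in the context (that is, the null hypothesis $\mathbf H_0$ holds: $b_i=X^{0\top}a_i^0+\tilde b_i$ for some matrix $X^0\in\mathbb R^{n\times d}$). Suppose that: (1) the error vectors $\tilde c_i$, $i\ge 1$, are i.i.d. with zero mean and covariance matrix $\mathbf{cov}(\tilde c_1)=\sigma^2\mathrm I_{n+d}$ with unknown $\sigma>0$; (2) for some $\delta>0$, $\mathsf E\|\tilde c_1\|^{4+2\delta}<\infty$ and, for the same $\delta$, $\frac{1}{m^{1+\delta/2}}\sum_{i=1}^m\|a_i^0\|^{2+\delta}\to 0$ as $m\to\infty$; (3) $\mathsf E\,\tilde c_1^{(p)}\tilde c_1^{(q)}\tilde c_1^{(r)}=0$ for all $p,q,r=1,\dots,n+d$; (4) $\frac1m\sum_{i=1}^m a_i^0\to\mu_a$ as $m\to\infty$ with $\mu_a\in\mathbb R^{n\times1}$; (5) there exists a finite matrix limit $S_a:=\lim_{m\to\infty}\frac1m\sum_{i=1}^m(a_i^0-\mu_a)(a_i^0-\mu_a)^\top$, and $S_a$ is nonsingular. Then the test statistic $T_m^2=m\,\|\hat\varSigma_T^{-1/2}T_m^0\|^2$ converges in distribution, as $m\to\infty$, to the chi-squared distribution $\chi_d^2$ with $d$ degrees of freedom.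
   Context: Model. Fix $n,d\ge1$, a matrix $X^0\in\mathbb R^{n\times d}$ and nonrandom vectors $a_i^0\in\mathbb R^n$, $i\ge1$. Put $b_i^0=X^{0\top}a_i^0\in\mathbb R^d$. One observes $a_i=a_i^0+\tilde a_i$, $b_i=b_i^0+\tilde b_i$, $i=1,\dots,m$, where $\tilde a_i,\tilde b_i$ are random errors; $\tilde c_i=[\tilde a_i^\top\ \tilde b_i^\top]^\top\in\mathbb R^{n+d}$, and $\tilde c_1^{(p)}$ is the $p$th coordinate of $\tilde c_1$. $A\in\mathbb R^{m\times n}$, $B\in\mathbb R^{m\times d}$ have rows $a_i^\top$, $b_i^\top$. Vectors are columns; $\|\cdot\|$ is the Frobenius norm; $\mathrm I_p$ is the $p\times p$ identity matrix; a bar denotes averaging over $i=1,\dots,m$, e.g. $\overline{ab^\top}=m^{-1}\sum_{i=1}^m a_ib_i^\top$. TLS estimator. The total least squares estimator $\hat X=\hat X_m$ is a Borel-measurable function of $(A,B)$ with values in $\mathbb R^{n\times d}\cup\{\infty\}$ which provides a solution (its $X$-component) of the problem of minimizing $\|\Delta A\|^2+\|\Delta B\|^2$ over $(X,\Delta A,\Delta B)$, $X\in\mathbb R^{n\times d}$, subject to $(A-\Delta A)X=B-\Delta B$, whenever a solution exists, and $\hat X=\infty$ otherwise. Estimating function: $s(a,b;X)=a(a^\top X-b^\top)-X(\mathrm I_d+X^\top X)^{-1}(X^\top a-b)(a^\top X-b^\top)$. Statistics: $T_m^0=\frac1m\sum_{i=1}^m(b_i-\hat X^\top a_i)$, $\hat\mu_a=\bar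 a=\frac1m\sum_{i=1}^m a_i$, $\hat\sigma^2=\frac1d\,\mathrm{tr}\big[(\overline{bb^\top}-2\hat X^\top\overline{ab^\top}+\hat X^\top\overline{aa^\top}\hat X)(\mathrm I_d+\hat X^\top\hat X)^{-1}\big]$, $\hat V_A=\overline{aa^\top}-\hat\sigma^2\mathrm I_n$, $\hat S(\hat\mu_a)=\frac1m\sum_{i=1}^m s^\top(a_i,b_i;\hat X)\,\hat V_A^{-1}\hat\mu_a\hat\mu_a^\top\hat V_A^{-1}\,s(a_i,b_i;\hat X)$, and $\hat\varSigma_T=\hat\sigma^2(1-2\hat\mu_a^\top\hat V_A^{-1}\hat\mu_a)(\mathrm I_d+\hat X^\top\hat X)+\hat S(\hat\mu_a)$. The statistic $T_m^2$ is defined for those $m\ge1$ and those outcomes $\omega$ for which $\hat\varSigma_T$ is positive definite (under the hypotheses this event has probability tending to one as $m\to\infty$). Convention: statistics are considered where $\hat X$ is finite and the required inverses exist (and $\hat\varSigma_T$ is positive definite, for $T_m^2$), and may be given arbitrary values elsewhere. *)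

theory Defs
  imports "HOL-Probability.Probability"
begin

section \<open>Matrices\<close>

text \<open>\<open>outer x y\<close> is the matrix \<open>x y\<^sup>T\<close>; a p-by-q real matrix has type \<open>real^'q^'p\<close>.
  The instance \<open>norm\<close> on \<open>real^'q^'p\<close> is the Frobenius norm.\<close>

definition outer :: "real^'p \<Rightarrow> real^'q \<Rightarrow> real^'q^'p" where
  "outer x y = (\<chi> i j. x $ i * y $ j)"

definition pos_def :: "real^'k^'k \<Rightarrow> bool" where
  "pos_def S \<longleftrightarrow> transpose S = S \<and> (\<forall>x. x \<noteq> 0 \<longrightarrow> 0 < x \<bullet> (S *v x))"

text \<open>For positive definite \<open>S\<close>, this is \<open>S\<^sup>-\<^sup>1\<^sup>/\<^sup>2\<close>, the unique positive definite square
  root of the inverse.\<close>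

definition inv_sqrt_matrix :: "real^'k^'k \<Rightarrow> real^'k^'k" where
  "inv_sqrt_matrix S = (THE R. pos_def R \<and> R ** R = matrix_inv S)"


section \<open>Probability\<close>

definition cov_matrix :: "'w measure \<Rightarrow> ('w \<Rightarrow> real^'k) \<Rightarrow> real^'k^'k" where
  "cov_matrix M Z =
     (let \<mu> = (\<integral>\<omega>. Z \<omega> \<partial>M) in \<integral>\<omega>. outer (Z \<omega> - \<mu>) (Z \<omega> - \<mu>) \<partial>M)"

text \<open>The law of a sum of \<open>k\<close> squared independent standard normal variables.\<close>

definition chi_squared :: "nat \<Rightarrow> real measure" where
  "chi_squared k =
     distr (Pi\<^sub>M {..<k} (\<lambda>_. density lborel (\<lambda>x. ennreal (std_normal_density x)))) borel
       (\<lambda>x. \<Sum>i<k. (x i)\<^sup>2)"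

text \<open>The Borel sigma-algebra of the one-point compactification; \<open>None\<close> is the point at
  infinity.\<close>

definition borel_infty :: "'a::topological_space option measure" where
  "borel_infty = sigma UNIV {U. openin (Alexandroff_compactification euclidean) U}"


section \<open>Total least squares\<close>

text \<open>Matrices with \<open>m\<close> rows are given by their rows, as functions on the indices
  \<open>1, \<dots>, m\<close>. The i-th row of \<open>(A - \<Delta>A) X = B - \<Delta>B\<close>, transposed, is
  \<open>X\<^sup>T (a\<^sub>i - \<Delta>a\<^sub>i) = b\<^sub>i - \<Delta>b\<^sub>i\<close>.\<close>

definition tls_feasible ::
  "nat \<Rightarrow> (nat \<Rightarrow> real^'n) \<Rightarrow> (nat \<Rightarrow> real^'d) \<Rightarrow>
   real^'d^'n \<Rightarrow> (nat \<Rightarrow> real^'n) \<Rightarrow> (nat \<Rightarrow> real^'d) \<Rightarrow> bool" where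
  "tls_feasible m a b X da db \<longleftrightarrow>
     (\<forall>i\<in>{1..m}. transpose X *v (a i - da i) = b i - db i)"

definition tls_cost :: "nat \<Rightarrow> (nat \<Rightarrow> real^'n) \<Rightarrow> (nat \<Rightarrow> real^'d) \<Rightarrow> real" where
  "tls_cost m da db = (\<Sum>i=1..m. (norm (da i))\<^sup>2) + (\<Sum>i=1..m. (norm (db i))\<^sup>2)"

definition tls_solution ::
  "nat \<Rightarrow> (nat \<Rightarrow> real^'n) \<Rightarrow> (nat \<Rightarrow> real^'d) \<Rightarrow>
   real^'d^'n \<Rightarrow> (nat \<Rightarrow> real^'n) \<Rightarrow> (nat \<Rightarrow> real^'d) \<Rightarrow> bool" where
  "tls_solution m a b X da db \<longleftrightarrow>
     tls_feasible m a b X da db \<and>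
     (\<forall>X' da' db'. tls_feasible m a b X' da' db' \<longrightarrow> tls_cost m da db \<le> tls_cost m da' db')"

text \<open>An estimator is a function of the finite data \<open>(a\<^sub>i, b\<^sub>i)\<close>, \<open>i = 1, \<dots>, m\<close>.\<close>

definition tls_estimator ::
  "nat \<Rightarrow> ((nat \<Rightarrow> (real^'n) \<times> (real^'d)) \<Rightarrow> (real^'d^'n) option) \<Rightarrow> bool" where
  "tls_estimator m est \<longleftrightarrow>
     est \<in> measurable (Pi\<^sub>M {1..m} (\<lambda>_. borel)) borel_infty \<and>
     (\<forall>D \<in> extensional {1..m}.
        let a = (\<lambda>i. fst (D i)); b = (\<lambda>i. snd (D i)) in
        if \<exists>X da db. tls_solution m a b X da db
        then \<exists>X da db. est D = Some X \<and> tls_solution m a b X da db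
        else est D = None)"


section \<open>Estimating function and statistics\<close>

definition avg :: "nat \<Rightarrow> (nat \<Rightarrow> 'v::real_vector) \<Rightarrow> 'v" where
  "avg m f = (1 / real m) *\<^sub>R (\<Sum>i=1..m. f i)"

definition est_fun :: "real^'n \<Rightarrow> real^'d \<Rightarrow> real^'d^'n \<Rightarrow> real^'d^'n" where
  "est_fun a b X =
     outer a (transpose X *v a - b)
     - X ** matrix_inv (mat 1 + transpose X ** X)
         ** outer (transpose X *v a - b) (transpose X *v a - b)"

definition T0_stat ::
  "nat \<Rightarrow> (nat \<Rightarrow> real^'n) \<Rightarrow> (nat \<Rightarrow> real^'d) \<Rightarrow> real^'d^'n \<Rightarrow> real^'d" where
  "T0_stat m a b X = avg m (\<lambda>i. b i - transpose X *v a i)"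

definition sigma2_hat ::
  "nat \<Rightarrow> (nat \<Rightarrow> real^'n) \<Rightarrow> (nat \<Rightarrow> real^'d) \<Rightarrow> real^'d^'n \<Rightarrow> real" where
  "sigma2_hat m a b X =
     1 / real CARD('d) *
     trace ((avg m (\<lambda>i. outer (b i) (b i))
             - 2 *\<^sub>R (transpose X ** avg m (\<lambda>i. outer (a i) (b i)))
             + transpose X ** avg m (\<lambda>i. outer (a i) (a i)) ** X)
            ** matrix_inv (mat 1 + transpose X ** X))"

definition V_hat ::
  "nat \<Rightarrow> (nat \<Rightarrow> real^'n) \<Rightarrow> (nat \<Rightarrow> real^'d) \<Rightarrow> real^'d^'n \<Rightarrow> real^'n^'n" where
  "V_hat m a b X = avg m (\<lambda>i. outer (a i) (a i)) - sigma2_hat m a b X *\<^sub>R mat 1"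

definition S_hat ::
  "nat \<Rightarrow> (nat \<Rightarrow> real^'n) \<Rightarrow> (nat \<Rightarrow> real^'d) \<Rightarrow> real^'d^'n \<Rightarrow> real^'n \<Rightarrow> real^'d^'d" where
  "S_hat m a b X \<mu> =
     (let W = matrix_inv (V_hat m a b X) in
      avg m (\<lambda>i. transpose (est_fun (a i) (b i) X) ** W ** outer \<mu> \<mu> ** W
                  ** est_fun (a i) (b i) X))"

definition Sigma_T_hat ::
  "nat \<Rightarrow> (nat \<Rightarrow> real^'n) \<Rightarrow> (nat \<Rightarrow> real^'d) \<Rightarrow> real^'d^'n \<Rightarrow> real^'d^'d" where
  "Sigma_T_hat m a b X =
     (let \<mu> = avg m a in
      (sigma2_hat m a b X * (1 - 2 * (\<mu> \<bullet> (matrix_inv (V_hat m a b X) *v \<mu>))))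
          *\<^sub>R (mat 1 + transpose X ** X)
      + S_hat m a b X \<mu>)"

text \<open>\<open>mat 1 + transpose X ** X\<close> is always invertible, so \<open>V_hat\<close> is the only matrix whose
  invertibility has to be required.\<close>

definition T2_defined ::
  "nat \<Rightarrow> (nat \<Rightarrow> real^'n) \<Rightarrow> (nat \<Rightarrow> real^'d) \<Rightarrow> (real^'d^'n) option \<Rightarrow> bool" where
  "T2_defined m a b Xh \<longleftrightarrow>
     1 \<le> m \<and> (\<exists>X. Xh = Some X \<and> invertible (V_hat m a b X) \<and> pos_def (Sigma_T_hat m a b X))"

text \<open>Only meaningful under \<open>T2_defined m a b (Some X)\<close>.\<close>

definition T2_stat ::
  "nat \<Rightarrow> (nat \<Rightarrow> real^'n) \<Rightarrow> (nat \<Rightarrow> real^'d) \<Rightarrow> real^'d^'n \<Rightarrow> real" where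
  "T2_stat m a b X =
     real m * (norm (inv_sqrt_matrix (Sigma_T_hat m a b X) *v T0_stat m a b X))\<^sup>2"

end

theory Submission
  imports Defs
begin

text \<open>Write \<open>\<rho>\<^sub>i = X\<^sub>0\<^sup>T a\<^sub>i - b\<^sub>i\<close>; under the model this is a linear function of the error \<open>c\<^sub>i\<close> alone. Put
\<open>V = S\<^sub>a + \<mu>\<^sub>a \<mu>\<^sub>a\<^sup>T\<close>, \<open>w = V\<^sup>-\<^sup>1 \<mu>\<^sub>a\<close>, \<open>B = I + X\<^sub>0\<^sup>T X\<^sub>0\<close>, and let \<open>X\<close> be the total least squares
estimate.

For a fixed matrix the best corrections are explicit, so \<open>X\<close> minimises \<open>\<Sum> r\<^sub>i\<^sup>T (I + X\<^sup>T X)\<^sup>-\<^sup>1 r\<^sub>i\<close> with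
\<open>r\<^sub>i = X\<^sup>T a\<^sub>i - b\<^sub>i\<close>. This objective depends on the data only through the second moments of
\<open>(a\<^sub>i, \<rho>\<^sub>i)\<close>. Once these are near their limits a minimiser exists and lies near \<open>X\<^sub>0\<close>
(\<open>tls_consistency\<close>). A minimiser is a zero of the estimating function
(\<open>estimating_equation\<close>), and linearisation at \<open>X\<^sub>0\<close> gives
\<open>\<surd>m V (X - X\<^sub>0) = - m\<^sup>-\<^sup>1\<^sup>/\<^sup>2 \<Sum> s(a\<^sub>i, b\<^sub>i; X\<^sub>0) + o(1)\<close> (\<open>sqrt_n_expansion\<close>). Hence
\<open>\<surd>m T\<^sub>m\<^sup>0 = m\<^sup>-\<^sup>1\<^sup>/\<^sup>2 \<Sum> u\<^sub>i + o(1)\<close> with \<open>u\<^sub>i = s(a\<^sub>i, b\<^sub>i; X\<^sub>0)\<^sup>T w - \<rho>\<^sub>i\<close>.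

The vectors \<open>u\<^sub>i\<close> are independent and centred, and \<open>u\<^sub>i = (w\<^sup>T a\<^sup>0\<^sub>i - 1 + \<kappa>\<^sub>i) \<rho>\<^sub>i\<close> for a linear function
\<open>\<kappa>\<^sub>i\<close> of the error that is uncorrelated with \<open>\<rho>\<^sub>i\<close>. Because third moments vanish, the average
covariance of the \<open>u\<^sub>i\<close> converges to
\<open>\<Sigma>\<^sub>T = \<sigma>\<^sup>2 (1 - \<mu>\<^sub>a\<^sup>T V\<^sup>-\<^sup>1 \<mu>\<^sub>a) B + E[\<kappa>\<^sup>2 \<rho> \<rho>\<^sup>T]\<close>. This is also the limit of the estimated covariance
(\<open>Sigma_T_hat_tendsto\<close>), and it is positive definite because \<open>\<mu>\<^sub>a\<^sup>T V\<^sup>-\<^sup>1 \<mu>\<^sub>a < 1\<close>. A central limit theorem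
for weighted iid terms (\<open>weighted_clt\<close>) then makes the whitened sum \<open>Y\<^sub>m = \<Sigma>\<^sub>T\<^sup>-\<^sup>1\<^sup>/\<^sup>2 m\<^sup>-\<^sup>1\<^sup>/\<^sup>2 \<Sum> u\<^sub>i\<close>
asymptotically standard normal, and \<open>T\<^sub>m\<^sup>2 - \<parallel>Y\<^sub>m\<parallel>\<^sup>2\<close> tends to zero in probability.

Two devices keep analysis and probability apart. First, everything about the estimator is proved
for arbitrary nonrandom sequences of data, assuming that certain statistics converge and others stay
bounded (\<open>T2_stat_expansion\<close>). \<open>null_in_probI\<close> turns such a statement into convergence in
probability as soon as the former statistics converge in \<open>L\<^sup>1\<close> and the latter are bounded in
\<open>L\<^sup>1\<close>; that is a matter of a weighted law of large numbers (\<open>weighted_lln\<close>) and of variance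
computations. Secondly, convergence in law of \<open>\<parallel>Y\<^sub>m\<parallel>\<^sup>2\<close> needs only pointwise convergence
of the characteristic functions of \<open>Y\<^sub>m\<close> on \<open>\<real>\<^sup>d\<close>: mixing \<open>exp (i t \<bullet> y)\<close> over a Gaussian \<open>t\<close> yields
\<open>exp (- k \<parallel>y\<parallel>\<^sup>2)\<close>, so the Laplace transforms of \<open>\<parallel>Y\<^sub>m\<parallel>\<^sup>2\<close> converge, and these determine the
limit law by the Weierstrass theorem (\<open>weak_conv_chi_squaredI\<close>).\<close>

section \<open>Matrix norms and rank-one matrices\<close>

text \<open>The default rewriting of \<open>transpose A *v x\<close> into the row form would hide the terms that the
  lemmas on inner products and residuals below are stated for.\<close>

declare transpose_matrix_vector [simp del]

lemma norm_matrix_vector_le: "norm (A *v x) \<le> norm A * norm (x::real^'n)" for A :: "real^'n^'m"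
proof -
  have "norm (A *v x) = L2_set (\<lambda>i. norm ((A *v x) $ i)) UNIV" by (simp add: norm_vec_def)
  also have "\<dots> \<le> L2_set (\<lambda>i. norm (A $ i) * norm x) UNIV"
    by (rule L2_set_mono) (simp_all add: matrix_vector_mul_component Cauchy_Schwarz_ineq2)
  also have "\<dots> = norm A * norm x"
    by (simp add: norm_vec_def L2_set_left_distrib)
  finally show ?thesis .
qed

lemma norm_matrix_sq: "(norm A)\<^sup>2 = (\<Sum>i\<in>UNIV. \<Sum>j\<in>UNIV. (A $ i $ j)\<^sup>2)" for A :: "real^'n^'m"
  by (simp add: norm_vec_def L2_set_def sum_nonneg)

lemma norm_transpose: "norm (transpose A) = norm A" for A :: "real^'n^'m"
proof -
  have "(norm (transpose A))\<^sup>2 = (norm A)\<^sup>2"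
    unfolding norm_matrix_sq by (subst sum.swap) (simp add: transpose_def)
  then show ?thesis by simp
qed

lemma norm_matrix_matrix_le: "norm (A ** B) \<le> norm A * norm B"
  for A :: "real^'n^'m" and B :: "real^'k^'n"
proof -
  have row: "(A ** B) $ i = transpose B *v (A $ i)" for i
    by (simp add: vec_eq_iff matrix_matrix_mult_def matrix_vector_mult_def transpose_def mult.commute)
  have "norm (A ** B) = L2_set (\<lambda>i. norm ((A ** B) $ i)) UNIV" by (simp add: norm_vec_def)
  also have "\<dots> \<le> L2_set (\<lambda>i. norm (A $ i) * norm B) UNIV"
    using norm_matrix_vector_le[of "transpose B"]
    by (intro L2_set_mono) (simp_all only: row norm_transpose mult.commute[of _ "norm B"] norm_ge_zero)
  also have "\<dots> = norm A * norm B"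
    by (simp add: norm_vec_def L2_set_left_distrib)
  finally show ?thesis .
qed

lemma matrix_add_rdistrib: "(A + B) ** C = A ** C + B ** C" for A B :: "real^'n^'m"
  by (simp add: vec_eq_iff matrix_matrix_mult_def sum.distrib algebra_simps)

lemma matrix_diff_ldistrib: "A ** (B - C) = A ** B - A ** C" for A :: "real^'n^'m"
  by (simp add: vec_eq_iff matrix_matrix_mult_def sum_subtractf algebra_simps)

lemma matrix_diff_rdistrib: "(A - B) ** C = A ** C - B ** C" for A B :: "real^'n^'m"
  by (simp add: vec_eq_iff matrix_matrix_mult_def sum_subtractf algebra_simps)

lemma matrix_scaleR_left: "(r *\<^sub>R A) ** B = r *\<^sub>R (A ** B)" for A :: "real^'n^'m"
  by (simp add: vec_eq_iff matrix_matrix_mult_def sum_distrib_left algebra_simps)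

lemma matrix_scaleR_right: "A ** (r *\<^sub>R B) = r *\<^sub>R (A ** B)" for A :: "real^'n^'m"
  by (simp add: vec_eq_iff matrix_matrix_mult_def sum_distrib_left algebra_simps)

lemma bounded_bilinear_matrix_mult:
  "bounded_bilinear ((**) :: real^'n^'m \<Rightarrow> real^'k^'n \<Rightarrow> real^'k^'m)"
  by (rule bounded_bilinear.intro)
    (auto simp: matrix_add_ldistrib matrix_add_rdistrib matrix_scaleR_left matrix_scaleR_right
      intro!: exI[of _ 1] norm_matrix_matrix_le)

lemma bounded_bilinear_matrix_vector_mult:
  "bounded_bilinear ((*v) :: real^'n^'m \<Rightarrow> real^'n \<Rightarrow> real^'m)"
  by (rule bounded_bilinear.intro)
    (auto simp: matrix_vector_right_distrib matrix_vector_mult_add_rdistrib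
      matrix_vector_mult_scaleR scaleR_matrix_vector_assoc intro!: exI[of _ 1] norm_matrix_vector_le)

lemma bounded_linear_transpose: "bounded_linear (transpose :: real^'n^'m \<Rightarrow> real^'m^'n)"
  by (rule bounded_linear_intro[where K=1])
    (auto simp: transpose_def vec_eq_iff norm_transpose[unfolded transpose_def])

lemma norm_outer: "norm (outer x y) = norm x * norm y" for x :: "real^'p" and y :: "real^'q"
proof -
  have "(norm (outer x y))\<^sup>2 = (norm x * norm y)\<^sup>2"
    by (simp add: norm_matrix_sq outer_def power_mult_distrib norm_vec_def L2_set_def
        sum_nonneg sum_product)
  then show ?thesis by simp
qed

lemma bounded_bilinear_outer: "bounded_bilinear (outer :: real^'p \<Rightarrow> real^'q \<Rightarrow> real^'q^'p)"
proof (rule bounded_bilinear.intro)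
  show "\<exists>K. \<forall>x y. norm (outer x y :: real^'q^'p) \<le> norm x * norm y * K"
    by (intro exI[of _ 1]) (simp add: norm_outer)
qed (simp_all add: outer_def vec_eq_iff algebra_simps)

lemma bounded_linear_trace: "bounded_linear (trace :: real^'n^'n \<Rightarrow> real)"
  unfolding trace_def
  by (intro bounded_linear_sum bounded_linear_compose[OF bounded_linear_vec_nth] bounded_linear_vec_nth)

lemmas tendsto_matrix_mult [tendsto_intros] =
  bounded_bilinear.tendsto[OF bounded_bilinear_matrix_mult]
lemmas tendsto_matrix_vector_mult [tendsto_intros] =
  bounded_bilinear.tendsto[OF bounded_bilinear_matrix_vector_mult]
lemmas tendsto_transpose [tendsto_intros] = bounded_linear.tendsto[OF bounded_linear_transpose]
lemmas tendsto_outer [tendsto_intros] = bounded_bilinear.tendsto[OF bounded_bilinear_outer]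
lemmas tendsto_trace [tendsto_intros] = bounded_linear.tendsto[OF bounded_linear_trace]

lemma outer_mult_vec: "outer x y *v z = (y \<bullet> z) *\<^sub>R x"
  by (simp add: vec_eq_iff outer_def matrix_vector_mult_def inner_vec_def sum_distrib_left
      algebra_simps)

lemma matrix_mult_outer: "A ** outer x y = outer (A *v x) y" for A :: "real^'n^'m"
  by (simp add: vec_eq_iff outer_def matrix_vector_mult_def matrix_matrix_mult_def sum_distrib_left
      algebra_simps)

lemma outer_mult_matrix: "outer x y ** A = outer x (transpose A *v y)" for A :: "real^'n^'m"
  by (simp add: vec_eq_iff outer_def matrix_vector_mult_def transpose_def matrix_matrix_mult_def sum_distrib_left
      algebra_simps)

lemma transpose_outer: "transpose (outer x y) = outer y x"
  by (simp add: vec_eq_iff outer_def transpose_def)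

lemmas transpose_add = linear_add[OF bounded_linear.linear[OF bounded_linear_transpose]]
lemmas transpose_diff = linear_diff[OF bounded_linear.linear[OF bounded_linear_transpose]]
lemma inner_transpose: "x \<bullet> (transpose A *v y) = (A *v x) \<bullet> y" for A :: "real^'n^'m"
  by (metis dot_lmul_matrix inner_commute transpose_matrix_vector)

section \<open>Inverse matrices\<close>

text \<open>On singular matrices the inverse is a single arbitrary constant. It is therefore a Borel function
  on all matrices, and no case distinction is needed when it is composed with random matrices.\<close>
lemma matrix_inv_not_invertible:
  "\<not> invertible A \<Longrightarrow> matrix_inv A = (SOME B::real^'n^'n. False)"
  unfolding matrix_inv_def invertible_def by metis

lemma matrix_inv_mult:
  assumes "invertible (A::real^'n^'n)"
  shows "A ** matrix_inv A = mat 1" "matrix_inv A ** A = mat 1"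
  using assms unfolding matrix_inv_def invertible_def by (metis (mono_tags, lifting) someI_ex)+

lemma matrix_inv_unique:
  assumes "A ** B = mat 1" shows "invertible (A::real^'n^'n)" "matrix_inv A = B"
proof -
  show inv: "invertible A" using assms invertible_right_inverse by blast
  have "matrix_inv A = matrix_inv A ** (A ** B)" by (simp add: assms)
  also have "\<dots> = B" by (simp add: matrix_mul_assoc matrix_inv_mult[OF inv])
  finally show "matrix_inv A = B" .
qed

text \<open>Cramer's rule; it reduces continuity of the inverse to that of the determinant.\<close>
lemma matrix_inv_component:
  assumes "invertible (A::real^'n^'n)"
  shows "matrix_inv A $ k $ l =
    det (\<chi> i j. if j = k then axis l 1 $ i else A $ i $ j) / det A"
proof -
  have "A *v (matrix_inv A *v axis l 1) = axis l 1"
    by (simp add: matrix_vector_mul_assoc matrix_inv_mult[OF assms])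
  then have "matrix_inv A *v axis l 1 =
      (\<chi> k. det (\<chi> i j. if j = k then axis l 1 $ i else A $ i $ j) / det A)"
    using assms cramer invertible_det_nz by blast
  then have "(matrix_inv A *v axis l 1) $ k =
      det (\<chi> i j. if j = k then axis l 1 $ i else A $ i $ j) / det A" by simp
  then show ?thesis by (simp add: matrix_vector_mult_basis column_def)
qed

lemma tendsto_det [tendsto_intros]:
  assumes "(f \<longlongrightarrow> A) F" shows "((\<lambda>x. det (f x)) \<longlongrightarrow> det (A::real^'n^'n)) F"
  unfolding det_def by (intro tendsto_intros assms)

lemma eventually_invertible:
  assumes "(f \<longlongrightarrow> A) F" "invertible (A::real^'n^'n)"
  shows "eventually (\<lambda>x. invertible (f x)) F"
  using tendsto_imp_eventually_ne[OF tendsto_det[OF assms(1)]] assms(2)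
  by (simp add: invertible_det_nz)

lemma tendsto_matrix_inv [tendsto_intros]:
  assumes f: "(f \<longlongrightarrow> A) F" and A: "invertible (A::real^'n^'n)"
  shows "((\<lambda>x. matrix_inv (f x)) \<longlongrightarrow> matrix_inv A) F"
proof (intro vec_tendstoI)
  fix k l
  have "((\<lambda>x. det (\<chi> i j. if j = k then axis l 1 $ i else f x $ i $ j) / det (f x))
      \<longlongrightarrow> matrix_inv A $ k $ l) F"
    unfolding matrix_inv_component[OF A] det_def[of "\<chi> i j. _ i j"]
    using A by (auto simp: invertible_det_nz if_distrib cong: if_cong intro!: tendsto_intros f)
  then show "((\<lambda>x. matrix_inv (f x) $ k $ l) \<longlongrightarrow> matrix_inv A $ k $ l) F"
    by (rule Lim_transform_eventually)
      (use eventually_invertible[OF f A] in eventually_elim, simp add: matrix_inv_component)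
qed

lemma continuous_on_det: "continuous_on S (det :: real^'n^'n \<Rightarrow> real)"
  unfolding continuous_on_def by (auto intro: tendsto_det)

lemma measurable_matrix_inv: "(matrix_inv :: real^'n^'n \<Rightarrow> _) \<in> borel_measurable borel"
proof -
  have o: "open {A::real^'n^'n. invertible A}"
    unfolding invertible_det_nz by (intro open_Collect_neq continuous_intros continuous_on_det)
  have c: "continuous_on {A::real^'n^'n. invertible A} matrix_inv"
    unfolding continuous_on_def by (auto intro: tendsto_matrix_inv)
  have m: "(\<lambda>A::real^'n^'n. if A \<in> {A. invertible A} then matrix_inv A else (SOME B. False))
      \<in> borel_measurable borel"
    by (rule borel_measurable_continuous_on_if) (use o c in auto)
  then show ?thesis
    by (rule back_subst[of "\<lambda>f. f \<in> borel_measurable borel"]) (auto simp: matrix_inv_not_invertible)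
qed

section \<open>Positive definite matrices and their square roots\<close>

lemma pos_def_sym: "pos_def S \<Longrightarrow> transpose S = S"
  by (simp add: pos_def_def)

lemma sym_inner: "transpose S = S \<Longrightarrow> x \<bullet> (S *v y) = (S *v x) \<bullet> y" for S :: "real^'n^'n"
  using inner_transpose[of x S y] by simp

lemma pos_def_pos: "pos_def S \<Longrightarrow> x \<noteq> 0 \<Longrightarrow> 0 < x \<bullet> (S *v x)"
  by (simp add: pos_def_def)

lemma pos_def_nonneg: "pos_def S \<Longrightarrow> 0 \<le> x \<bullet> (S *v x)"
  by (cases "x = 0") (auto simp: less_imp_le pos_def_pos)

lemma pos_def_invertible: assumes "pos_def S" shows "invertible S"
proof -
  have "x = 0" if "S *v x = 0" for x using pos_def_pos[OF assms, of x] that by auto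
  then show ?thesis
    by (meson invertible_left_inverse matrix_left_invertible_ker)
qed

lemma transpose_matrix_inv:
  assumes "invertible (S::real^'n^'n)" "transpose S = S"
  shows "transpose (matrix_inv S) = matrix_inv S"
proof -
  have "S ** transpose (matrix_inv S) = transpose (matrix_inv S ** S)"
    using assms(2) by (simp add: matrix_transpose_mul)
  also have "\<dots> = mat 1" by (simp add: matrix_inv_mult[OF assms(1)])
  finally show ?thesis by (rule matrix_inv_unique(2)[symmetric])
qed

lemma pos_def_matrix_inv: assumes "pos_def S" shows "pos_def (matrix_inv S)"
proof -
  note inv = matrix_inv_mult[OF pos_def_invertible[OF assms]]
  have sym: "transpose (matrix_inv S) = matrix_inv S"
    by (rule transpose_matrix_inv[OF pos_def_invertible[OF assms] pos_def_sym[OF assms]])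
  have "0 < x \<bullet> (matrix_inv S *v x)" if "x \<noteq> 0" for x
  proof -
    define y where "y = matrix_inv S *v x"
    have x: "x = S *v y" by (simp add: y_def matrix_vector_mul_assoc inv)
    then have "y \<noteq> 0" using that by auto
    then have "0 < y \<bullet> x" using pos_def_pos[OF assms] x by auto
    then show ?thesis by (simp add: y_def inner_commute)
  qed
  then show ?thesis using sym by (simp add: pos_def_def)
qed

text \<open>The quadratic form attains its minimum on the unit sphere.\<close>
lemma pos_def_lower_bound:
  assumes "pos_def (S::real^'n^'n)"
  obtains e where "0 < e" "\<And>x. e * (norm x)\<^sup>2 \<le> x \<bullet> (S *v x)"
proof -
  have "continuous_on (sphere 0 1) (\<lambda>x. x \<bullet> (S *v x))"
    by (intro continuous_intros linear_continuous_on) (simp add: matrix_vector_mul_bounded_linear)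
  then obtain x0 where x0: "x0 \<in> sphere 0 1"
      "\<And>x. x \<in> sphere 0 1 \<Longrightarrow> x0 \<bullet> (S *v x0) \<le> x \<bullet> (S *v x)"
    using continuous_attains_inf[OF compact_sphere, of 0 1 "\<lambda>x. x \<bullet> (S *v x)"] by auto
  let ?e = "x0 \<bullet> (S *v x0)"
  have "x0 \<noteq> 0" using x0(1) by auto
  then have "0 < ?e" by (rule pos_def_pos[OF assms])
  moreover have "?e * (norm x)\<^sup>2 \<le> x \<bullet> (S *v x)" for x
  proof (cases "x = 0")
    case False
    let ?y = "(1 / norm x) *\<^sub>R x"
    have "?y \<in> sphere 0 1" using False by simp
    then have "?e \<le> ?y \<bullet> (S *v ?y)" by (rule x0(2))
    also have "\<dots> = (x \<bullet> (S *v x)) / (norm x)\<^sup>2"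
      by (simp add: matrix_vector_mult_scaleR power2_eq_square)
    finally show ?thesis using False by (simp add: field_simps)
  qed simp
  ultimately show thesis using that by blast
qed

lemma quadratic_form_bound: "\<bar>x \<bullet> (A *v y)\<bar> \<le> norm A * norm x * norm y" for A :: "real^'n^'m"
proof -
  have "\<bar>x \<bullet> (A *v y)\<bar> \<le> norm x * norm (A *v y)" by (rule Cauchy_Schwarz_ineq2)
  also have "\<dots> \<le> norm x * (norm A * norm y)" by (intro mult_left_mono norm_matrix_vector_le) simp
  finally show ?thesis by (simp add: algebra_simps)
qed

lemma eventually_pos_def:
  assumes f: "(f \<longlongrightarrow> A) F" and A: "pos_def (A::real^'n^'n)"
    and sym: "eventually (\<lambda>x. transpose (f x) = f x) F"
  shows "eventually (\<lambda>x. pos_def (f x)) F"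
proof -
  obtain e where e: "0 < e" "\<And>x. e * (norm x)\<^sup>2 \<le> x \<bullet> (A *v x)"
    using pos_def_lower_bound[OF A] by blast
  have "eventually (\<lambda>x. dist (f x) A < e) F" using f e(1) by (rule tendstoD)
  then show ?thesis using sym
  proof eventually_elim
    case (elim z)
    have "0 < x \<bullet> (f z *v x)" if "x \<noteq> 0" for x
    proof -
      have "\<bar>x \<bullet> ((f z - A) *v x)\<bar> \<le> norm (f z - A) * norm x * norm x"
        by (rule quadratic_form_bound)
      also have "\<dots> < e * (norm x)\<^sup>2"
        using elim that by (simp add: dist_norm power2_eq_square)
      also have "\<dots> \<le> x \<bullet> (A *v x)" by (rule e)
      finally show ?thesis by (simp add: algebra_simps)
    qed
    then show ?case by (simp add: pos_def_def elim)
  qed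
qed

text \<open>The difference \<open>D\<close> of two square roots \<open>R\<close>, \<open>Q\<close> satisfies \<open>R D + D Q = R\<^sup>2 - Q\<^sup>2 = 0\<close>. In the trace
  of \<open>D\<^sup>T (R D + D Q)\<close> both terms are sums of values of positive definite forms, at the columns
  and at the rows of \<open>D\<close>, so \<open>D = 0\<close>.\<close>
lemma pos_def_sqrt_unique:
  assumes R: "pos_def R" and Q: "pos_def Q" and eq: "R ** R = Q ** (Q::real^'n^'n)"
  shows "R = Q"
proof -
  define D where "D = R - Q"
  have RDQ: "R ** D + D ** Q = 0"
    by (simp add: D_def matrix_diff_ldistrib matrix_diff_rdistrib eq)
  have RD: "(R ** D) $ i $ j = (R *v column j D) $ i" for i j
    by (simp add: matrix_matrix_mult_def matrix_vector_mult_def column_def)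
  have sym: "Q $ k $ j = Q $ j $ k" for j k
    using pos_def_sym[OF Q] by (simp add: transpose_def vec_eq_iff)
  have DQ: "(D ** Q) $ i $ j = (Q *v row i D) $ j" for i j
    by (simp add: matrix_matrix_mult_def matrix_vector_mult_def row_def sym[of _ j] mult.commute)
  have *: "(R *v column j D) $ i + (Q *v row i D) $ j = 0" for i j
  proof -
    have "(R ** D + D ** Q) $ i $ j = 0" by (simp only: RDQ zero_index)
    then show ?thesis by (simp only: vector_add_component RD DQ)
  qed
  have "0 = (\<Sum>i\<in>UNIV. \<Sum>j\<in>UNIV. D $ i $ j * ((R *v column j D) $ i + (Q *v row i D) $ j))"
    by (simp add: *)
  also have "\<dots> = (\<Sum>i\<in>UNIV. \<Sum>j\<in>UNIV. D $ i $ j * (R *v column j D) $ i)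
      + (\<Sum>i\<in>UNIV. \<Sum>j\<in>UNIV. D $ i $ j * (Q *v row i D) $ j)"
    by (simp add: distrib_left sum.distrib)
  also have "(\<Sum>i\<in>UNIV. \<Sum>j\<in>UNIV. D $ i $ j * (R *v column j D) $ i)
      = (\<Sum>j\<in>UNIV. column j D \<bullet> (R *v column j D))"
    by (subst sum.swap) (simp add: inner_vec_def column_def)
  also have "(\<Sum>i\<in>UNIV. \<Sum>j\<in>UNIV. D $ i $ j * (Q *v row i D) $ j)
      = (\<Sum>i\<in>UNIV. row i D \<bullet> (Q *v row i D))"
    by (simp add: inner_vec_def row_def)
  finally have "(\<Sum>i\<in>UNIV. row i D \<bullet> (Q *v row i D)) \<le> 0"
    using sum_nonneg[of UNIV "\<lambda>j. column j D \<bullet> (R *v column j D)"] pos_def_nonneg[OF R] by simp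
  then have "row i D \<bullet> (Q *v row i D) = 0" for i
    using pos_def_nonneg[OF Q] sum_nonneg_eq_0_iff[of UNIV "\<lambda>i. row i D \<bullet> (Q *v row i D)"]
    by (simp add: antisym sum_nonneg)
  then have "row i D = 0" for i using pos_def_pos[OF Q, of "row i D"] by auto
  then have "D = 0" by (simp add: row_def vec_eq_iff)
  then show ?thesis by (simp add: D_def)
qed

text \<open>Put \<open>E = I - S / c\<close> with \<open>c\<close> so large that the operator norm of \<open>E\<close> is at most some \<open>q < 1\<close>. On the
  symmetric matrices of operator norm at most \<open>r = 1 - sqrt (1 - q)\<close> the map \<open>Z \<mapsto> (E + Z\<^sup>2) / 2\<close> is
  a contraction, and for its fixed point \<open>(I - Z)\<^sup>2 = I - E = S / c\<close>. This avoids the spectral theorem.\<close>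
lemma pos_def_sqrt_exists:
  assumes S: "pos_def (S::real^'n^'n)"
  obtains R where "pos_def R" "R ** R = S"
proof -
  obtain e where e: "0 < e" "\<And>x. e * (norm x)\<^sup>2 \<le> x \<bullet> (S *v x)"
    using pos_def_lower_bound[OF S] by blast
  define K where "K = max (norm S) e"
  have K: "0 < K" "norm S \<le> K" "e \<le> K" using e by (auto simp: K_def)
  \<comment> \<open>With this \<open>c\<close>, \<open>\<parallel>x - S x / c\<parallel>\<^sup>2 \<le> (1 - 2 e / c + K\<^sup>2 / c\<^sup>2) \<parallel>x\<parallel>\<^sup>2 = (1 - e\<^sup>2 / K\<^sup>2) \<parallel>x\<parallel>\<^sup>2\<close>.\<close>
  define c where "c = K\<^sup>2 / e"
  have c: "0 < c" using e K by (simp add: c_def)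
  define E where "E = mat 1 - (1 / c) *\<^sub>R S"
  define q where "q = sqrt (1 - e\<^sup>2 / K\<^sup>2)"
  have eK: "e\<^sup>2 / K\<^sup>2 \<le> 1" using K e by (simp add: divide_le_eq power_mono)
  have q: "0 \<le> q" "q < 1" using eK e K by (auto simp: q_def)
  have E_bound: "norm (E *v x) \<le> q * norm x" for x
  proof -
    have Ex: "E *v x = x - (1 / c) *\<^sub>R (S *v x)"
      by (simp add: E_def algebra_simps scaleR_matrix_vector_assoc)
    have "norm (S *v x) \<le> K * norm x"
      using norm_matrix_vector_le[of S x] K(2) by (meson mult_right_mono norm_ge_zero order_trans)
    then have "(norm (S *v x))\<^sup>2 \<le> K\<^sup>2 * (norm x)\<^sup>2"
      by (metis norm_ge_zero power_mono power_mult_distrib)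
    then have 1: "(norm (S *v x))\<^sup>2 / c\<^sup>2 \<le> K\<^sup>2 * (norm x)\<^sup>2 / c\<^sup>2"
      using c by (simp add: divide_right_mono)
    have 2: "e * (norm x)\<^sup>2 / c \<le> x \<bullet> (S *v x) / c" using e(2) c by (simp add: divide_right_mono)
    have "(norm (E *v x))\<^sup>2 = (norm x)\<^sup>2 - 2 * (x \<bullet> (S *v x) / c) + (norm (S *v x))\<^sup>2 / c\<^sup>2"
      unfolding Ex power2_norm_eq_inner
      by (simp add: inner_diff_left inner_diff_right inner_commute power2_eq_square)
    also have "\<dots> \<le> (norm x)\<^sup>2 - 2 * (e * (norm x)\<^sup>2 / c) + K\<^sup>2 * (norm x)\<^sup>2 / c\<^sup>2"
      using 1 2 by linarith
    also have "\<dots> = (1 - e\<^sup>2 / K\<^sup>2) * (norm x)\<^sup>2"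
      using e K by (simp add: c_def field_simps power2_eq_square)
    also have "\<dots> = (q * norm x)\<^sup>2" using eK by (simp add: q_def power_mult_distrib)
    finally show ?thesis using q by (simp add: power2_le_iff_abs_le)
  qed
  define r where "r = 1 - sqrt (1 - q)"
  have r: "0 \<le> r" "r < 1" using q by (auto simp: r_def)
  \<comment> \<open>The radius is the fixed point of the scalar map \<open>z \<mapsto> (q + z\<^sup>2) / 2\<close>, so the ball is mapped into itself.\<close>
  have r_eq: "(q + r * r) / 2 = r"
    using q real_sqrt_mult_self[of "1 - q"] by (simp add: r_def field_simps)
  define \<Z> where "\<Z> = {Z::real^'n^'n. transpose Z = Z \<and> (\<forall>x. norm (Z *v x) \<le> r * norm x)}"
  define f where "f Z = (1 / 2) *\<^sub>R (E + Z ** Z)" for Z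
  have "closed {Z::real^'n^'n. transpose Z = Z}"
    by (rule closed_Collect_eq[OF linear_continuous_on[OF bounded_linear_transpose] continuous_on_id])
  moreover have "closed {Z::real^'n^'n. \<forall>x. norm (Z *v x) \<le> r * norm x}"
    by (intro closed_Collect_all closed_Collect_le continuous_on_norm continuous_on_const
        linear_continuous_on
        bounded_bilinear.bounded_linear_left[OF bounded_bilinear_matrix_vector_mult])
  ultimately have "closed \<Z>" unfolding \<Z>_def by (rule closed_Collect_conj)
  note complete = complete_eq_closed[THEN iffD2, OF this]
  have "0 \<in> \<Z>" using r by (simp add: \<Z>_def transpose_def vec_eq_iff)
  have E_sym: "transpose E = E"
    by (simp add: E_def transpose_diff transpose_scalar pos_def_sym[OF S])
  have f_in: "f Z \<in> \<Z>" if Z: "Z \<in> \<Z>" for Z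
  proof -
    have "norm (f Z *v x) \<le> r * norm x" for x
    proof -
      have "norm (Z *v (Z *v x)) \<le> r * norm (Z *v x)" using Z by (simp add: \<Z>_def)
      also have "\<dots> \<le> r * (r * norm x)" using Z r by (intro mult_left_mono) (auto simp: \<Z>_def)
      finally have "norm (E *v x + Z *v (Z *v x)) \<le> q * norm x + r * (r * norm x)"
        using E_bound[of x] norm_triangle_ineq[of "E *v x" "Z *v (Z *v x)"] by linarith
      then have "norm (f Z *v x) \<le> (q * norm x + r * (r * norm x)) / 2"
        by (simp add: f_def matrix_vector_mult_add_rdistrib matrix_vector_mul_assoc
            flip: scaleR_matrix_vector_assoc)
      also have "\<dots> = (q + r * r) / 2 * norm x" by (simp add: field_simps)
      also have "\<dots> = r * norm x" by (simp only: r_eq)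
      finally show ?thesis .
    qed
    moreover have "transpose (f Z) = f Z"
      using Z E_sym by (simp add: f_def \<Z>_def transpose_scalar transpose_add matrix_transpose_mul)
    ultimately show ?thesis by (simp add: \<Z>_def)
  qed
  have op_bound: "norm (Z ** D) \<le> r * norm D" if "Z \<in> \<Z>" for Z D :: "real^'n^'n"
  proof -
    have col: "row i (transpose (Z ** D)) = Z *v row i (transpose D)" for i
      by (simp add: vec_eq_iff column_def matrix_matrix_mult_def matrix_vector_mult_def)
    have "norm (Z ** D) = L2_set (\<lambda>i. norm (row i (transpose (Z ** D)))) UNIV"
      by (simp add: norm_transpose[symmetric, of "Z ** D"] norm_vec_def[of "transpose (Z ** D)"] row_def
          del: row_transpose)
    also have "\<dots> \<le> L2_set (\<lambda>i. r * norm (row i (transpose D))) UNIV"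
      using that unfolding col by (intro L2_set_mono) (auto simp: \<Z>_def)
    also have "\<dots> = r * norm D"
      using r by (simp add: norm_transpose[symmetric, of D] norm_vec_def[of "transpose D"] row_def
          L2_set_right_distrib del: row_transpose)
    finally show ?thesis .
  qed
  have contr: "dist (f Y) (f Z) \<le> r * dist Y Z" if Y: "Y \<in> \<Z>" and Z: "Z \<in> \<Z>" for Y Z
  proof -
    have eq: "f Y - f Z = (1 / 2) *\<^sub>R (Y ** (Y - Z) + (Y - Z) ** Z)"
      by (simp add: f_def matrix_diff_ldistrib matrix_diff_rdistrib algebra_simps)
    have "norm ((Y - Z) ** Z) = norm (transpose ((Y - Z) ** Z))" by (simp only: norm_transpose)
    also have "\<dots> = norm (Z ** transpose (Y - Z))" using Z by (simp add: matrix_transpose_mul \<Z>_def)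
    also have "\<dots> \<le> r * norm (Y - Z)" using op_bound[OF Z, of "transpose (Y - Z)"] by (simp only: norm_transpose)
    finally have "norm (Y ** (Y - Z) + (Y - Z) ** Z) \<le> 2 * (r * norm (Y - Z))"
      using op_bound[OF Y, of "Y - Z"] norm_triangle_ineq[of "Y ** (Y - Z)" "(Y - Z) ** Z"] by linarith
    then show ?thesis by (simp add: dist_norm eq)
  qed
  obtain Z where Z: "Z \<in> \<Z>" "f Z = Z"
    using Banach_fix[OF complete _ r, of f] \<open>0 \<in> \<Z>\<close> f_in contr by blast
  have fix_eq: "Z + Z = E + Z ** Z"
  proof -
    have "Z + Z = f Z + f Z" using Z(2) by simp
    also have "\<dots> = E + Z ** Z" by (simp add: f_def flip: scaleR_left_distrib)
    finally show ?thesis .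
  qed
  define R where "R = sqrt c *\<^sub>R (mat 1 - Z)"
  have "(mat 1 - Z) ** (mat 1 - Z) = mat 1 - E"
    using fix_eq by (simp add: matrix_diff_ldistrib matrix_diff_rdistrib algebra_simps)
  then have "R ** R = S"
    using c by (simp add: R_def matrix_scaleR_left matrix_scaleR_right E_def)
  moreover have "pos_def R"
  proof -
    have "0 < x \<bullet> ((mat 1 - Z) *v x)" if "x \<noteq> 0" for x
    proof -
      have "x \<bullet> (Z *v x) \<le> norm x * norm (Z *v x)" by (rule norm_cauchy_schwarz)
      also have "\<dots> \<le> norm x * (r * norm x)" using Z(1) by (intro mult_left_mono) (auto simp: \<Z>_def)
      also have "\<dots> < norm x * norm x" using r that by simp
      finally show ?thesis by (simp add: algebra_simps dot_square_norm power2_eq_square)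
    qed
    moreover have "transpose (mat 1 - Z) = mat 1 - Z" using Z(1) by (simp add: transpose_diff \<Z>_def)
    ultimately show ?thesis using c
      by (simp add: R_def pos_def_def transpose_scalar flip: scaleR_matrix_vector_assoc)
  qed
  ultimately show thesis using that by blast
qed

text \<open>Existence and uniqueness of the root make the definite description in the definition of
  \<open>inv_sqrt_matrix\<close> meaningful.\<close>
lemma inv_sqrt_matrix:
  assumes "pos_def S"
  shows "pos_def (inv_sqrt_matrix S)"
    and "inv_sqrt_matrix S ** inv_sqrt_matrix S = matrix_inv S"
proof -
  obtain R where "pos_def R" "R ** R = matrix_inv S"
    by (rule pos_def_sqrt_exists[OF pos_def_matrix_inv[OF assms]])
  then have "\<exists>!R. pos_def R \<and> R ** R = matrix_inv S"
    by (metis pos_def_sqrt_unique)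
  then have "pos_def (inv_sqrt_matrix S) \<and> inv_sqrt_matrix S ** inv_sqrt_matrix S = matrix_inv S"
    unfolding inv_sqrt_matrix_def by (rule theI')
  then show "pos_def (inv_sqrt_matrix S)"
    "inv_sqrt_matrix S ** inv_sqrt_matrix S = matrix_inv S" by auto
qed

lemma norm_inv_sqrt_matrix_mult:
  assumes "pos_def S"
  shows "(norm (inv_sqrt_matrix S *v x))\<^sup>2 = x \<bullet> (matrix_inv S *v x)"
  unfolding power2_norm_eq_inner inv_sqrt_matrix(2)[OF assms, symmetric]
  by (metis inv_sqrt_matrix(1)[OF assms] matrix_vector_mul_assoc pos_def_sym sym_inner)

section \<open>The total least squares objective\<close>

definition gram :: "real^'d^'n \<Rightarrow> real^'d^'d" where
  "gram X = mat 1 + transpose X ** X"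

lemma gram_mult: "gram X *v y = y + transpose X *v (X *v y)"
  by (simp add: gram_def matrix_vector_mult_add_rdistrib matrix_vector_mul_assoc)

lemma gram_inner: "y \<bullet> (gram X *v y) = (norm y)\<^sup>2 + (norm (X *v y))\<^sup>2"
  by (simp add: gram_mult inner_add_right inner_transpose power2_norm_eq_inner)

lemma gram_sym: "transpose (gram X) = gram X"
  by (simp add: gram_def transpose_add matrix_transpose_mul)

lemma pos_def_gram: "pos_def (gram X)"
proof -
  have "0 < y \<bullet> (gram X *v y)" if "y \<noteq> 0" for y
    using that by (simp add: gram_inner add_pos_nonneg)
  then show ?thesis by (simp add: pos_def_def gram_sym)
qed

lemma gram_inv_mult: "gram X *v (matrix_inv (gram X) *v y) = y"
  by (simp add: matrix_vector_mul_assoc matrix_inv_mult pos_def_invertible pos_def_gram)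

definition resid :: "real^'d^'n \<Rightarrow> real^'n \<Rightarrow> real^'d \<Rightarrow> real^'d" where
  "resid X a b = transpose X *v a - b"

text \<open>The least total cost of corrections for a given \<open>X\<close>; see \<open>tls_obj_le_cost\<close> and
  \<open>optimal_correction\<close>.\<close>
definition tls_obj :: "nat \<Rightarrow> (nat \<Rightarrow> real^'n) \<Rightarrow> (nat \<Rightarrow> real^'d) \<Rightarrow> real^'d^'n \<Rightarrow> real" where
  "tls_obj m a b X = (\<Sum>i=1..m. resid X (a i) (b i) \<bullet> (matrix_inv (gram X) *v resid X (a i) (b i)))"

text \<open>Completing the square: with \<open>r = X\<^sup>T e - f\<close> and \<open>y = (I + X\<^sup>T X)\<^sup>-\<^sup>1 r\<close> the difference of the two
  sides is \<open>\<parallel>e - X y\<parallel>\<^sup>2 + \<parallel>f + y\<parallel>\<^sup>2\<close>, which also shows where equality holds.\<close>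
lemma correction_cost_ge:
  fixes X :: "real^'d^'n"
  shows "(transpose X *v e - f) \<bullet> (matrix_inv (gram X) *v (transpose X *v e - f))
    \<le> (norm e)\<^sup>2 + (norm f)\<^sup>2"
proof -
  define r where "r = transpose X *v e - f"
  define y where "y = matrix_inv (gram X) *v r"
  have "0 \<le> (norm (e - X *v y))\<^sup>2 + (norm (f + y))\<^sup>2" by simp
  also have "\<dots> = (norm e)\<^sup>2 + (norm f)\<^sup>2 - 2 * (y \<bullet> r) + y \<bullet> (gram X *v y)"
    unfolding gram_inner unfolding r_def power2_norm_eq_inner
    by (simp add: inner_diff_left inner_diff_right inner_add_left inner_add_right inner_transpose
        inner_commute)
  also have "gram X *v y = r" by (simp add: y_def gram_inv_mult)
  finally show ?thesis by (simp add: y_def r_def inner_commute)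
qed

lemma tls_obj_le_cost:
  assumes "tls_feasible m a b X da db"
  shows "tls_obj m a b X \<le> tls_cost m da db"
proof -
  have "resid X (a i) (b i) = transpose X *v da i - db i" if "i \<in> {1..m}" for i
    using assms that
    by (auto simp: tls_feasible_def resid_def matrix_vector_mult_diff_distrib algebra_simps)
  then show ?thesis
    using correction_cost_ge[of X]
    by (simp add: tls_obj_def tls_cost_def flip: sum.distrib) (intro sum_mono, simp)
qed

lemma optimal_correction:
  defines "y \<equiv> \<lambda>X a b. matrix_inv (gram X) *v resid X a b"
  shows "tls_feasible m a b X (\<lambda>i. X *v y X (a i) (b i)) (\<lambda>i. - y X (a i) (b i))"
    and "tls_cost m (\<lambda>i. X *v y X (a i) (b i)) (\<lambda>i. - y X (a i) (b i)) = tls_obj m a b X"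
proof -
  have gy: "gram X *v y X a b = resid X a b" for a b
    by (simp add: y_def gram_inv_mult)
  then have "y X a b + transpose X *v (X *v y X a b) = transpose X *v a - b" for a b
    unfolding gram_mult resid_def .
  then show "tls_feasible m a b X (\<lambda>i. X *v y X (a i) (b i)) (\<lambda>i. - y X (a i) (b i))"
    by (simp add: tls_feasible_def matrix_vector_mult_diff_distrib algebra_simps)
  have "(norm (X *v y X a b))\<^sup>2 + (norm (y X a b))\<^sup>2 = resid X a b \<bullet> y X a b" for a b
    using gram_inner[of "y X a b" X] by (simp add: gy inner_commute)
  then show "tls_cost m (\<lambda>i. X *v y X (a i) (b i)) (\<lambda>i. - y X (a i) (b i)) = tls_obj m a b X"
    by (simp add: tls_cost_def tls_obj_def y_def flip: sum.distrib)
qed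

lemma tls_solution_minimizes:
  assumes sol: "tls_solution m a b X da db"
  shows "tls_obj m a b X \<le> tls_obj m a b X'"
proof -
  have "tls_obj m a b X \<le> tls_cost m da db"
    using sol by (intro tls_obj_le_cost) (simp add: tls_solution_def)
  also have "\<dots> \<le> tls_obj m a b X'"
    using sol optimal_correction(1)[where m=m and a=a and b=b and X=X']
    by (simp add: tls_solution_def flip: optimal_correction(2)[where m=m and a=a and b=b and X=X'])
  finally show ?thesis .
qed

lemma minimizer_tls_solution:
  assumes "\<And>X'. tls_obj m a b X \<le> tls_obj m a b X'"
  shows "\<exists>da db. tls_solution m a b X da db"
proof (intro exI)
  show "tls_solution m a b X (\<lambda>i. X *v (matrix_inv (gram X) *v resid X (a i) (b i)))
      (\<lambda>i. - (matrix_inv (gram X) *v resid X (a i) (b i)))"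
    unfolding tls_solution_def optimal_correction(2)
    using optimal_correction(1) assms tls_obj_le_cost order_trans by blast
qed

text \<open>A quadratic polynomial that is nonnegative and vanishes at \<open>0\<close> has no linear term. This
  replaces differentiation in the two places where a minimum is exploited.\<close>
lemma linear_term_zero:
  fixes p q :: real
  assumes "\<And>t. 0 \<le> t * p + t\<^sup>2 * q"
  shows "p = 0"
proof (rule ccontr)
  assume "p \<noteq> 0"
  have q: "0 \<le> q" using assms[of 1] assms[of "-1"] by simp
  have "(- p / (q + 1)) * p + (- p / (q + 1))\<^sup>2 * q = - p\<^sup>2 / (q + 1)\<^sup>2"
    using q by (simp add: field_simps power2_eq_square add_nonneg_eq_0_iff)
  also have "\<dots> < 0" using q \<open>p \<noteq> 0\<close> by (simp add: divide_neg_pos)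
  finally show False using assms[of "- p / (q + 1)"] by linarith
qed

lemma est_fun_eq:
  "est_fun a b X = outer (a - X *v (matrix_inv (gram X) *v resid X a b)) (resid X a b)"
  by (simp add: est_fun_def matrix_mult_outer matrix_vector_mul_assoc
      bounded_bilinear.diff_left[OF bounded_bilinear_outer] flip: gram_def resid_def)

text \<open>Keep the corrected regressors \<open>a'\<^sub>i = a\<^sub>i - X y\<^sub>i\<close> of the minimiser and move \<open>X\<close> in a direction
  \<open>h k\<^sup>T\<close>. The cost is then a quadratic polynomial in the step, minimal at \<open>0\<close>, with linear coefficient
  \<open>2 \<Sum> (h \<bullet> a'\<^sub>i) (k \<bullet> y\<^sub>i)\<close>. So \<open>\<Sum> a'\<^sub>i y\<^sub>i\<^sup>T = 0\<close>, and multiplication by \<open>I + X\<^sup>T X\<close> turns \<open>y\<^sub>i\<close> into the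
  residual. The inverse \<open>(I + X\<^sup>T X)\<^sup>-\<^sup>1\<close> is never differentiated.\<close>
lemma estimating_equation:
  assumes min: "\<And>X'. tls_obj m a b X \<le> tls_obj m a b X'"
  shows "(\<Sum>i=1..m. est_fun (a i) (b i) X) = 0"
proof -
  define y where "y i = matrix_inv (gram X) *v resid X (a i) (b i)" for i
  define a' where "a' i = a i - X *v y i" for i
  have "resid X (a i) (b i) = gram X *v y i" for i by (simp add: y_def gram_inv_mult)
  then have "transpose X *v a i - b i = y i + transpose X *v (X *v y i)" for i
    by (simp add: resid_def gram_mult)
  then have Xa': "transpose X *v a' i = b i + y i" for i
    by (simp add: a'_def matrix_vector_mult_diff_distrib algebra_simps)
  have zero: "(\<Sum>i=1..m. (h \<bullet> a' i) * (k \<bullet> y i)) = 0" for h k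
  proof -
    have "0 \<le> t * (2 * (\<Sum>i=1..m. (h \<bullet> a' i) * (k \<bullet> y i))) + t\<^sup>2 * (\<Sum>i=1..m. (h \<bullet> a' i)\<^sup>2 * (k \<bullet> k))"
      for t
    proof -
      define X' where "X' = X + t *\<^sub>R outer h k"
      define db where "db i = - (y i + (t * (h \<bullet> a' i)) *\<^sub>R k)" for i
      have "transpose X' *v a' i = b i - db i" for i
        by (simp add: X'_def transpose_add transpose_scalar transpose_outer matrix_vector_mult_add_rdistrib
            Xa' db_def outer_mult_vec flip: scaleR_matrix_vector_assoc)
      then have "tls_feasible m a b X' (\<lambda>i. X *v y i) db"
        by (simp add: tls_feasible_def a'_def)
      then have "tls_obj m a b X \<le> tls_cost m (\<lambda>i. X *v y i) db"
        using tls_obj_le_cost min order_trans by blast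
      also have "\<dots> = tls_cost m (\<lambda>i. X *v y i) (\<lambda>i. - y i)
          + (\<Sum>i=1..m. t * (2 * ((h \<bullet> a' i) * (k \<bullet> y i))) + t\<^sup>2 * ((h \<bullet> a' i)\<^sup>2 * (k \<bullet> k)))"
        unfolding tls_cost_def db_def norm_minus_cancel add.assoc sum.distrib[symmetric]
        unfolding power2_norm_eq_inner
        by (intro arg_cong2[where f="(+)"] refl sum.cong)
          (simp add: inner_add_left inner_add_right inner_commute power2_eq_square algebra_simps)
      also have "tls_cost m (\<lambda>i. X *v y i) (\<lambda>i. - y i) = tls_obj m a b X"
        unfolding y_def by (rule optimal_correction)
      finally show ?thesis by (simp add: sum.distrib sum_distrib_left)
    qed
    then have "2 * (\<Sum>i=1..m. (h \<bullet> a' i) * (k \<bullet> y i)) = 0" by (rule linear_term_zero)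
    then show ?thesis by simp
  qed
  have "(\<Sum>i=1..m. outer (a' i) (y i)) = 0"
    using zero[of "axis _ 1" "axis _ 1"]
    by (simp add: vec_eq_iff outer_def inner_axis' )
  moreover have "est_fun (a i) (b i) X = outer (a' i) (y i) ** gram X" for i
    by (simp add: est_fun_eq outer_mult_matrix gram_sym a'_def y_def gram_inv_mult)
  moreover have "(\<Sum>i=1..m. outer (a' i) (y i) ** gram X) = (\<Sum>i=1..m. outer (a' i) (y i)) ** gram X"
    by (rule bounded_bilinear.sum_left[OF bounded_bilinear_matrix_mult, symmetric])
  ultimately show ?thesis by (simp add: bounded_bilinear.zero_left[OF bounded_bilinear_matrix_mult])
qed

lemma avg_quadratic: "avg m (\<lambda>i. (x \<bullet> u i) * (y \<bullet> v i)) = x \<bullet> (avg m (\<lambda>i. outer (u i) (v i)) *v y)"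
proof -
  have "avg m (\<lambda>i. outer (u i) (v i)) *v y = (1 / real m) *\<^sub>R (\<Sum>i=1..m. outer (u i) (v i) *v y)"
    by (simp add: avg_def bounded_bilinear.sum_left[OF bounded_bilinear_matrix_vector_mult]
        flip: scaleR_matrix_vector_assoc)
  then show ?thesis
    by (simp add: avg_def outer_mult_vec inner_sum_right sum_distrib_left algebra_simps inner_commute)
qed

text \<open>With \<open>I + X\<^sup>T X = S\<^sup>2\<close> take \<open>R = S\<^sup>-\<^sup>1\<close>. Along the rows of \<open>R\<close> the objective becomes a sum of
  squares, so that bounds on the quadratic forms of the moment matrices can be applied row by row.\<close>
lemma gram_whitening:
  fixes X :: "real^'d^'n"
  obtains R :: "real^'d^'d" where
    "\<And>r. r \<bullet> (matrix_inv (gram X) *v r) = (\<Sum>j\<in>UNIV. (R $ j \<bullet> r)\<^sup>2)"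
    "(\<Sum>j\<in>UNIV. (R $ j) \<bullet> (gram X *v R $ j)) = real CARD('d)"
    "\<And>D :: real^'d^'n. (norm D)\<^sup>2 \<le> (1 + (norm X)\<^sup>2) * (\<Sum>j\<in>UNIV. (norm (D *v R $ j))\<^sup>2)"
proof -
  obtain S where S: "pos_def S" "S ** S = gram X"
    using pos_def_sqrt_exists[OF pos_def_gram] by blast
  define R where "R = matrix_inv S"
  have R: "pos_def R" unfolding R_def by (rule pos_def_matrix_inv[OF S(1)])
  have SR: "S ** R = mat 1" "R ** S = mat 1"
    unfolding R_def by (rule matrix_inv_mult[OF pos_def_invertible[OF S(1)]])+
  have "gram X ** (R ** R) = S ** (S ** R) ** R"
    unfolding S(2)[symmetric] by (simp only: matrix_mul_assoc)
  then have RR: "matrix_inv (gram X) = R ** R"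
    using SR by (intro matrix_inv_unique(2)) simp
  have Rr: "(R *v r) $ j = R $ j \<bullet> r" for r j by (simp add: matrix_vector_mul_component)
  have norm_R: "(norm (R *v r))\<^sup>2 = (\<Sum>j\<in>UNIV. (R $ j \<bullet> r)\<^sup>2)" for r
    by (simp add: norm_vec_def L2_set_def sum_nonneg Rr)
  have 1: "r \<bullet> (matrix_inv (gram X) *v r) = (\<Sum>j\<in>UNIV. (R $ j \<bullet> r)\<^sup>2)" for r
    using sym_inner[OF pos_def_sym[OF R], of r "R *v r"]
    by (simp add: RR norm_R[symmetric] power2_norm_eq_inner flip: matrix_vector_mul_assoc)
  have row: "R *v axis j 1 = R $ j" for j
    using pos_def_sym[OF R]
    by (simp add: matrix_vector_mult_basis column_def vec_eq_iff transpose_def)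
  have "R $ j \<bullet> (gram X *v R $ j) = 1" for j
  proof -
    have "gram X *v R $ j = S *v (S *v (R *v axis j 1))"
      by (simp add: row S(2)[symmetric] matrix_vector_mul_assoc)
    also have "\<dots> = S *v axis j 1" by (simp add: matrix_vector_mul_assoc SR)
    finally have "R $ j \<bullet> (gram X *v R $ j) = (R *v (S *v axis j 1)) $ j" by (simp add: Rr)
    then show ?thesis by (simp add: matrix_vector_mul_assoc SR axis_def)
  qed
  then have 2: "(\<Sum>j\<in>UNIV. (R $ j) \<bullet> (gram X *v R $ j)) = real CARD('d)" by simp
  have 3: "(norm D)\<^sup>2 \<le> (1 + (norm X)\<^sup>2) * (\<Sum>j\<in>UNIV. (norm (D *v R $ j))\<^sup>2)" for D :: "real^'d^'n"
  proof -
    have bound: "(norm z)\<^sup>2 \<le> (1 + (norm X)\<^sup>2) * (norm (R *v z))\<^sup>2" for z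
    proof -
      define u where "u = R *v z"
      have "z = S *v u" by (simp add: u_def matrix_vector_mul_assoc SR)
      then have "(norm z)\<^sup>2 = u \<bullet> (gram X *v u)"
        using sym_inner[OF pos_def_sym[OF S(1)], of u "S *v u"]
        by (simp add: power2_norm_eq_inner S(2)[symmetric] flip: matrix_vector_mul_assoc)
      also have "\<dots> \<le> (norm u)\<^sup>2 + (norm X * norm u)\<^sup>2"
        unfolding gram_inner by (intro add_left_mono power_mono norm_matrix_vector_le norm_ge_zero)
      finally show ?thesis by (simp add: u_def algebra_simps power_mult_distrib)
    qed
    have "(norm D)\<^sup>2 = (\<Sum>i\<in>UNIV. (norm (D $ i))\<^sup>2)"
      by (simp add: norm_vec_def[of D] L2_set_def sum_nonneg)
    also have "\<dots> \<le> (\<Sum>i\<in>UNIV. (1 + (norm X)\<^sup>2) * (norm (R *v D $ i))\<^sup>2)"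
      by (intro sum_mono bound)
    also have "\<dots> = (1 + (norm X)\<^sup>2) * (\<Sum>i\<in>UNIV. \<Sum>j\<in>UNIV. (R $ j \<bullet> D $ i)\<^sup>2)"
      by (simp add: sum_distrib_left norm_R)
    also have "(\<Sum>i\<in>UNIV. \<Sum>j\<in>UNIV. (R $ j \<bullet> D $ i)\<^sup>2) = (\<Sum>j\<in>UNIV. (norm (D *v R $ j))\<^sup>2)"
      by (subst sum.swap)
        (simp add: norm_vec_def L2_set_def sum_nonneg matrix_vector_mul_component inner_commute)
    finally show ?thesis .
  qed
  show thesis using that[of R, OF 1 2 3] .
qed

section \<open>Averages\<close>

lemma avg_add: "avg m (\<lambda>i. f i + g i) = avg m f + avg m g"
  by (simp add: avg_def sum.distrib scaleR_add_right)

lemma avg_diff: "avg m (\<lambda>i. f i - g i) = avg m f - avg m g"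
  by (simp add: avg_def sum_subtractf scaleR_diff_right)

lemma avg_linear: "linear T \<Longrightarrow> T (avg m f) = avg m (\<lambda>i. T (f i))"
  by (simp add: avg_def linear_cmul linear_sum)

lemma avg_mult_left: "avg m (\<lambda>i. c * f i) = c * avg m f" for c :: real
  by (simp add: avg_def sum_distrib_left)

lemma avg_mono: "(\<And>i. f i \<le> g i) \<Longrightarrow> avg m f \<le> avg m g" for f :: "nat \<Rightarrow> real"
  by (simp add: avg_def divide_right_mono sum_mono)

lemma avg_nonneg: "(\<And>i. 0 \<le> f i) \<Longrightarrow> 0 \<le> avg m f" for f :: "nat \<Rightarrow> real"
  by (simp add: avg_def sum_nonneg)

lemma norm_avg_le: "norm (avg m f) \<le> avg m (\<lambda>i. norm (f i))"
  by (simp add: avg_def divide_right_mono norm_sum)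

lemma avg_Cauchy_Schwarz: "avg m (\<lambda>i. \<bar>f i\<bar> * \<bar>g i\<bar>) \<le> sqrt (avg m (\<lambda>i. (f i)\<^sup>2)) * sqrt (avg m (\<lambda>i. (g i)\<^sup>2))"
  using L2_set_mult_ineq[of f g "{1..m}"]
  by (simp add: avg_def L2_set_def real_sqrt_mult real_sqrt_divide divide_right_mono flip: real_sqrt_mult)

lemma avg_matrix_mult_left: "avg m (\<lambda>i. A ** f i) = A ** avg m f" for A :: "real^'n^'m"
  by (rule avg_linear[symmetric])
    (rule bounded_linear.linear[OF bounded_bilinear.bounded_linear_right[OF bounded_bilinear_matrix_mult]])

lemma avg_matrix_mult_right: "avg m (\<lambda>i. f i ** A) = avg m f ** A" for A :: "real^'n^'m"
  by (rule avg_linear[symmetric])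
    (rule bounded_linear.linear[OF bounded_bilinear.bounded_linear_left[OF bounded_bilinear_matrix_mult]])

lemma avg_matrix_vector_mult: "avg m (\<lambda>i. A *v f i) = A *v avg m f" for A :: "real^'n^'m"
  by (rule avg_linear[symmetric])
    (rule bounded_linear.linear[OF bounded_bilinear.bounded_linear_right[OF bounded_bilinear_matrix_vector_mult]])

lemma avg_matrix_vector_mult_left: "avg m (\<lambda>i. f i *v x) = avg m f *v x" for x :: "real^'n"
  by (rule avg_linear[symmetric])
    (rule bounded_linear.linear[OF bounded_bilinear.bounded_linear_left[OF bounded_bilinear_matrix_vector_mult]])

lemma avg_transpose: "avg m (\<lambda>i. transpose (f i)) = transpose (avg m f)"
  for f :: "nat \<Rightarrow> real^'n^'m"
  by (rule avg_linear[symmetric]) (rule bounded_linear.linear[OF bounded_linear_transpose])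

section \<open>Existence and consistency of the estimator\<close>

lemma resid_shift: "resid X a b = resid X0 a b + transpose (X - X0) *v a"
  by (simp add: resid_def transpose_diff matrix_vector_mult_diff_rdistrib)

text \<open>The objective and the estimating function at every \<open>X\<close> are determined by these three matrices,
  taken at the true \<open>X\<^sub>0\<close>. Their limits are \<open>V + s I\<close>, \<open>s X\<^sub>0\<close> and \<open>s (I + X\<^sub>0\<^sup>T X\<^sub>0)\<close> with \<open>s = \<sigma>\<^sup>2\<close>.\<close>
abbreviation moment_aa :: "nat \<Rightarrow> (nat \<Rightarrow> real^'n) \<Rightarrow> real^'n^'n" where
  "moment_aa m a \<equiv> avg m (\<lambda>i. outer (a i) (a i))"

abbreviation moment_ar ::
  "real^'d^'n \<Rightarrow> nat \<Rightarrow> (nat \<Rightarrow> real^'n) \<Rightarrow> (nat \<Rightarrow> real^'d) \<Rightarrow> real^'d^'n" where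
  "moment_ar X m a b \<equiv> avg m (\<lambda>i. outer (a i) (resid X (a i) (b i)))"

abbreviation moment_rr ::
  "real^'d^'n \<Rightarrow> nat \<Rightarrow> (nat \<Rightarrow> real^'n) \<Rightarrow> (nat \<Rightarrow> real^'d) \<Rightarrow> real^'d^'d" where
  "moment_rr X m a b \<equiv> avg m (\<lambda>i. outer (resid X (a i) (b i)) (resid X (a i) (b i)))"

lemma avg_resid_sq:
  fixes X X0 :: "real^'d^'n"
  shows "avg m (\<lambda>i. (y \<bullet> resid X (a i) (b i))\<^sup>2) =
    y \<bullet> (moment_rr X0 m a b *v y)
    + 2 * (((X - X0) *v y) \<bullet> (moment_ar X0 m a b *v y))
    + ((X - X0) *v y) \<bullet> (moment_aa m a *v ((X - X0) *v y))"
proof -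
  have eq: "(y \<bullet> resid X (a i) (b i))\<^sup>2 =
      (y \<bullet> resid X0 (a i) (b i)) * (y \<bullet> resid X0 (a i) (b i))
      + 2 * ((((X - X0) *v y) \<bullet> a i) * (y \<bullet> resid X0 (a i) (b i)))
      + (((X - X0) *v y) \<bullet> a i) * (((X - X0) *v y) \<bullet> a i)" for i
    unfolding resid_shift[of X "a i" "b i" X0] inner_add_right inner_transpose
    by (simp add: power2_eq_square algebra_simps)
  show ?thesis unfolding eq avg_add avg_mult_left avg_quadratic ..
qed

lemma quadratic_ge:
  fixes A B :: "real^'n^'m"
  assumes "norm (A - B) \<le> \<eta>"
  shows "x \<bullet> (B *v y) - \<eta> * (norm x * norm y) \<le> x \<bullet> (A *v y)"
    and "x \<bullet> (A *v y) \<le> x \<bullet> (B *v y) + \<eta> * (norm x * norm y)"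
proof -
  have "\<bar>x \<bullet> ((A - B) *v y)\<bar> \<le> norm (A - B) * norm x * norm y" by (rule quadratic_form_bound)
  also have "\<dots> \<le> \<eta> * (norm x * norm y)"
    using assms by (simp add: mult.assoc mult_right_mono)
  finally show "x \<bullet> (B *v y) - \<eta> * (norm x * norm y) \<le> x \<bullet> (A *v y)"
    and "x \<bullet> (A *v y) \<le> x \<bullet> (B *v y) + \<eta> * (norm x * norm y)"
    by (simp_all add: matrix_vector_mult_diff_rdistrib inner_diff_right)
qed

lemma norm_sq_add_le: "(norm (x + y))\<^sup>2 \<le> 2 * (norm x)\<^sup>2 + 2 * (norm y)\<^sup>2"
  for x y :: "'a::real_normed_vector"
proof -
  have "(norm (x + y))\<^sup>2 \<le> (norm x + norm y)\<^sup>2" by (intro power_mono norm_triangle_ineq norm_ge_zero)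
  also have "\<dots> \<le> 2 * (norm x)\<^sup>2 + 2 * (norm y)\<^sup>2"
    using sum_squares_bound[of "norm x" "norm y"] by (simp add: power2_sum)
  finally show ?thesis .
qed

text \<open>Here \<open>\<eta>\<close> measures the distance of the three moment matrices from their limits. At the limits
  the form \<open>avg (y \<bullet> r\<^sub>i)\<^sup>2\<close> equals \<open>s y\<^sup>T (I + X\<^sup>T X) y + z\<^sup>T V z\<close> with \<open>z = (X - X\<^sub>0) y\<close>; its first
  term contributes the same amount \<open>s d\<close> to the objective for every \<open>X\<close>, and the second one
  penalises the distance from \<open>X\<^sub>0\<close>.\<close>
context
  fixes X0 :: "real^'d^'n" and V :: "real^'n^'n" and a :: "nat \<Rightarrow> real^'n" and b :: "nat \<Rightarrow> real^'d"
    and m :: nat and \<eta> s lam :: real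
  assumes m: "1 \<le> m"
    and Maa: "norm (moment_aa m a - (V + s *\<^sub>R mat 1)) \<le> \<eta>"
    and N: "norm (moment_ar X0 m a b - s *\<^sub>R X0) \<le> \<eta>"
    and R0: "norm (moment_rr X0 m a b - s *\<^sub>R gram X0) \<le> \<eta>"
    and V: "\<And>x. lam * (norm x)\<^sup>2 \<le> x \<bullet> (V *v x)" and lam: "0 < lam"
begin

lemma eta_nonneg: "0 \<le> \<eta>" using R0 norm_ge_zero order_trans by blast

text \<open>The error term is at most \<open>\<eta> (\<parallel>y\<parallel> + \<parallel>z\<parallel>)\<^sup>2\<close>. It is compared with \<open>y\<^sup>T (I + X\<^sup>T X) y = \<parallel>y\<parallel>\<^sup>2 + \<parallel>X y\<parallel>\<^sup>2\<close>,
  and not with \<open>\<parallel>y\<parallel>\<^sup>2\<close>, in order to be uniform in the unbounded matrix \<open>X\<close>.\<close>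
lemma avg_resid_sq_ge:
  "s * (y \<bullet> (gram X *v y)) + lam * (norm ((X - X0) *v y))\<^sup>2
      - 4 * (1 + (norm X0)\<^sup>2) * \<eta> * (y \<bullet> (gram X *v y))
    \<le> avg m (\<lambda>i. (y \<bullet> resid X (a i) (b i))\<^sup>2)"
proof -
  define z where "z = (X - X0) *v y"
  have Xy: "X *v y = X0 *v y + z" by (simp add: z_def matrix_vector_mult_diff_rdistrib)
  have 1: "s * (y \<bullet> (gram X0 *v y)) - \<eta> * (norm y * norm y) \<le>
      y \<bullet> (moment_rr X0 m a b *v y)"
    using quadratic_ge(1)[OF R0, of y y] by (simp flip: scaleR_matrix_vector_assoc)
  have 2: "s * (z \<bullet> (X0 *v y)) - \<eta> * (norm z * norm y) \<le>
      z \<bullet> (moment_ar X0 m a b *v y)"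
    using quadratic_ge(1)[OF N, of z y] by (simp flip: scaleR_matrix_vector_assoc)
  have 3: "z \<bullet> (V *v z) + s * (z \<bullet> z) - \<eta> * (norm z * norm z) \<le>
      z \<bullet> (moment_aa m a *v z)"
    using quadratic_ge(1)[OF Maa, of z z]
    by (simp add: matrix_vector_mult_add_rdistrib inner_add_right flip: scaleR_matrix_vector_assoc)
  have "(norm z)\<^sup>2 \<le> 2 * (norm (X *v y))\<^sup>2 + 2 * (norm (- (X0 *v y)))\<^sup>2"
    using norm_sq_add_le[of "X *v y" "- (X0 *v y)"] by (simp add: Xy)
  also have "\<dots> \<le> 2 * (norm (X *v y))\<^sup>2 + 2 * (norm X0 * norm y)\<^sup>2"
    unfolding norm_minus_cancel
    by (intro add_left_mono mult_left_mono power_mono norm_matrix_vector_le) auto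
  finally have nz: "(norm z)\<^sup>2 \<le> 2 * (norm (X *v y))\<^sup>2 + 2 * (norm X0)\<^sup>2 * (norm y)\<^sup>2"
    by (simp add: power_mult_distrib)
  have "(norm y + norm z)\<^sup>2 \<le> 2 * (norm y)\<^sup>2 + 2 * (norm z)\<^sup>2"
    using sum_squares_bound[of "norm y" "norm z"] by (simp add: power2_sum)
  also have "\<dots> \<le> 2 * (norm y)\<^sup>2 + 4 * (norm (X *v y))\<^sup>2 + 4 * (norm X0)\<^sup>2 * (norm y)\<^sup>2"
    using nz by linarith
  also have "\<dots> \<le> 4 * (1 + (norm X0)\<^sup>2) * (y \<bullet> (gram X *v y))"
    unfolding gram_inner by (simp add: algebra_simps)
  finally have "\<eta> * (norm y + norm z)\<^sup>2 \<le> \<eta> * (4 * (1 + (norm X0)\<^sup>2) * (y \<bullet> (gram X *v y)))"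
    using eta_nonneg by (intro mult_left_mono)
  then have 4: "\<eta> * (norm y * norm y) + 2 * (\<eta> * (norm z * norm y)) + \<eta> * (norm z * norm z)
      \<le> 4 * (1 + (norm X0)\<^sup>2) * \<eta> * (y \<bullet> (gram X *v y))"
    by (simp add: power2_eq_square algebra_simps)
  have "s * (y \<bullet> (gram X *v y)) = s * (y \<bullet> (gram X0 *v y)) + 2 * (s * (z \<bullet> (X0 *v y))) + s * (z \<bullet> z)"
    unfolding gram_inner Xy power2_norm_eq_inner
    by (simp add: inner_add_left inner_add_right inner_commute algebra_simps)
  then show ?thesis
    unfolding avg_resid_sq[of m y X a b X0] z_def[symmetric] using 1 2 3 4 V[of z] by linarith
qed

lemma tls_obj_true_le: "tls_obj m a b X0 / m \<le> (s + \<eta>) * real CARD('d)"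
proof -
  obtain R :: "real^'d^'d" where R:
    "\<And>r. r \<bullet> (matrix_inv (gram X0) *v r) = (\<Sum>j\<in>UNIV. (R $ j \<bullet> r)\<^sup>2)"
    "(\<Sum>j\<in>UNIV. (R $ j) \<bullet> (gram X0 *v R $ j)) = real CARD('d)"
    by (rule gram_whitening[of X0]) blast
  have "tls_obj m a b X0 / m = (\<Sum>j\<in>UNIV. avg m (\<lambda>i. (R $ j \<bullet> resid X0 (a i) (b i))\<^sup>2))"
    unfolding tls_obj_def R(1) avg_def by (subst sum.swap) (simp add: sum_divide_distrib)
  also have "\<dots> \<le> (\<Sum>j\<in>UNIV. (s + \<eta>) * (R $ j \<bullet> (gram X0 *v R $ j)))"
  proof (rule sum_mono)
    fix j
    have "avg m (\<lambda>i. (R $ j \<bullet> resid X0 (a i) (b i))\<^sup>2)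
        = R $ j \<bullet> (moment_rr X0 m a b *v R $ j)"
      unfolding avg_resid_sq[of m _ X0 a b X0] by simp
    also have "\<dots> \<le> s * (R $ j \<bullet> (gram X0 *v R $ j)) + \<eta> * (norm (R $ j) * norm (R $ j))"
      using quadratic_ge(2)[OF R0, of "R $ j" "R $ j"] by (simp flip: scaleR_matrix_vector_assoc)
    also have "\<eta> * (norm (R $ j) * norm (R $ j)) \<le> \<eta> * (R $ j \<bullet> (gram X0 *v R $ j))"
      using eta_nonneg by (intro mult_left_mono) (simp_all add: gram_inner flip: power2_eq_square)
    finally show "avg m (\<lambda>i. (R $ j \<bullet> resid X0 (a i) (b i))\<^sup>2) \<le> (s + \<eta>) * (R $ j \<bullet> (gram X0 *v R $ j))"
      by (simp add: algebra_simps)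
  qed
  finally show ?thesis by (simp add: R(2) flip: sum_distrib_left)
qed

lemma tls_obj_ge:
  "s * real CARD('d) + lam * ((norm (X - X0))\<^sup>2 / (1 + (norm X)\<^sup>2))
      - 4 * (1 + (norm X0)\<^sup>2) * \<eta> * real CARD('d)
    \<le> tls_obj m a b X / m"
proof -
  obtain R :: "real^'d^'d" where R:
    "\<And>r. r \<bullet> (matrix_inv (gram X) *v r) = (\<Sum>j\<in>UNIV. (R $ j \<bullet> r)\<^sup>2)"
    "(\<Sum>j\<in>UNIV. (R $ j) \<bullet> (gram X *v R $ j)) = real CARD('d)"
    "\<And>D :: real^'d^'n. (norm D)\<^sup>2 \<le> (1 + (norm X)\<^sup>2) * (\<Sum>j\<in>UNIV. (norm (D *v R $ j))\<^sup>2)"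
    by (rule gram_whitening[of X]) blast
  have "0 < 1 + (norm X)\<^sup>2" by (simp add: add_pos_nonneg)
  then have "(norm (X - X0))\<^sup>2 / (1 + (norm X)\<^sup>2) \<le> (\<Sum>j\<in>UNIV. (norm ((X - X0) *v R $ j))\<^sup>2)"
    using R(3)[of "X - X0"] by (simp add: divide_le_eq mult.commute)
  then have "lam * ((norm (X - X0))\<^sup>2 / (1 + (norm X)\<^sup>2)) \<le> lam * (\<Sum>j\<in>UNIV. (norm ((X - X0) *v R $ j))\<^sup>2)"
    using lam by (intro mult_left_mono) auto
  then have "s * real CARD('d) + lam * ((norm (X - X0))\<^sup>2 / (1 + (norm X)\<^sup>2))
      - 4 * (1 + (norm X0)\<^sup>2) * \<eta> * real CARD('d)
    \<le> s * real CARD('d) + lam * (\<Sum>j\<in>UNIV. (norm ((X - X0) *v R $ j))\<^sup>2)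
      - 4 * (1 + (norm X0)\<^sup>2) * \<eta> * real CARD('d)" by linarith
  also have "\<dots> = (\<Sum>j\<in>UNIV. s * (R $ j \<bullet> (gram X *v R $ j)) + lam * (norm ((X - X0) *v R $ j))\<^sup>2
      - 4 * (1 + (norm X0)\<^sup>2) * \<eta> * (R $ j \<bullet> (gram X *v R $ j)))"
    by (simp only: sum_subtractf sum.distrib R(2) flip: sum_distrib_left)
  also have "\<dots> \<le> (\<Sum>j\<in>UNIV. avg m (\<lambda>i. (R $ j \<bullet> resid X (a i) (b i))\<^sup>2))"
    by (intro sum_mono avg_resid_sq_ge)
  also have "\<dots> = tls_obj m a b X / m"
    unfolding tls_obj_def R(1) avg_def by (subst sum.swap) (simp add: sum_divide_distrib)
  finally show ?thesis .
qed

definition tls_const :: real where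
  "tls_const = (5 + 4 * (norm X0)\<^sup>2) * real CARD('d)"

text \<open>The lower bound \<open>lam \<parallel>X - X\<^sub>0\<parallel>\<^sup>2 / (1 + \<parallel>X\<parallel>\<^sup>2)\<close> of the excess stays away from zero as \<open>X\<close> tends to
  infinity, so for small \<open>\<eta>\<close> the whole sublevel set of \<open>X\<^sub>0\<close> lies in a small ball.\<close>
lemma sublevel_close:
  assumes small: "4 * (tls_const * \<eta>) \<le> lam" and le: "tls_obj m a b X \<le> tls_obj m a b X0"
  shows "(norm (X - X0))\<^sup>2 \<le> 2 * (tls_const * \<eta>) * (1 + 2 * (norm X0)\<^sup>2) / lam"
proof -
  define \<epsilon> where "\<epsilon> = tls_const * \<eta>"
  define D where "D = (norm (X - X0))\<^sup>2"
  have \<epsilon>: "0 \<le> \<epsilon>" "4 * \<epsilon> \<le> lam" using eta_nonneg small by (simp_all add: \<epsilon>_def tls_const_def)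
  have pos: "0 < 1 + (norm X)\<^sup>2" by (simp add: add_pos_nonneg)
  have "tls_obj m a b X / m \<le> tls_obj m a b X0 / m" using le by (simp add: divide_right_mono)
  then have "lam * (D / (1 + (norm X)\<^sup>2)) \<le> \<epsilon>"
    using tls_obj_ge[of X] tls_obj_true_le by (simp add: \<epsilon>_def tls_const_def D_def algebra_simps)
  then have 1: "lam * D \<le> \<epsilon> * (1 + (norm X)\<^sup>2)" using pos by (simp add: divide_le_eq)
  have "(norm X)\<^sup>2 \<le> 2 * (norm X0)\<^sup>2 + 2 * D"
    using norm_sq_add_le[of X0 "X - X0"] by (simp add: D_def)
  then have "\<epsilon> * (1 + (norm X)\<^sup>2) \<le> \<epsilon> * (1 + (2 * (norm X0)\<^sup>2 + 2 * D))" using \<epsilon>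
    by (intro mult_left_mono) auto
  also have "\<dots> = \<epsilon> * (1 + 2 * (norm X0)\<^sup>2) + 2 * \<epsilon> * D" by (simp add: algebra_simps)
  also have "2 * \<epsilon> * D \<le> lam / 2 * D" using \<epsilon> by (intro mult_right_mono) (auto simp: D_def)
  finally have "lam * D \<le> 2 * \<epsilon> * (1 + 2 * (norm X0)\<^sup>2)" using 1 by simp
  then show ?thesis using lam by (simp add: D_def \<epsilon>_def field_simps)
qed

text \<open>A continuous function attains its minimum on the ball that contains the sublevel set of \<open>X\<^sub>0\<close>;
  outside the ball it is larger than at \<open>X\<^sub>0\<close>.\<close>
lemma tls_solution_exists:
  assumes small: "4 * (tls_const * \<eta>) \<le> lam"
  shows "\<exists>X da db. tls_solution m a b X da db"
proof -
  define K where "K = cball X0 (sqrt (2 * (tls_const * \<eta>) * (1 + 2 * (norm X0)\<^sup>2) / lam))"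
  have in_K: "X \<in> K" if "tls_obj m a b X \<le> tls_obj m a b X0" for X
    using sublevel_close[OF small that]
    by (auto simp: K_def dist_norm norm_minus_commute intro: real_le_rsqrt)
  have "continuous_on K (tls_obj m a b)"
    unfolding continuous_on_def tls_obj_def resid_def gram_def
    by (intro ballI tendsto_intros pos_def_invertible[OF pos_def_gram, unfolded gram_def])
  moreover have "compact K" "X0 \<in> K" using in_K[of X0] by (auto simp: K_def)
  ultimately obtain X where X: "\<And>X'. X' \<in> K \<Longrightarrow> tls_obj m a b X \<le> tls_obj m a b X'"
    using continuous_attains_inf[of K "tls_obj m a b"] by blast
  then have "tls_obj m a b X \<le> tls_obj m a b X'" for X'
    using in_K[of X'] X[OF \<open>X0 \<in> K\<close>] X[of X'] by linarith
  then show ?thesis by (meson minimizer_tls_solution)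
qed

end

section \<open>Linearisation of the estimating equation\<close>

lemma avg_est_fun:
  "avg m (\<lambda>i. est_fun (a i) (b i) X) = moment_ar X m a b
    - X ** matrix_inv (gram X) ** moment_rr X m a b"
  by (simp add: est_fun_def avg_diff avg_matrix_mult_left flip: gram_def resid_def)

lemma outer_add_left: "outer (x + x') y = outer x y + outer x' y"
  by (rule bounded_bilinear.add_left[OF bounded_bilinear_outer])

lemma outer_add_right: "outer x (y + y') = outer x y + outer x y'"
  by (rule bounded_bilinear.add_right[OF bounded_bilinear_outer])

lemma avg_outer_resid:
  fixes X0 X :: "real^'d^'n"
  defines "D \<equiv> X - X0"
  shows "moment_ar X m a b =
    moment_ar X0 m a b + moment_aa m a ** D"
  unfolding resid_shift[of X _ _ X0] D_def[symmetric]
  by (simp add: outer_add_right avg_add avg_matrix_mult_right[symmetric] outer_mult_matrix)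

lemma avg_resid_resid:
  fixes X0 X :: "real^'d^'n"
  defines "D \<equiv> X - X0"
  shows "moment_rr X m a b =
    moment_rr X0 m a b
    + transpose D ** moment_ar X0 m a b
    + transpose (moment_ar X0 m a b) ** D
    + transpose D ** moment_aa m a ** D"
proof -
  have eq: "outer (resid X (a i) (b i)) (resid X (a i) (b i)) =
    outer (resid X0 (a i) (b i)) (resid X0 (a i) (b i))
    + transpose D ** outer (a i) (resid X0 (a i) (b i))
    + outer (resid X0 (a i) (b i)) (a i) ** D
    + transpose D ** outer (a i) (a i) ** D" for i
    unfolding resid_shift[of X _ _ X0] D_def[symmetric]
    by (simp add: outer_add_right outer_add_left matrix_mult_outer outer_mult_matrix)
  show ?thesis
    unfolding eq avg_add avg_matrix_mult_right avg_matrix_mult_left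
    by (simp add: avg_transpose[symmetric] transpose_outer)
qed

lemma gram_shift: "gram (X0 + D) = gram X0 + (transpose D ** X0 + transpose X0 ** D + transpose D ** D)"
  by (simp add: gram_def transpose_add matrix_add_ldistrib matrix_add_rdistrib)

text \<open>Here \<open>A\<close>, \<open>N\<close>, \<open>R0\<close> are the moment matrices at \<open>X\<^sub>0\<close>, and \<open>eqn\<close> is the estimating equation at
  \<open>X\<^sub>0 + D\<close>. At the limits \<open>A = V + s I\<close>, \<open>N = s X\<^sub>0\<close>, \<open>P = Q = s I\<close> the right-hand side has no term of
  first order in \<open>D\<close>: the derivative of the estimating function at \<open>X\<^sub>0\<close> is \<open>D \<mapsto> V D\<close>. The identity is
  exact and uses only \<open>P - Q = (I + X\<^sup>T X)\<^sup>-\<^sup>1 (R - (I + X\<^sup>T X) Q)\<close>.\<close>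
lemma estimating_linearization:
  fixes X0 D N :: "real^'d^'n" and A V :: "real^'n^'n" and R0 :: "real^'d^'d" and s :: real
  defines "X \<equiv> X0 + D"
  defines "Q \<equiv> matrix_inv (gram X0) ** R0"
  defines "R \<equiv> R0 + transpose D ** N + transpose N ** D + transpose D ** A ** D"
  defines "P \<equiv> matrix_inv (gram X) ** R"
  assumes eqn: "N + A ** D - X ** matrix_inv (gram X) ** R = 0"
  shows "V ** D + (N - X0 ** matrix_inv (gram X0) ** R0) =
    - (A - (V + s *\<^sub>R mat 1)) ** D + D ** (P - s *\<^sub>R mat 1)
    + X0 ** matrix_inv (gram X) **
       (transpose D ** (N - s *\<^sub>R X0) + transpose (N - s *\<^sub>R X0) ** D + transpose D ** (A ** D - D ** Q)
        - (transpose D ** X0 + transpose X0 ** D) ** (Q - s *\<^sub>R mat 1))"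
proof -
  have gQ: "gram X0 ** Q = R0"
    by (simp add: Q_def matrix_mul_assoc matrix_inv_mult pos_def_invertible pos_def_gram)
  have "matrix_inv (gram X) ** (gram X ** Q) = Q"
    by (simp add: matrix_mul_assoc matrix_inv_mult pos_def_invertible pos_def_gram)
  then have "P - Q = matrix_inv (gram X) ** (R - gram X ** Q)"
    by (simp add: P_def matrix_diff_ldistrib)
  also have "R - gram X ** Q = transpose D ** (N - s *\<^sub>R X0) + transpose (N - s *\<^sub>R X0) ** D
      + transpose D ** (A ** D - D ** Q)
      - (transpose D ** X0 + transpose X0 ** D) ** (Q - s *\<^sub>R mat 1)"
    unfolding X_def gram_shift R_def
    by (simp add: matrix_add_rdistrib matrix_add_ldistrib matrix_diff_ldistrib matrix_diff_rdistrib gQ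
        matrix_mul_assoc transpose_diff transpose_scalar matrix_scaleR_right matrix_scaleR_left algebra_simps)
  finally have PQ: "X0 ** matrix_inv (gram X) ** (transpose D ** (N - s *\<^sub>R X0)
      + transpose (N - s *\<^sub>R X0) ** D + transpose D ** (A ** D - D ** Q)
      - (transpose D ** X0 + transpose X0 ** D) ** (Q - s *\<^sub>R mat 1)) = X0 ** (P - Q)"
    by (simp add: matrix_mul_assoc)
  have "N + A ** D - (X0 + D) ** P = 0" using eqn by (simp add: P_def X_def matrix_mul_assoc)
  then have "N - X0 ** Q = X0 ** (P - Q) + D ** P - A ** D"
    by (simp add: matrix_add_rdistrib matrix_diff_ldistrib algebra_simps)
  then show ?thesis
    unfolding PQ
    by (simp add: Q_def matrix_mul_assoc matrix_diff_rdistrib matrix_diff_ldistrib matrix_add_rdistrib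
        matrix_scaleR_right matrix_scaleR_left algebra_simps
        bounded_bilinear.minus_left[OF bounded_bilinear_matrix_mult])
qed

lemma norm_matrix_mult_mono:
  "norm A \<le> \<alpha> \<Longrightarrow> norm B \<le> \<beta> \<Longrightarrow> norm (A ** B) \<le> \<alpha> * \<beta>" for A :: "real^'n^'m" and B :: "real^'k^'n"
  by (meson mult_mono norm_ge_zero norm_matrix_matrix_le order_trans)

text \<open>The right-hand side of \<open>estimating_linearization\<close>, bounded by \<open>\<parallel>D\<parallel>\<close> times a factor that
  vanishes in the limit.\<close>
lemma linearization_error_le:
  fixes X0 D N :: "real^'d^'n" and A' :: "real^'n^'n" and P Q G :: "real^'d^'d" and C :: "real^'d^'n"
  shows "norm (- A' ** D + D ** P
    + X0 ** G ** (transpose D ** N + transpose N ** D + transpose D ** C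
        - (transpose D ** X0 + transpose X0 ** D) ** Q))
    \<le> (norm A' + norm P + norm X0 * norm G * (2 * norm N + norm C + 2 * norm X0 * norm Q)) * norm D"
proof -
  have "norm (transpose D ** X0 + transpose X0 ** D) \<le> 2 * norm X0 * norm D"
    using norm_triangle_ineq[of "transpose D ** X0" "transpose X0 ** D"]
      norm_matrix_matrix_le[of "transpose D" X0] norm_matrix_matrix_le[of "transpose X0" D]
    by (simp add: norm_transpose mult.commute)
  then have 1: "norm ((transpose D ** X0 + transpose X0 ** D) ** Q) \<le> 2 * norm X0 * norm D * norm Q"
    by (intro norm_matrix_mult_mono) auto
  have 2: "norm (transpose D ** N) \<le> norm D * norm N" "norm (transpose N ** D) \<le> norm N * norm D"
    "norm (transpose D ** C) \<le> norm D * norm C"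
    using norm_matrix_matrix_le[of "transpose D" N] norm_matrix_matrix_le[of "transpose N" D]
      norm_matrix_matrix_le[of "transpose D" C] by (simp_all add: norm_transpose)
  let ?E = "transpose D ** N + transpose N ** D + transpose D ** C - (transpose D ** X0 + transpose X0 ** D) ** Q"
  have "norm ?E \<le> norm (transpose D ** N) + norm (transpose N ** D) + norm (transpose D ** C)
      + norm ((transpose D ** X0 + transpose X0 ** D) ** Q)"
    by norm
  also have "\<dots> \<le> (2 * norm N + norm C + 2 * norm X0 * norm Q) * norm D"
    using 1 2 by (simp add: algebra_simps)
  finally have "norm (X0 ** G ** ?E) \<le> (norm X0 * norm G) * ((2 * norm N + norm C + 2 * norm X0 * norm Q) * norm D)"
    by (intro norm_matrix_mult_mono norm_matrix_matrix_le)
  moreover have "norm (- A' ** D) \<le> norm A' * norm D" "norm (D ** P) \<le> norm D * norm P"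
    using norm_matrix_matrix_le[of "- A'" D] norm_matrix_matrix_le[of D P] by simp_all
  moreover have "norm (- A' ** D + D ** P + X0 ** G ** ?E) \<le> norm (- A' ** D) + norm (D ** P) + norm (X0 ** G ** ?E)"
    by norm
  ultimately show ?thesis by (simp add: algebra_simps)
qed

section \<open>Limits along sequences of data\<close>

lemma gram_inv_scaleR: "matrix_inv (gram X) ** (c *\<^sub>R gram X) = c *\<^sub>R mat 1"
  by (simp add: matrix_scaleR_right matrix_inv_mult pos_def_invertible pos_def_gram)

lemma avg_minus: "avg m (\<lambda>i. - f i) = - avg m f"
  by (simp add: avg_def sum_negf)

lemma weighted_outer:
  fixes S :: "real^'d^'n"
  assumes "transpose W = W"
  shows "transpose S ** W ** outer \<mu> \<mu> ** W ** S = outer (transpose S *v (W *v \<mu>)) (transpose S *v (W *v \<mu>))"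
  by (simp add: matrix_mult_outer outer_mult_matrix assms flip: matrix_vector_mul_assoc)

lemma norm_outer_diff_le:
  fixes x y :: "real^'d"
  shows "norm (outer x x - outer y y) \<le> (norm (x - y))\<^sup>2 + 2 * (norm y * norm (x - y))"
proof -
  have "outer x x - outer y y = outer (x - y) (x - y) + outer y (x - y) + outer (x - y) y"
    by (simp add: bounded_bilinear.diff_left[OF bounded_bilinear_outer]
        bounded_bilinear.diff_right[OF bounded_bilinear_outer])
  then have "norm (outer x x - outer y y) \<le> norm (outer (x - y) (x - y)) + norm (outer y (x - y)) + norm (outer (x - y) y)"
    using norm_triangle_ineq norm_add_rule_thm by (smt (verit))
  then show ?thesis by (simp add: norm_outer power2_eq_square)
qed

text \<open>The factor of \<open>\<parallel>a\<parallel>\<^sup>2\<close> carries \<open>\<parallel>X - X\<^sub>0\<parallel>\<close> itself, of order \<open>m\<^sup>-\<^sup>1\<^sup>/\<^sup>2\<close>; this is what compensates for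
  regressors whose averaged fourth powers are only of order \<open>o(m)\<close>.\<close>
lemma norm_est_fun_diff_le:
  fixes X X0 :: "real^'d^'n"
  defines "D \<equiv> X - X0" and "G \<equiv> X ** matrix_inv (gram X)" and "G0 \<equiv> X0 ** matrix_inv (gram X0)"
  shows "norm (est_fun a b X - est_fun a b X0) \<le>
    norm D * (1 + norm G * (1 + norm D)) * (norm a)\<^sup>2
    + (norm (G - G0) + norm G * norm D) * (norm (resid X0 a b))\<^sup>2"
proof -
  define \<rho> where "\<rho> = resid X0 a b"
  define d where "d = transpose D *v a"
  have d: "norm d \<le> norm D * norm a"
    using norm_matrix_vector_le[of "transpose D" a] by (simp add: d_def norm_transpose)
  have "est_fun a b X = outer a (\<rho> + d) - G ** outer (\<rho> + d) (\<rho> + d)"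
    using resid_shift[of X a b X0]
    by (simp add: est_fun_def \<rho>_def d_def D_def G_def flip: gram_def resid_def)
  moreover have "est_fun a b X0 = outer a \<rho> - G0 ** outer \<rho> \<rho>"
    by (simp add: est_fun_def \<rho>_def G0_def flip: gram_def resid_def)
  ultimately have "est_fun a b X - est_fun a b X0 =
      outer a d - (G - G0) ** outer \<rho> \<rho> - G ** (outer d \<rho> + outer \<rho> d + outer d d)"
    by (simp add: outer_add_left outer_add_right matrix_add_ldistrib matrix_diff_rdistrib)
  moreover have "norm (outer a d) \<le> norm D * (norm a)\<^sup>2"
    using mult_left_mono[OF d, of "norm a"] by (simp add: norm_outer power2_eq_square algebra_simps)
  moreover have "norm ((G - G0) ** outer \<rho> \<rho>) \<le> norm (G - G0) * (norm \<rho>)\<^sup>2"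
    using norm_matrix_matrix_le[of "G - G0" "outer \<rho> \<rho>"] by (simp add: norm_outer power2_eq_square)
  moreover have "norm (G ** (outer d \<rho> + outer \<rho> d + outer d d))
      \<le> norm G * (norm D * ((norm a)\<^sup>2 + (norm \<rho>)\<^sup>2) + (norm D)\<^sup>2 * (norm a)\<^sup>2)"
  proof (rule norm_matrix_mult_mono)
    have "norm (outer d \<rho> + outer \<rho> d + outer d d) \<le> norm (outer d \<rho>) + norm (outer \<rho> d) + norm (outer d d)"
      by norm
    also have "\<dots> = norm d * (2 * norm \<rho>) + (norm d)\<^sup>2" by (simp add: norm_outer power2_eq_square)
    also have "\<dots> \<le> (norm D * norm a) * (2 * norm \<rho>) + (norm D * norm a)\<^sup>2"
      using d by (intro add_mono mult_right_mono power_mono) auto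
    also have "(norm D * norm a) * (2 * norm \<rho>) = norm D * (2 * norm a * norm \<rho>)" by simp
    also have "\<dots> \<le> norm D * ((norm a)\<^sup>2 + (norm \<rho>)\<^sup>2)"
      by (intro mult_left_mono sum_squares_bound) auto
    finally show "norm (outer d \<rho> + outer \<rho> d + outer d d)
      \<le> norm D * ((norm a)\<^sup>2 + (norm \<rho>)\<^sup>2) + (norm D)\<^sup>2 * (norm a)\<^sup>2"
      by (simp add: power_mult_distrib)
  qed simp
  moreover have "norm (x - y - z) \<le> norm x + norm y + norm z" for x y z :: "real^'d^'n" by norm
  ultimately have "norm (est_fun a b X - est_fun a b X0) \<le> norm D * (norm a)\<^sup>2 + norm (G - G0) * (norm \<rho>)\<^sup>2
      + norm G * (norm D * ((norm a)\<^sup>2 + (norm \<rho>)\<^sup>2) + (norm D)\<^sup>2 * (norm a)\<^sup>2)"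
    by (smt (verit))
  then show ?thesis by (simp add: \<rho>_def algebra_simps power2_eq_square)
qed

text \<open>From here on the data are nonrandom: \<open>a k\<close>, \<open>b k\<close> is the \<open>k\<close>th data set, of size \<open>n k\<close>.\<close>
context
  fixes X0 :: "real^'d^'n" and V :: "real^'n^'n" and s :: real
    and n :: "nat \<Rightarrow> nat" and a :: "nat \<Rightarrow> nat \<Rightarrow> real^'n" and b :: "nat \<Rightarrow> nat \<Rightarrow> real^'d"
  assumes n: "filterlim n at_top sequentially"
    and Maa: "(\<lambda>k. moment_aa (n k) (a k)) \<longlonglongrightarrow> V + s *\<^sub>R mat 1"
    and N: "(\<lambda>k. moment_ar X0 (n k) (a k) (b k)) \<longlonglongrightarrow> s *\<^sub>R X0"
    and R0: "(\<lambda>k. moment_rr X0 (n k) (a k) (b k))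
      \<longlonglongrightarrow> s *\<^sub>R gram X0"
    and V: "pos_def V"
begin

definition moment_error :: "nat \<Rightarrow> real" where
  "moment_error k = norm (moment_aa (n k) (a k) - (V + s *\<^sub>R mat 1))
    + norm (moment_ar X0 (n k) (a k) (b k) - s *\<^sub>R X0)
    + norm (moment_rr X0 (n k) (a k) (b k) - s *\<^sub>R gram X0)"

lemma moment_error_null: "moment_error \<longlonglongrightarrow> 0"
proof -
  have "(\<lambda>k. moment_error k) \<longlonglongrightarrow> norm ((V + s *\<^sub>R mat 1) - (V + s *\<^sub>R mat 1))
      + norm (s *\<^sub>R X0 - s *\<^sub>R X0) + norm (s *\<^sub>R gram X0 - s *\<^sub>R gram X0)"
    unfolding moment_error_def by (intro tendsto_intros Maa N R0)
  then show ?thesis by simp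
qed

lemma n_ge_1: "eventually (\<lambda>k. 1 \<le> n k) sequentially"
  using n by (simp add: filterlim_at_top)

lemma tls_consistency:
  shows "eventually (\<lambda>k. \<exists>X da db. tls_solution (n k) (a k) (b k) X da db) sequentially"
    and "eventually (\<lambda>k. \<exists>da db. tls_solution (n k) (a k) (b k) (X k) da db) sequentially \<Longrightarrow>
      X \<longlonglongrightarrow> X0"
proof -
  obtain lam where lam: "0 < lam" "\<And>x. lam * (norm x)\<^sup>2 \<le> x \<bullet> (V *v x)"
    using pos_def_lower_bound[OF V] by blast
  have bounds: "norm (moment_aa (n k) (a k) - (V + s *\<^sub>R mat 1)) \<le> moment_error k"
    "norm (moment_ar X0 (n k) (a k) (b k) - s *\<^sub>R X0) \<le> moment_error k"
    "norm (moment_rr X0 (n k) (a k) (b k)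
      - s *\<^sub>R gram X0) \<le> moment_error k" for k
    unfolding moment_error_def by auto
  have "(\<lambda>k. 4 * (tls_const X0 * moment_error k)) \<longlonglongrightarrow> 4 * (tls_const X0 * 0)"
    by (intro tendsto_intros moment_error_null)
  then have "eventually (\<lambda>k. 4 * (tls_const X0 * moment_error k) < lam) sequentially"
    using lam by (simp add: order_tendsto_iff)
  then have ev: "eventually (\<lambda>k. 1 \<le> n k \<and> 4 * (tls_const X0 * moment_error k) \<le> lam) sequentially"
    using n_ge_1 by eventually_elim auto
  then show "eventually (\<lambda>k. \<exists>X da db. tls_solution (n k) (a k) (b k) X da db) sequentially"
    by eventually_elim (rule tls_solution_exists[OF _ bounds lam(2,1)], auto)
  show "X \<longlonglongrightarrow> X0" if sol: "eventually (\<lambda>k. \<exists>da db. tls_solution (n k) (a k) (b k) (X k) da db) sequentially"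
  proof -
    let ?c = "\<lambda>k. 2 * (tls_const X0 * moment_error k) * (1 + 2 * (norm X0)\<^sup>2) / lam"
    have "?c \<longlonglongrightarrow> 2 * (tls_const X0 * 0) * (1 + 2 * (norm X0)\<^sup>2) / lam"
      using lam by (intro tendsto_intros moment_error_null) auto
    then have c: "?c \<longlonglongrightarrow> 0" by simp
    have "eventually (\<lambda>k. norm ((norm (X k - X0))\<^sup>2) \<le> ?c k) sequentially"
      using ev sol
    proof eventually_elim
      case (elim k)
      then have "tls_obj (n k) (a k) (b k) (X k) \<le> tls_obj (n k) (a k) (b k) X0"
        using tls_solution_minimizes by blast
      with elim show ?case
        using sublevel_close[OF _ bounds[of k] lam(2,1)] by simp
    qed
    then have "(\<lambda>k. (norm (X k - X0))\<^sup>2) \<longlonglongrightarrow> 0" using c by (rule Lim_null_comparison)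
    then have "(\<lambda>k. sqrt ((norm (X k - X0))\<^sup>2)) \<longlonglongrightarrow> sqrt 0" by (rule tendsto_real_sqrt)
    then show ?thesis by (simp add: tendsto_norm_zero_iff Lim_null[of X])
  qed
qed

context
  fixes X :: "nat \<Rightarrow> real^'d^'n"
  assumes sol: "eventually (\<lambda>k. \<exists>da db. tls_solution (n k) (a k) (b k) (X k) da db) sequentially"
begin

lemma X_tendsto: "X \<longlonglongrightarrow> X0"
  by (rule tls_consistency(2)[OF sol])

lemma D_null: "(\<lambda>k. X k - X0) \<longlonglongrightarrow> 0"
  using X_tendsto by (simp add: Lim_null[of X])

lemma gram_tendsto: "(\<lambda>k. gram (X k)) \<longlonglongrightarrow> gram X0"
  unfolding gram_def by (intro tendsto_intros X_tendsto)

lemma inv_gram_tendsto: "(\<lambda>k. matrix_inv (gram (X k))) \<longlonglongrightarrow> matrix_inv (gram X0)"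
  by (intro tendsto_intros gram_tendsto pos_def_invertible pos_def_gram)

text \<open>Since \<open>\<parallel>V D + F\<parallel> \<le> e \<parallel>D\<parallel>\<close> with \<open>e \<longlonglongrightarrow> 0\<close>, where \<open>F\<close> is the average of the estimating function
  at \<open>X\<^sub>0\<close>, and \<open>\<parallel>V D\<parallel> \<ge> lam \<parallel>D\<parallel>\<close>, boundedness of \<open>\<surd>n F\<close> first bounds \<open>\<surd>n D\<close>; this in turn makes the
  remainder \<open>\<surd>n e \<parallel>D\<parallel>\<close> vanish.\<close>
lemma sqrt_n_expansion:
  assumes F: "eventually (\<lambda>k. sqrt (n k) * norm (avg (n k) (\<lambda>i. est_fun (a k i) (b k i) X0)) \<le> C) sequentially"
  shows "(\<lambda>k. sqrt (n k) *\<^sub>R (V ** (X k - X0) + avg (n k) (\<lambda>i. est_fun (a k i) (b k i) X0))) \<longlonglongrightarrow> 0"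
    and "\<exists>K. eventually (\<lambda>k. sqrt (n k) * norm (X k - X0) \<le> K) sequentially"
proof -
  obtain lam where lam: "0 < lam" "\<And>x. lam * (norm x)\<^sup>2 \<le> x \<bullet> (V *v x)"
    using pos_def_lower_bound[OF V] by blast
  define A where "A k = moment_aa (n k) (a k)" for k
  define N' where "N' k = moment_ar X0 (n k) (a k) (b k)" for k
  define R0' where "R0' k = moment_rr X0 (n k) (a k) (b k)" for k
  define D where "D k = X k - X0" for k
  define R where "R k = R0' k + transpose (D k) ** N' k + transpose (N' k) ** D k
    + transpose (D k) ** A k ** D k" for k
  define P where "P k = matrix_inv (gram (X k)) ** R k" for k
  define Q where "Q k = matrix_inv (gram X0) ** R0' k" for k
  define F where "F k = avg (n k) (\<lambda>i. est_fun (a k i) (b k i) X0)" for k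
  have X: "X k = X0 + D k" for k by (simp add: D_def)
  have F_eq: "F k = N' k - X0 ** matrix_inv (gram X0) ** R0' k" for k
    by (simp add: F_def avg_est_fun N'_def R0'_def)
  note lims = Maa[folded A_def] N[folded N'_def] R0[folded R0'_def] D_null[folded D_def]
  have R_lim: "R \<longlonglongrightarrow> s *\<^sub>R gram X0"
  proof -
    have "(\<lambda>k. R k) \<longlonglongrightarrow> s *\<^sub>R gram X0 + transpose 0 ** (s *\<^sub>R X0) + transpose (s *\<^sub>R X0) ** 0
      + transpose 0 ** (V + s *\<^sub>R mat 1) ** 0"
      unfolding R_def by (intro tendsto_intros lims)
    then show ?thesis
      by (simp add: bounded_bilinear.zero_right[OF bounded_bilinear_matrix_mult]
          bounded_bilinear.zero_left[OF bounded_bilinear_matrix_mult]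
          linear_0[OF bounded_linear.linear[OF bounded_linear_transpose]])
  qed
  have P_lim: "P \<longlonglongrightarrow> s *\<^sub>R mat 1"
    using tendsto_matrix_mult[OF inv_gram_tendsto R_lim] by (simp add: P_def[abs_def] gram_inv_scaleR)
  have Q_lim: "Q \<longlonglongrightarrow> s *\<^sub>R mat 1"
    using tendsto_matrix_mult[OF tendsto_const[of "matrix_inv (gram X0)"] lims(3)]
    by (simp add: Q_def[abs_def] gram_inv_scaleR)
  define e where "e k = norm (A k - (V + s *\<^sub>R mat 1)) + norm (P k - s *\<^sub>R mat 1)
    + norm X0 * norm (matrix_inv (gram (X k))) * (2 * norm (N' k - s *\<^sub>R X0)
      + norm (A k ** D k - D k ** Q k) + 2 * norm X0 * norm (Q k - s *\<^sub>R mat 1))" for k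
  have e_lim: "e \<longlonglongrightarrow> 0"
  proof -
    have "(\<lambda>k. e k) \<longlonglongrightarrow> norm ((V + s *\<^sub>R mat 1) - (V + s *\<^sub>R mat 1)) + norm (s *\<^sub>R mat 1 - s *\<^sub>R mat 1 :: real^'d^'d)
      + norm X0 * norm (matrix_inv (gram X0)) * (2 * norm (s *\<^sub>R X0 - s *\<^sub>R X0)
      + norm ((V + s *\<^sub>R mat 1) ** (0 :: real^'d^'n) - (0 :: real^'d^'n) ** (s *\<^sub>R mat 1))
      + 2 * norm X0 * norm (s *\<^sub>R mat 1 - s *\<^sub>R mat 1 :: real^'d^'d))"
      unfolding e_def by (intro tendsto_intros lims P_lim Q_lim inv_gram_tendsto)
    then show ?thesis
      by (simp add: bounded_bilinear.zero_right[OF bounded_bilinear_matrix_mult]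
          bounded_bilinear.zero_left[OF bounded_bilinear_matrix_mult])
  qed
  have key: "eventually (\<lambda>k. norm (V ** D k + F k) \<le> e k * norm (D k)) sequentially"
    using sol n_ge_1
  proof eventually_elim
    case (elim k)
    then have "(\<Sum>i=1..n k. est_fun (a k i) (b k i) (X k)) = 0"
      using estimating_equation tls_solution_minimizes by blast
    then have "avg (n k) (\<lambda>i. est_fun (a k i) (b k i) (X k)) = 0" by (simp add: avg_def)
    then have eqn: "N' k + A k ** D k - (X0 + D k) ** matrix_inv (gram (X0 + D k)) ** R k = 0"
      unfolding avg_est_fun avg_outer_resid[of _ "a k" "X k" _ X0] avg_resid_resid[of _ "X k" _ _ X0]
      by (simp add: A_def N'_def R0'_def R_def D_def)
    show ?case
      unfolding F_eq
      unfolding estimating_linearization[OF eqn[unfolded R_def], where s=s and V=V]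
      unfolding R_def[symmetric] X[symmetric] P_def[symmetric] Q_def[symmetric] e_def
      by (rule linearization_error_le)
  qed
  have VD: "lam * norm (D k) \<le> norm (V ** D k)" for k
  proof -
    have col: "row i (transpose (V ** D k)) = V *v row i (transpose (D k))" for i
      by (simp add: vec_eq_iff column_def matrix_matrix_mult_def matrix_vector_mult_def)
    have V_ge: "lam * norm x \<le> norm (V *v x)" for x
    proof -
      have "lam * (norm x)\<^sup>2 \<le> norm x * norm (V *v x)"
        using lam(2)[of x] norm_cauchy_schwarz order_trans by blast
      then show ?thesis
        by (cases "x = 0") (auto simp: power2_eq_square mult.left_commute[of lam])
    qed
    have "lam * norm (D k) = L2_set (\<lambda>i. lam * norm (row i (transpose (D k)))) UNIV"
      using lam(1) by (simp add: norm_transpose[symmetric, of "D k"] norm_vec_def[of "transpose (D k)"]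
          row_def L2_set_right_distrib del: row_transpose)
    also have "\<dots> \<le> L2_set (\<lambda>i. norm (row i (transpose (V ** D k)))) UNIV"
      unfolding col using lam(1) by (intro L2_set_mono V_ge) auto
    also have "\<dots> = norm (V ** D k)"
      by (simp add: norm_transpose[symmetric, of "V ** D k"] norm_vec_def[of "transpose (V ** D k)"] row_def
          del: row_transpose)
    finally show ?thesis .
  qed
  have "eventually (\<lambda>k. e k < lam / 2) sequentially"
    using lam(1) by (intro order_tendstoD(2)[OF e_lim]) simp
  then have bdd: "eventually (\<lambda>k. sqrt (n k) * norm (D k) \<le> 2 * C / lam) sequentially"
    using key F[folded F_def]
  proof eventually_elim
    case (elim k)
    have "norm (V ** D k) \<le> norm (V ** D k + F k) + norm (F k)" by norm
    also have "\<dots> \<le> lam / 2 * norm (D k) + norm (F k)"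
      using elim mult_right_mono[of "e k" "lam / 2" "norm (D k)"] by auto
    finally have "lam / 2 * norm (D k) \<le> norm (F k)" using VD[of k] by simp
    then have "sqrt (n k) * (lam / 2 * norm (D k)) \<le> sqrt (n k) * norm (F k)" by (intro mult_left_mono) auto
    also have "\<dots> \<le> C" by (rule elim)
    finally show ?case using lam(1) by (simp add: field_simps)
  qed
  then show "\<exists>K. eventually (\<lambda>k. sqrt (n k) * norm (X k - X0) \<le> K) sequentially"
    unfolding D_def by blast
  show "(\<lambda>k. sqrt (n k) *\<^sub>R (V ** (X k - X0) + avg (n k) (\<lambda>i. est_fun (a k i) (b k i) X0))) \<longlonglongrightarrow> 0"
    unfolding D_def[symmetric] F_def[symmetric]
  proof (rule Lim_null_comparison)
    show "eventually (\<lambda>k. norm (sqrt (n k) *\<^sub>R (V ** D k + F k)) \<le> \<bar>e k\<bar> * (2 * C / lam)) sequentially"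
      using key bdd
    proof eventually_elim
      case (elim k)
      have "norm (sqrt (n k) *\<^sub>R (V ** D k + F k)) \<le> sqrt (n k) * (\<bar>e k\<bar> * norm (D k))"
        using order_trans[OF elim(1), of "\<bar>e k\<bar> * norm (D k)"] by (simp add: mult_left_mono mult_right_mono)
      also have "\<dots> = \<bar>e k\<bar> * (sqrt (n k) * norm (D k))" by simp
      also have "\<dots> \<le> \<bar>e k\<bar> * (2 * C / lam)" using elim by (intro mult_left_mono) auto
      finally show ?case .
    qed
    have "(\<lambda>k. \<bar>e k\<bar> * (2 * C / lam)) \<longlonglongrightarrow> \<bar>0\<bar> * (2 * C / lam)" by (intro tendsto_intros e_lim)
    then show "(\<lambda>k. \<bar>e k\<bar> * (2 * C / lam)) \<longlonglongrightarrow> 0" by simp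
  qed
qed

text \<open>The statistic is a continuous function of the moment matrices and of \<open>X\<close>; at the limits the
  matrix under the trace is \<open>s (I + X\<^sub>0\<^sup>T X\<^sub>0) (I + X\<^sub>0\<^sup>T X\<^sub>0)\<^sup>-\<^sup>1 = s I\<close>.\<close>
lemma sigma2_hat_tendsto: "(\<lambda>k. sigma2_hat (n k) (a k) (b k) (X k)) \<longlonglongrightarrow> s"
proof -
  define A where "A k = moment_aa (n k) (a k)" for k
  define N' where "N' k = moment_ar X0 (n k) (a k) (b k)" for k
  define R0' where "R0' k = moment_rr X0 (n k) (a k) (b k)" for k
  note lims = Maa[folded A_def] N[folded N'_def] R0[folded R0'_def] X_tendsto
  have b: "b k i = transpose X0 *v a k i - resid X0 (a k i) (b k i)" for k i by (simp add: resid_def)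
  have ab: "avg (n k) (\<lambda>i. outer (a k i) (b k i)) = A k ** X0 - N' k" for k
    unfolding A_def N'_def avg_matrix_mult_right[symmetric] avg_diff[symmetric]
    by (subst b) (simp add: outer_mult_matrix bounded_bilinear.diff_right[OF bounded_bilinear_outer])
  have bb: "avg (n k) (\<lambda>i. outer (b k i) (b k i)) =
      transpose X0 ** A k ** X0 - transpose X0 ** N' k - transpose (N' k) ** X0 + R0' k" for k
    unfolding A_def N'_def R0'_def avg_matrix_mult_right[symmetric] avg_matrix_mult_left[symmetric]
      avg_transpose[symmetric] avg_diff[symmetric] avg_add[symmetric]
    by (subst (1 2) b) (simp add: outer_mult_matrix matrix_mult_outer transpose_outer algebra_simps
        bounded_bilinear.diff_right[OF bounded_bilinear_outer]
        bounded_bilinear.diff_left[OF bounded_bilinear_outer])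
  have "(\<lambda>k. sigma2_hat (n k) (a k) (b k) (X k)) \<longlonglongrightarrow> 1 / real CARD('d) *
     trace ((transpose X0 ** (V + s *\<^sub>R mat 1) ** X0 - transpose X0 ** (s *\<^sub>R X0)
         - transpose (s *\<^sub>R X0) ** X0 + s *\<^sub>R gram X0
       - 2 *\<^sub>R (transpose X0 ** ((V + s *\<^sub>R mat 1) ** X0 - s *\<^sub>R X0))
       + transpose X0 ** (V + s *\<^sub>R mat 1) ** X0) ** matrix_inv (gram X0))"
    unfolding sigma2_hat_def gram_def[symmetric] ab bb A_def[symmetric]
    by (intro tendsto_intros lims inv_gram_tendsto)
  also have "transpose X0 ** (V + s *\<^sub>R mat 1) ** X0 - transpose X0 ** (s *\<^sub>R X0)
         - transpose (s *\<^sub>R X0) ** X0 + s *\<^sub>R gram X0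
       - 2 *\<^sub>R (transpose X0 ** ((V + s *\<^sub>R mat 1) ** X0 - s *\<^sub>R X0))
       + transpose X0 ** (V + s *\<^sub>R mat 1) ** X0 = s *\<^sub>R gram X0"
    by (simp add: matrix_add_ldistrib matrix_add_rdistrib matrix_diff_ldistrib matrix_scaleR_right
        matrix_scaleR_left transpose_scalar matrix_mul_assoc scaleR_2)
  also have "1 / real CARD('d) * trace (s *\<^sub>R gram X0 ** matrix_inv (gram X0)) = s"
    by (simp add: matrix_scaleR_left matrix_inv_mult pos_def_invertible pos_def_gram trace_def mat_def)
  finally show ?thesis .
qed

lemma V_hat_tendsto: "(\<lambda>k. V_hat (n k) (a k) (b k) (X k)) \<longlonglongrightarrow> V"
proof -
  have "(\<lambda>k. V_hat (n k) (a k) (b k) (X k)) \<longlonglongrightarrow> V + s *\<^sub>R mat 1 - s *\<^sub>R mat 1"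
    unfolding V_hat_def by (intro tendsto_intros Maa sigma2_hat_tendsto)
  then show ?thesis by simp
qed

lemma V_hat_inv_tendsto:
  "eventually (\<lambda>k. invertible (V_hat (n k) (a k) (b k) (X k))) sequentially"
  "(\<lambda>k. matrix_inv (V_hat (n k) (a k) (b k) (X k))) \<longlonglongrightarrow> matrix_inv V"
  by (intro eventually_invertible[OF V_hat_tendsto] tendsto_matrix_inv V_hat_tendsto pos_def_invertible V)+

text \<open>The averaged fourth powers of the regressors need not be bounded. They enter with the factor
  \<open>\<parallel>X - X\<^sub>0\<parallel>\<^sup>2\<close>, which is of order \<open>1 / n\<close>, so \<open>a4\<close> suffices.\<close>
lemma avg_est_fun_diff_null:
  assumes F: "eventually (\<lambda>k. sqrt (n k) * norm (avg (n k) (\<lambda>i. est_fun (a k i) (b k i) X0)) \<le> C) sequentially"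
    and a4: "(\<lambda>k. avg (n k) (\<lambda>i. (norm (a k i))^4) / n k) \<longlonglongrightarrow> 0"
    and r4: "eventually (\<lambda>k. avg (n k) (\<lambda>i. (norm (resid X0 (a k i) (b k i)))^4) \<le> C) sequentially"
  shows "(\<lambda>k. avg (n k) (\<lambda>i. (norm (est_fun (a k i) (b k i) (X k) - est_fun (a k i) (b k i) X0))\<^sup>2)) \<longlonglongrightarrow> 0"
proof -
  define D where "D k = X k - X0" for k
  define G where "G k = X k ** matrix_inv (gram (X k))" for k
  define G0 where "G0 = X0 ** matrix_inv (gram X0)"
  define g where "g k = 1 + norm (G k) * (1 + norm (D k))" for k
  define h where "h k = norm (G k - G0) + norm (G k) * norm (D k)" for k
  obtain K where K: "eventually (\<lambda>k. sqrt (n k) * norm (D k) \<le> K) sequentially"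
    using sqrt_n_expansion(2)[OF F] by (auto simp: D_def)
  have D_lim: "D \<longlonglongrightarrow> 0" using D_null by (simp add: D_def[abs_def])
  have G_lim: "G \<longlonglongrightarrow> G0" unfolding G_def[abs_def] G0_def by (intro tendsto_intros X_tendsto inv_gram_tendsto)
  have g_lim: "g \<longlonglongrightarrow> 1 + norm G0 * (1 + norm (0::real^'d^'n))"
    unfolding g_def[abs_def] by (intro tendsto_intros D_lim G_lim)
  have h_lim: "h \<longlonglongrightarrow> norm (G0 - G0) + norm G0 * norm (0::real^'d^'n)"
    unfolding h_def[abs_def] by (intro tendsto_intros D_lim G_lim)
  have le: "(norm (est_fun (a k i) (b k i) (X k) - est_fun (a k i) (b k i) X0))\<^sup>2
      \<le> 2 * (norm (D k) * g k)\<^sup>2 * (norm (a k i))^4 + 2 * (h k)\<^sup>2 * (norm (resid X0 (a k i) (b k i)))^4" for k i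
  proof -
    let ?\<alpha> = "norm (a k i)" and ?\<rho> = "norm (resid X0 (a k i) (b k i))"
    have "norm (est_fun (a k i) (b k i) (X k) - est_fun (a k i) (b k i) X0)
        \<le> norm (D k) * g k * ?\<alpha>\<^sup>2 + h k * ?\<rho>\<^sup>2"
      using norm_est_fun_diff_le[of "a k i" "b k i" "X k" X0] unfolding D_def[symmetric] G_def[symmetric] G0_def[symmetric] g_def h_def .
    then have "(norm (est_fun (a k i) (b k i) (X k) - est_fun (a k i) (b k i) X0))\<^sup>2
        \<le> (norm (D k) * g k * ?\<alpha>\<^sup>2 + h k * ?\<rho>\<^sup>2)\<^sup>2"
      by (intro power_mono) auto
    also have "\<dots> \<le> 2 * (norm (D k) * g k * ?\<alpha>\<^sup>2)\<^sup>2 + 2 * (h k * ?\<rho>\<^sup>2)\<^sup>2"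
      using sum_squares_bound[of "norm (D k) * g k * ?\<alpha>\<^sup>2" "h k * ?\<rho>\<^sup>2"] by (simp add: power2_sum)
    finally show ?thesis by (simp add: power_mult_distrib mult.assoc flip: power_mult)
  qed
  let ?A4 = "\<lambda>k. avg (n k) (\<lambda>i. (norm (a k i))^4)"
    and ?R4 = "\<lambda>k. avg (n k) (\<lambda>i. (norm (resid X0 (a k i) (b k i)))^4)"
  show ?thesis
  proof (rule Lim_null_comparison)
    show "eventually (\<lambda>k. norm (avg (n k) (\<lambda>i. (norm (est_fun (a k i) (b k i) (X k) - est_fun (a k i) (b k i) X0))\<^sup>2))
        \<le> 2 * (K * g k)\<^sup>2 * (?A4 k / n k) + 2 * (h k)\<^sup>2 * C) sequentially"
      using K r4 n_ge_1
    proof eventually_elim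
      case (elim k)
      have "avg (n k) (\<lambda>i. (norm (est_fun (a k i) (b k i) (X k) - est_fun (a k i) (b k i) X0))\<^sup>2)
        \<le> 2 * (norm (D k) * g k)\<^sup>2 * ?A4 k + 2 * (h k)\<^sup>2 * ?R4 k"
        unfolding avg_mult_left[symmetric] avg_add[symmetric] by (intro avg_mono le)
      moreover have "2 * (h k)\<^sup>2 * ?R4 k \<le> 2 * (h k)\<^sup>2 * C" using elim by (intro mult_left_mono) auto
      moreover have "2 * (norm (D k) * g k)\<^sup>2 * ?A4 k = 2 * (sqrt (n k) * norm (D k))\<^sup>2 * (g k)\<^sup>2 * (?A4 k / n k)"
        using elim by (simp add: power_mult_distrib)
      moreover have "\<dots> \<le> 2 * K\<^sup>2 * (g k)\<^sup>2 * (?A4 k / n k)"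
        using elim by (intro mult_right_mono mult_left_mono power_mono divide_nonneg_nonneg avg_nonneg) auto
      ultimately show ?case by (simp add: avg_nonneg power_mult_distrib mult.assoc)
    qed
    have "(\<lambda>k. 2 * (K * g k)\<^sup>2 * (?A4 k / n k) + 2 * (h k)\<^sup>2 * C) \<longlonglongrightarrow>
        2 * (K * (1 + norm G0 * (1 + norm (0::real^'d^'n))))\<^sup>2 * 0
        + 2 * (norm (G0 - G0) + norm G0 * norm (0::real^'d^'n))\<^sup>2 * C"
      by (intro tendsto_intros g_lim h_lim a4)
    then show "(\<lambda>k. 2 * (K * g k)\<^sup>2 * (?A4 k / n k) + 2 * (h k)\<^sup>2 * C) \<longlonglongrightarrow> 0" by simp
  qed
qed

context
  fixes \<mu> w :: "real^'n" and S :: "real^'d^'d" and C :: real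
  assumes w_eq: "w = matrix_inv V *v \<mu>"
    and mean: "(\<lambda>k. avg (n k) (a k)) \<longlonglongrightarrow> \<mu>"
    and S: "(\<lambda>k. avg (n k) (\<lambda>i. outer (transpose (est_fun (a k i) (b k i) X0) *v w)
      (transpose (est_fun (a k i) (b k i) X0) *v w))) \<longlonglongrightarrow> S"
    and F: "eventually (\<lambda>k. sqrt (n k) * norm (avg (n k) (\<lambda>i. est_fun (a k i) (b k i) X0)) \<le> C) sequentially"
    and a4: "(\<lambda>k. avg (n k) (\<lambda>i. (norm (a k i))^4) / n k) \<longlonglongrightarrow> 0"
    and r4: "eventually (\<lambda>k. avg (n k) (\<lambda>i. (norm (resid X0 (a k i) (b k i)))^4) \<le> C) sequentially"
    and s2: "eventually (\<lambda>k. avg (n k) (\<lambda>i. (norm (est_fun (a k i) (b k i) X0))\<^sup>2) \<le> C) sequentially"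
    and r1: "eventually (\<lambda>k. sqrt (n k) * norm (avg (n k) (\<lambda>i. resid X0 (a k i) (b k i))) \<le> C) sequentially"
    and pd: "pos_def ((s * (1 - 2 * (\<mu> \<bullet> w))) *\<^sub>R gram X0 + S)"
begin

lemma w_tendsto: "(\<lambda>k. matrix_inv (V_hat (n k) (a k) (b k) (X k)) *v avg (n k) (a k)) \<longlonglongrightarrow> w"
  unfolding w_eq by (intro tendsto_intros V_hat_inv_tendsto mean)

lemma V_hat_sym: "transpose (V_hat m a' b' X') = V_hat m a' b' X'"
  by (simp add: V_hat_def transpose_diff transpose_scalar transpose_outer flip: avg_transpose)

text \<open>The plug-in quantities \<open>s(a\<^sub>i, b\<^sub>i; X)\<close> and \<open>V_hat\<^sup>-\<^sup>1 avg a\<close> are replaced by their limits inside the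
  average; the error is controlled in mean square and passes to the outer products by the
  Cauchy-Schwarz inequality.\<close>
lemma S_hat_tendsto: "(\<lambda>k. S_hat (n k) (a k) (b k) (X k) (avg (n k) (a k))) \<longlonglongrightarrow> S"
proof -
  define wh where "wh k = matrix_inv (V_hat (n k) (a k) (b k) (X k)) *v avg (n k) (a k)" for k
  define e where "e k i = est_fun (a k i) (b k i) (X k)" for k i
  define e0 where "e0 k i = est_fun (a k i) (b k i) X0" for k i
  define q where "q k i = transpose (e0 k i) *v w" for k i
  define qh where "qh k i = transpose (e k i) *v wh k" for k i
  define \<epsilon> where "\<epsilon> k = avg (n k) (\<lambda>i. (norm (e k i - e0 k i))\<^sup>2)" for k
  define \<epsilon>' where "\<epsilon>' k = 2 * (norm (wh k))\<^sup>2 * \<epsilon> k + 2 * (norm (wh k - w))\<^sup>2 * C" for k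
  have \<epsilon>: "\<epsilon> \<longlonglongrightarrow> 0"
    using avg_est_fun_diff_null[OF F a4 r4] by (simp add: \<epsilon>_def[abs_def] e_def e0_def)
  have wh: "wh \<longlonglongrightarrow> w" using w_tendsto by (simp add: wh_def[abs_def])
  have "(\<lambda>k. \<epsilon>' k) \<longlonglongrightarrow> 2 * (norm w)\<^sup>2 * 0 + 2 * (norm (w - w))\<^sup>2 * C"
    unfolding \<epsilon>'_def by (intro tendsto_intros \<epsilon> wh)
  then have \<epsilon>': "\<epsilon>' \<longlonglongrightarrow> 0" by simp
  have dq: "eventually (\<lambda>k. avg (n k) (\<lambda>i. (norm (qh k i - q k i))\<^sup>2) \<le> \<epsilon>' k) sequentially"
    using s2[folded e0_def]
  proof eventually_elim
    case (elim k)
    have "(norm (qh k i - q k i))\<^sup>2 \<le> 2 * (norm (wh k))\<^sup>2 * (norm (e k i - e0 k i))\<^sup>2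
        + 2 * (norm (wh k - w))\<^sup>2 * (norm (e0 k i))\<^sup>2" for i
    proof -
      have eq: "qh k i - q k i = transpose (e k i - e0 k i) *v wh k + transpose (e0 k i) *v (wh k - w)"
        by (simp add: qh_def q_def transpose_diff matrix_vector_mult_diff_rdistrib matrix_vector_mult_diff_distrib)
      have "(norm (qh k i - q k i))\<^sup>2 \<le> 2 * (norm (transpose (e k i - e0 k i) *v wh k))\<^sup>2
          + 2 * (norm (transpose (e0 k i) *v (wh k - w)))\<^sup>2"
        unfolding eq by (rule norm_sq_add_le)
      also have "\<dots> \<le> 2 * (norm (transpose (e k i - e0 k i)) * norm (wh k))\<^sup>2
          + 2 * (norm (transpose (e0 k i)) * norm (wh k - w))\<^sup>2"
        by (intro add_mono mult_left_mono power_mono norm_matrix_vector_le) auto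
      finally show ?thesis by (simp add: norm_transpose power_mult_distrib algebra_simps)
    qed
    then have "avg (n k) (\<lambda>i. (norm (qh k i - q k i))\<^sup>2)
        \<le> 2 * (norm (wh k))\<^sup>2 * \<epsilon> k + 2 * (norm (wh k - w))\<^sup>2 * avg (n k) (\<lambda>i. (norm (e0 k i))\<^sup>2)"
      unfolding \<epsilon>_def avg_mult_left[symmetric] avg_add[symmetric] by (intro avg_mono)
    also have "\<dots> \<le> \<epsilon>' k"
      unfolding \<epsilon>'_def using elim by (intro add_left_mono mult_left_mono) auto
    finally show ?case .
  qed
  have q2: "eventually (\<lambda>k. avg (n k) (\<lambda>i. (norm (q k i))\<^sup>2) \<le> (norm w)\<^sup>2 * C) sequentially"
    using s2[folded e0_def]
  proof eventually_elim
    case (elim k)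
    have "avg (n k) (\<lambda>i. (norm (q k i))\<^sup>2) \<le> avg (n k) (\<lambda>i. (norm w)\<^sup>2 * (norm (e0 k i))\<^sup>2)"
    proof (rule avg_mono)
      fix i
      have "(norm (q k i))\<^sup>2 \<le> (norm (transpose (e0 k i)) * norm w)\<^sup>2"
        unfolding q_def by (intro power_mono norm_matrix_vector_le) auto
      then show "(norm (q k i))\<^sup>2 \<le> (norm w)\<^sup>2 * (norm (e0 k i))\<^sup>2"
        by (simp add: norm_transpose power_mult_distrib mult.commute)
    qed
    also have "\<dots> \<le> (norm w)\<^sup>2 * C"
      unfolding avg_mult_left using elim by (intro mult_left_mono) auto
    finally show ?case .
  qed
  have "(\<lambda>k. avg (n k) (\<lambda>i. outer (qh k i) (qh k i)) - avg (n k) (\<lambda>i. outer (q k i) (q k i))) \<longlonglongrightarrow> 0"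
  proof (rule Lim_null_comparison)
    show "eventually (\<lambda>k. norm (avg (n k) (\<lambda>i. outer (qh k i) (qh k i)) - avg (n k) (\<lambda>i. outer (q k i) (q k i)))
      \<le> \<epsilon>' k + 2 * (sqrt ((norm w)\<^sup>2 * C) * sqrt (\<epsilon>' k))) sequentially"
      using dq q2
    proof eventually_elim
      case (elim k)
      have "norm (avg (n k) (\<lambda>i. outer (qh k i) (qh k i)) - avg (n k) (\<lambda>i. outer (q k i) (q k i)))
        \<le> avg (n k) (\<lambda>i. norm (outer (qh k i) (qh k i) - outer (q k i) (q k i)))"
        unfolding avg_diff[symmetric] by (rule norm_avg_le)
      also have "\<dots> \<le> avg (n k) (\<lambda>i. (norm (qh k i - q k i))\<^sup>2 + 2 * (\<bar>norm (q k i)\<bar> * \<bar>norm (qh k i - q k i)\<bar>))"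
        by (intro avg_mono) (use norm_outer_diff_le in simp)
      also have "\<dots> = avg (n k) (\<lambda>i. (norm (qh k i - q k i))\<^sup>2)
          + 2 * avg (n k) (\<lambda>i. \<bar>norm (q k i)\<bar> * \<bar>norm (qh k i - q k i)\<bar>)"
        by (simp only: avg_add avg_mult_left)
      also have "\<dots> \<le> avg (n k) (\<lambda>i. (norm (qh k i - q k i))\<^sup>2)
          + 2 * (sqrt (avg (n k) (\<lambda>i. (norm (q k i))\<^sup>2)) * sqrt (avg (n k) (\<lambda>i. (norm (qh k i - q k i))\<^sup>2)))"
        using avg_Cauchy_Schwarz[of "n k" "\<lambda>i. norm (q k i)" "\<lambda>i. norm (qh k i - q k i)"] by simp
      also have "avg (n k) (\<lambda>i. (norm (qh k i - q k i))\<^sup>2)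
          + 2 * (sqrt (avg (n k) (\<lambda>i. (norm (q k i))\<^sup>2)) * sqrt (avg (n k) (\<lambda>i. (norm (qh k i - q k i))\<^sup>2)))
        \<le> \<epsilon>' k + 2 * (sqrt ((norm w)\<^sup>2 * C) * sqrt (\<epsilon>' k))"
        using elim order_trans[OF avg_nonneg elim(2)]
        by (intro add_mono mult_left_mono mult_mono real_sqrt_le_mono) (auto intro: avg_nonneg order_trans)
      finally show ?case .
    qed
    have "(\<lambda>k. \<epsilon>' k + 2 * (sqrt ((norm w)\<^sup>2 * C) * sqrt (\<epsilon>' k))) \<longlonglongrightarrow> 0 + 2 * (sqrt ((norm w)\<^sup>2 * C) * sqrt 0)"
      by (intro tendsto_intros \<epsilon>')
    then show "(\<lambda>k. \<epsilon>' k + 2 * (sqrt ((norm w)\<^sup>2 * C) * sqrt (\<epsilon>' k))) \<longlonglongrightarrow> 0" by simp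
  qed
  from tendsto_add[OF this S[folded e0_def q_def]]
  have "(\<lambda>k. avg (n k) (\<lambda>i. outer (qh k i) (qh k i))) \<longlonglongrightarrow> S" by simp
  then show ?thesis
  proof (rule Lim_transform_eventually)
    show "eventually (\<lambda>k. avg (n k) (\<lambda>i. outer (qh k i) (qh k i)) =
        S_hat (n k) (a k) (b k) (X k) (avg (n k) (a k))) sequentially"
      using V_hat_inv_tendsto(1)
      by eventually_elim
        (simp add: S_hat_def Let_def weighted_outer transpose_matrix_inv V_hat_sym qh_def wh_def e_def)
  qed
qed

abbreviation (input) "limit_cov \<equiv> (s * (1 - 2 * (\<mu> \<bullet> w))) *\<^sub>R gram X0 + S"

lemma Sigma_T_hat_tendsto: "(\<lambda>k. Sigma_T_hat (n k) (a k) (b k) (X k)) \<longlonglongrightarrow> limit_cov"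
  unfolding Sigma_T_hat_def Let_def gram_def[symmetric]
  by (intro tendsto_intros sigma2_hat_tendsto mean w_tendsto gram_tendsto S_hat_tendsto)

lemma transpose_S_hat:
  assumes "invertible (V_hat m a' b' X')"
  shows "transpose (S_hat m a' b' X' \<nu>) = S_hat m a' b' X' \<nu>"
  unfolding S_hat_def Let_def
  by (simp add: weighted_outer transpose_matrix_inv[OF assms V_hat_sym] transpose_outer flip: avg_transpose)

lemma T2_eventually_defined:
  "eventually (\<lambda>k. T2_defined (n k) (a k) (b k) (Some (X k))) sequentially"
proof -
  have "eventually (\<lambda>k. transpose (Sigma_T_hat (n k) (a k) (b k) (X k)) = Sigma_T_hat (n k) (a k) (b k) (X k)) sequentially"
    using V_hat_inv_tendsto(1)
    by eventually_elim
      (simp add: Sigma_T_hat_def Let_def transpose_add transpose_scalar transpose_S_hat gram_sym flip: gram_def)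
  from eventually_pos_def[OF Sigma_T_hat_tendsto pd this]
  show ?thesis using V_hat_inv_tendsto(1) n_ge_1
    by eventually_elim (simp add: T2_defined_def)
qed

text \<open>\<open>T0_stat = - avg \<rho> - D\<^sup>T avg a\<close> and, by the expansion of \<open>D\<close>, the last term is approximately
  \<open>(avg s(a\<^sub>i, b\<^sub>i; X\<^sub>0))\<^sup>T V\<^sup>-\<^sup>1 \<mu>\<close>.\<close>
lemma T0_stat_expansion:
  fixes u :: "nat \<Rightarrow> real^'d"
  defines "u \<equiv> \<lambda>k. avg (n k) (\<lambda>i. transpose (est_fun (a k i) (b k i) X0) *v w - resid X0 (a k i) (b k i))"
  shows "(\<lambda>k. sqrt (n k) *\<^sub>R T0_stat (n k) (a k) (b k) (X k) - sqrt (n k) *\<^sub>R u k) \<longlonglongrightarrow> 0"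
    and "\<exists>K. eventually (\<lambda>k. norm (sqrt (n k) *\<^sub>R u k) \<le> K) sequentially"
proof -
  define D where "D k = X k - X0" for k
  define F where "F k = avg (n k) (\<lambda>i. est_fun (a k i) (b k i) X0)" for k
  define r where "r k = avg (n k) (\<lambda>i. resid X0 (a k i) (b k i))" for k
  have u: "u k = transpose (F k) *v w - r k" for k
    by (simp add: u_def F_def r_def avg_diff avg_matrix_vector_mult_left avg_transpose)
  have T0: "T0_stat (n k) (a k) (b k) (X k) = - r k - transpose (D k) *v avg (n k) (a k)" for k
  proof -
    have "b k i - transpose (X k) *v a k i = - resid X0 (a k i) (b k i) - transpose (D k) *v a k i" for i
      using resid_shift[of "X k" "a k i" "b k i" X0] by (simp add: resid_def D_def)
    then show ?thesis
      by (simp add: T0_stat_def r_def avg_diff avg_minus avg_matrix_vector_mult)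
  qed
  obtain K where K: "eventually (\<lambda>k. sqrt (n k) * norm (D k) \<le> K) sequentially"
    using sqrt_n_expansion(2)[OF F] by (auto simp: D_def)
  have "(\<lambda>k. transpose (sqrt (n k) *\<^sub>R (V ** D k + F k)) *v w) \<longlonglongrightarrow> transpose 0 *v w"
    using sqrt_n_expansion(1)[OF F] unfolding D_def F_def by (intro tendsto_intros)
  then have 1: "(\<lambda>k. transpose (sqrt (n k) *\<^sub>R (V ** D k + F k)) *v w) \<longlonglongrightarrow> 0"
    by (simp add: transpose_def zero_vec_def matrix_vector_mult_def)
  have 2: "(\<lambda>k. transpose (sqrt (n k) *\<^sub>R D k) *v (avg (n k) (a k) - \<mu>)) \<longlonglongrightarrow> 0"
  proof (rule Lim_null_comparison)
    show "eventually (\<lambda>k. norm (transpose (sqrt (n k) *\<^sub>R D k) *v (avg (n k) (a k) - \<mu>)) \<le> K * norm (avg (n k) (a k) - \<mu>)) sequentially"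
      using K
    proof eventually_elim
      case (elim k)
      have "norm (transpose (sqrt (n k) *\<^sub>R D k) *v (avg (n k) (a k) - \<mu>))
        \<le> norm (transpose (sqrt (n k) *\<^sub>R D k)) * norm (avg (n k) (a k) - \<mu>)" by (rule norm_matrix_vector_le)
      also have "\<dots> \<le> K * norm (avg (n k) (a k) - \<mu>)"
        using elim unfolding norm_transpose by (intro mult_right_mono) auto
      finally show ?case .
    qed
    have "(\<lambda>k. K * norm (avg (n k) (a k) - \<mu>)) \<longlonglongrightarrow> K * norm (\<mu> - \<mu>)"
      by (intro tendsto_intros mean)
    then show "(\<lambda>k. K * norm (avg (n k) (a k) - \<mu>)) \<longlonglongrightarrow> 0" by simp
  qed
  have Vw: "V *v w = \<mu>"
    by (simp add: w_eq matrix_vector_mul_assoc matrix_inv_mult[OF pos_def_invertible[OF V]])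
  have "sqrt (n k) *\<^sub>R T0_stat (n k) (a k) (b k) (X k) - sqrt (n k) *\<^sub>R u k =
      - (transpose (sqrt (n k) *\<^sub>R (V ** D k + F k)) *v w)
      - transpose (sqrt (n k) *\<^sub>R D k) *v (avg (n k) (a k) - \<mu>)" for k
    by (simp add: T0 u transpose_scalar transpose_add matrix_transpose_mul pos_def_sym[OF V]
        matrix_vector_mult_add_rdistrib matrix_vector_mult_diff_distrib Vw algebra_simps
        flip: matrix_vector_mul_assoc scaleR_matrix_vector_assoc)
  then show "(\<lambda>k. sqrt (n k) *\<^sub>R T0_stat (n k) (a k) (b k) (X k) - sqrt (n k) *\<^sub>R u k) \<longlonglongrightarrow> 0"
    using tendsto_diff[OF tendsto_minus[OF 1] 2] by simp
  have "eventually (\<lambda>k. norm (sqrt (n k) *\<^sub>R u k) \<le> C * norm w + C) sequentially"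
    using F r1 unfolding F_def[symmetric] r_def[symmetric]
  proof eventually_elim
    case (elim k)
    have "norm (transpose (F k) *v w) \<le> norm (F k) * norm w"
      using norm_matrix_vector_le[of "transpose (F k)" w] by (simp add: norm_transpose)
    then have "norm (u k) \<le> norm (F k) * norm w + norm (r k)"
      unfolding u using norm_triangle_ineq4[of "transpose (F k) *v w" "r k"] by linarith
    then have "sqrt (n k) * norm (u k) \<le> sqrt (n k) * (norm (F k) * norm w + norm (r k))" by (intro mult_left_mono) auto
    also have "\<dots> = (sqrt (n k) * norm (F k)) * norm w + sqrt (n k) * norm (r k)" by (simp add: algebra_simps)
    also have "\<dots> \<le> C * norm w + C" using elim by (intro add_mono mult_right_mono) auto
    finally show ?case by simp
  qed
  then show "\<exists>K. eventually (\<lambda>k. norm (sqrt (n k) *\<^sub>R u k) \<le> K) sequentially" by blast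
qed

lemma T2_stat_expansion:
  fixes u :: "nat \<Rightarrow> real^'d"
  defines "u \<equiv> \<lambda>k. avg (n k) (\<lambda>i. transpose (est_fun (a k i) (b k i) X0) *v w - resid X0 (a k i) (b k i))"
  shows "(\<lambda>k. T2_stat (n k) (a k) (b k) (X k) - n k * (u k \<bullet> (matrix_inv limit_cov *v u k))) \<longlonglongrightarrow> 0"
proof -
  define x where "x k = sqrt (n k) *\<^sub>R T0_stat (n k) (a k) (b k) (X k)" for k
  define y where "y k = sqrt (n k) *\<^sub>R u k" for k
  define A where "A k = matrix_inv (Sigma_T_hat (n k) (a k) (b k) (X k))" for k
  define A0 where "A0 = matrix_inv limit_cov"
  have A: "A \<longlonglongrightarrow> A0"
    unfolding A_def[abs_def] A0_def by (intro tendsto_matrix_inv Sigma_T_hat_tendsto pos_def_invertible pd)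
  have xy: "(\<lambda>k. x k - y k) \<longlonglongrightarrow> 0"
    using T0_stat_expansion(1) by (simp add: x_def y_def u_def)
  obtain K where K: "eventually (\<lambda>k. norm (y k) \<le> K) sequentially"
    using T0_stat_expansion(2) by (auto simp: y_def u_def)
  let ?e = "\<lambda>k. norm (A k) * (norm (x k - y k))\<^sup>2 + 2 * norm (A k) * (K * norm (x k - y k)) + norm (A k - A0) * K\<^sup>2"
  have "(\<lambda>k. x k \<bullet> (A k *v x k) - y k \<bullet> (A0 *v y k)) \<longlonglongrightarrow> 0"
  proof (rule Lim_null_comparison)
    show "eventually (\<lambda>k. norm (x k \<bullet> (A k *v x k) - y k \<bullet> (A0 *v y k)) \<le> ?e k) sequentially"
      using K
    proof eventually_elim
      case (elim k)
      define d where "d = x k - y k"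
      have "x k \<bullet> (A k *v x k) - y k \<bullet> (A0 *v y k) =
          d \<bullet> (A k *v d) + d \<bullet> (A k *v y k) + y k \<bullet> (A k *v d) + y k \<bullet> ((A k - A0) *v y k)"
        by (simp add: d_def matrix_vector_mult_diff_distrib matrix_vector_mult_diff_rdistrib
            inner_diff_left inner_diff_right)
      moreover have "\<bar>d \<bullet> (A k *v d)\<bar> \<le> norm (A k) * (norm d)\<^sup>2"
        using quadratic_form_bound[of d "A k" d] by (simp add: power2_eq_square mult.assoc)
      moreover have "\<bar>d \<bullet> (A k *v y k)\<bar> \<le> norm (A k) * (K * norm d)"
      proof -
        have "\<bar>d \<bullet> (A k *v y k)\<bar> \<le> norm (A k) * (norm (y k) * norm d)"
          using quadratic_form_bound[of d "A k" "y k"] by (simp add: mult_ac)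
        also have "\<dots> \<le> norm (A k) * (K * norm d)" using elim by (intro mult_left_mono mult_right_mono) auto
        finally show ?thesis .
      qed
      moreover have "\<bar>y k \<bullet> (A k *v d)\<bar> \<le> norm (A k) * (K * norm d)"
      proof -
        have "\<bar>y k \<bullet> (A k *v d)\<bar> \<le> norm (A k) * (norm (y k) * norm d)"
          using quadratic_form_bound[of "y k" "A k" d] by (simp add: mult_ac)
        also have "\<dots> \<le> norm (A k) * (K * norm d)" using elim by (intro mult_left_mono mult_right_mono) auto
        finally show ?thesis .
      qed
      moreover have "\<bar>y k \<bullet> ((A k - A0) *v y k)\<bar> \<le> norm (A k - A0) * K\<^sup>2"
      proof -
        have "\<bar>y k \<bullet> ((A k - A0) *v y k)\<bar> \<le> norm (A k - A0) * (norm (y k))\<^sup>2"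
          using quadratic_form_bound[of "y k" "A k - A0" "y k"] by (simp add: power2_eq_square mult.assoc)
        also have "\<dots> \<le> norm (A k - A0) * K\<^sup>2" using elim by (intro mult_left_mono power_mono) auto
        finally show ?thesis .
      qed
      ultimately show ?case unfolding d_def[symmetric] real_norm_def by linarith
    qed
    have "?e \<longlonglongrightarrow> norm A0 * (norm (0::real^'d))\<^sup>2 + 2 * norm A0 * (K * norm (0::real^'d)) + norm (A0 - A0) * K\<^sup>2"
      by (intro tendsto_intros A xy)
    then show "?e \<longlonglongrightarrow> 0" by simp
  qed
  then show ?thesis
  proof (rule Lim_transform_eventually)
    show "eventually (\<lambda>k. x k \<bullet> (A k *v x k) - y k \<bullet> (A0 *v y k) =
        T2_stat (n k) (a k) (b k) (X k) - n k * (u k \<bullet> (matrix_inv limit_cov *v u k))) sequentially"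
      using T2_eventually_defined
    proof eventually_elim
      case (elim k)
      then have "pos_def (Sigma_T_hat (n k) (a k) (b k) (X k))" by (simp add: T2_defined_def)
      then show ?case
        by (simp add: T2_stat_def norm_inv_sqrt_matrix_mult x_def y_def A_def A0_def matrix_vector_mult_scaleR
            mult.assoc[symmetric])
    qed
  qed
qed

end

end

end

section \<open>From data sequences to convergence in probability\<close>

context prob_space
begin

text \<open>If the conclusion failed, the bad event would have probability at least some \<open>\<delta>\<close> for infinitely many
  \<open>m\<close>. By Markov's inequality it would then contain, for infinitely many \<open>m\<close>, a point where \<open>S m\<close> is below a
  threshold \<open>t m \<longlonglongrightarrow> 0\<close> and \<open>B m\<close> is below a constant, and these points would contradict \<open>det\<close>.\<close>
lemma null_in_probI:
  fixes S B R :: "nat \<Rightarrow> 'a \<Rightarrow> real"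
  assumes S: "\<And>m. integrable M (S m)" "\<And>m \<omega>. 0 \<le> S m \<omega>" "(\<lambda>m. expectation (S m)) \<longlonglongrightarrow> 0"
    and B: "\<And>m. integrable M (B m)" "\<And>m \<omega>. 0 \<le> B m \<omega>" "\<And>m. expectation (B m) \<le> C"
    and R [measurable]: "\<And>m. R m \<in> borel_measurable M"
    and det: "\<And>n \<omega> K. strict_mono n \<Longrightarrow> (\<And>k. \<omega> k \<in> space M) \<Longrightarrow> (\<lambda>k. S (n k) (\<omega> k)) \<longlonglongrightarrow> 0 \<Longrightarrow>
      (\<And>k. B (n k) (\<omega> k) \<le> K) \<Longrightarrow> (\<lambda>k. R (n k) (\<omega> k)) \<longlonglongrightarrow> 0"
    and \<epsilon>: "0 < \<epsilon>"
  shows "(\<lambda>m. prob {\<omega>\<in>space M. \<epsilon> \<le> \<bar>R m \<omega>\<bar>}) \<longlonglongrightarrow> 0"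
proof (rule ccontr)
  note [measurable] = borel_measurable_integrable[OF S(1)] borel_measurable_integrable[OF B(1)]
  let ?bad = "\<lambda>m. {\<omega>\<in>space M. \<epsilon> \<le> \<bar>R m \<omega>\<bar>}"
  assume "\<not> ?thesis"
  then obtain \<delta> where \<delta>: "0 < \<delta>" "\<exists>\<^sub>F m in sequentially. \<not> prob (?bad m) < \<delta>"
    unfolding tendsto_iff by (auto simp: not_eventually dist_real_def)
  \<comment> \<open>The summand \<open>1 / (m + 1)\<close> keeps the threshold positive where \<open>E (S m) = 0\<close>.\<close>
  define t where "t m = sqrt (expectation (S m) + inverse (real (Suc m)))" for m
  have ES: "0 \<le> expectation (S m)" for m using S(2) by (simp add: integral_nonneg)
  then have t_pos: "0 < t m" for m by (simp add: t_def add_nonneg_pos)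
  have "(\<lambda>m. t m) \<longlonglongrightarrow> sqrt (0 + 0)"
    unfolding t_def by (intro tendsto_intros S(3) LIMSEQ_inverse_real_of_nat)
  then have t: "t \<longlonglongrightarrow> 0" by simp
  have "0 \<le> expectation (B 0)" using B(2) by (simp add: integral_nonneg)
  then have "0 \<le> C" using B(3)[of 0] by linarith
  define K where "K = 4 * (C + 1) / \<delta>"
  have K: "0 < K" "C / K < \<delta> / 2" using \<delta>(1) \<open>0 \<le> C\<close> by (auto simp: K_def field_simps intro: add_pos_nonneg)
  have PS: "prob {\<omega>\<in>space M. t m \<le> S m \<omega>} \<le> t m" for m
  proof -
    have "prob {\<omega>\<in>space M. t m \<le> S m \<omega>} \<le> expectation (S m) / t m"
      by (rule integral_Markov_inequality_measure[where A="{}"]) (use S t_pos in auto)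
    also have "\<dots> \<le> (t m)\<^sup>2 / t m"
      using ES[of m] t_pos[of m] by (intro divide_right_mono) (auto simp: t_def)
    finally show ?thesis using t_pos[of m] by (simp add: power2_eq_square)
  qed
  have PB: "prob {\<omega>\<in>space M. K \<le> B m \<omega>} < \<delta> / 2" for m
  proof -
    have "prob {\<omega>\<in>space M. K \<le> B m \<omega>} \<le> expectation (B m) / K"
      by (rule integral_Markov_inequality_measure[where A="{}"]) (use B K in auto)
    also have "\<dots> \<le> C / K" using B(3)[of m] K by (intro divide_right_mono) auto
    finally show ?thesis using K(2) by linarith
  qed
  have ev: "eventually (\<lambda>m. t m < \<delta> / 2) sequentially"
    using t \<delta>(1) by (intro order_tendstoD(2)) auto
  have "\<exists>\<^sub>F m in sequentially. \<not> prob (?bad m) < \<delta> \<and> t m < \<delta> / 2"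
    using frequently_eventually_frequently[OF \<delta>(2) ev] .
  then have freq: "\<exists>\<^sub>F m in sequentially. \<exists>\<omega>\<in>space M. \<epsilon> \<le> \<bar>R m \<omega>\<bar> \<and> S m \<omega> < t m \<and> B m \<omega> < K"
  proof (rule frequently_elim1)
    fix m assume m: "\<not> prob (?bad m) < \<delta> \<and> t m < \<delta> / 2"
    show "\<exists>\<omega>\<in>space M. \<epsilon> \<le> \<bar>R m \<omega>\<bar> \<and> S m \<omega> < t m \<and> B m \<omega> < K"
    proof (rule ccontr)
      assume "\<not> ?thesis"
      then have "?bad m \<subseteq> {\<omega>\<in>space M. t m \<le> S m \<omega>} \<union> {\<omega>\<in>space M. K \<le> B m \<omega>}" by force
      then have "prob (?bad m) \<le> prob ({\<omega>\<in>space M. t m \<le> S m \<omega>} \<union> {\<omega>\<in>space M. K \<le> B m \<omega>})"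
        by (intro finite_measure_mono) auto
      also have "\<dots> \<le> prob {\<omega>\<in>space M. t m \<le> S m \<omega>} + prob {\<omega>\<in>space M. K \<le> B m \<omega>}"
        by (intro measure_Un_le) auto
      also have "\<dots> < \<delta>" using PS[of m] PB[of m] m by linarith
      finally show False using m by simp
    qed
  qed
  define I where "I = {m. \<exists>\<omega>\<in>space M. \<epsilon> \<le> \<bar>R m \<omega>\<bar> \<and> S m \<omega> < t m \<and> B m \<omega> < K}"
  have inf: "infinite I"
    using freq by (simp add: I_def frequently_cofinite[symmetric] cofinite_eq_sequentially)
  define n where "n = enumerate I"
  have mono: "strict_mono n" using inf by (simp add: n_def strict_mono_enumerate)
  have "\<forall>k. \<exists>\<omega>. \<omega> \<in> space M \<and> \<epsilon> \<le> \<bar>R (n k) \<omega>\<bar> \<and> S (n k) \<omega> < t (n k) \<and> B (n k) \<omega> < K"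
    using enumerate_in_set[OF inf] by (auto simp: n_def I_def)
  then obtain \<omega> where \<omega>: "\<And>k. \<omega> k \<in> space M" "\<And>k. \<epsilon> \<le> \<bar>R (n k) (\<omega> k)\<bar>"
    "\<And>k. S (n k) (\<omega> k) < t (n k)" "\<And>k. B (n k) (\<omega> k) < K" by metis
  have "(\<lambda>k. S (n k) (\<omega> k)) \<longlonglongrightarrow> 0"
  proof (rule Lim_null_comparison)
    show "eventually (\<lambda>k. norm (S (n k) (\<omega> k)) \<le> t (n k)) sequentially"
      using S(2) \<omega>(3) by (auto intro!: always_eventually simp: less_imp_le)
    show "(\<lambda>k. t (n k)) \<longlonglongrightarrow> 0"
      using LIMSEQ_subseq_LIMSEQ[OF t mono] by (simp add: comp_def)
  qed
  from det[OF mono \<omega>(1) this less_imp_le[OF \<omega>(4)]]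
  have "(\<lambda>k. \<bar>R (n k) (\<omega> k)\<bar>) \<longlonglongrightarrow> 0" by (rule tendsto_rabs_zero)
  then have "\<epsilon> \<le> 0" by (rule LIMSEQ_le_const) (use \<omega>(2) in auto)
  then show False using \<epsilon> by simp
qed

end

section \<open>Laws of large numbers for weighted iid terms\<close>

locale iid_vectors = prob_space M for M :: "'w measure" +
  fixes c :: "nat \<Rightarrow> 'w \<Rightarrow> 'c::second_countable_topology"
  assumes indep: "indep_vars (\<lambda>_. borel) c {1..}"
    and ident: "\<And>i. 1 \<le> i \<Longrightarrow> distr M borel (c i) = distr M borel (c 1)"
begin

lemma c_measurable: "1 \<le> i \<Longrightarrow> c i \<in> borel_measurable M"
  using indep by (auto simp: indep_vars_def)

lemma integrable_ident:
  fixes g :: "'c \<Rightarrow> 'v::{banach, second_countable_topology}"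
  assumes "g \<in> borel_measurable borel" "1 \<le> i"
  shows "integrable M (\<lambda>\<omega>. g (c i \<omega>)) \<longleftrightarrow> integrable M (\<lambda>\<omega>. g (c 1 \<omega>))"
  using assms integrable_distr_eq[OF c_measurable[of i], of g] integrable_distr_eq[OF c_measurable[of 1], of g]
    ident[of i] by simp

lemma expectation_ident:
  fixes g :: "'c \<Rightarrow> 'v::{banach, second_countable_topology}"
  assumes "g \<in> borel_measurable borel" "1 \<le> i"
  shows "(\<integral>\<omega>. g (c i \<omega>) \<partial>M) = (\<integral>\<omega>. g (c 1 \<omega>) \<partial>M)"
  using assms integral_distr[OF c_measurable[of i], of g] integral_distr[OF c_measurable[of 1], of g]
    ident[of i] by simp

lemma expectation_sum_sq:
  fixes f :: "nat \<Rightarrow> 'c \<Rightarrow> real"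
  assumes f [measurable]: "\<And>i. f i \<in> borel_measurable borel"
    and sq: "\<And>i. 1 \<le> i \<Longrightarrow> integrable M (\<lambda>\<omega>. (f i (c i \<omega>))\<^sup>2)"
    and zero: "\<And>i. 1 \<le> i \<Longrightarrow> expectation (\<lambda>\<omega>. f i (c i \<omega>)) = 0"
  shows "integrable M (\<lambda>\<omega>. (\<Sum>i=1..m. f i (c i \<omega>))\<^sup>2)"
    and "expectation (\<lambda>\<omega>. (\<Sum>i=1..m. f i (c i \<omega>))\<^sup>2) = (\<Sum>i=1..m. expectation (\<lambda>\<omega>. (f i (c i \<omega>))\<^sup>2))"
proof -
  note [measurable] = c_measurable
  have int: "integrable M (\<lambda>\<omega>. f i (c i \<omega>))" if "1 \<le> i" for i
    by (rule square_integrable_imp_integrable[OF _ sq[OF that]]) (use that in measurable)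
  have prod: "integrable M (\<lambda>\<omega>. f i (c i \<omega>) * f j (c j \<omega>)) \<and>
      expectation (\<lambda>\<omega>. f i (c i \<omega>) * f j (c j \<omega>)) = (if i = j then expectation (\<lambda>\<omega>. (f i (c i \<omega>))\<^sup>2) else 0)"
    if ij: "1 \<le> i" "1 \<le> j" for i j
  proof (cases "i = j")
    case True
    then show ?thesis using sq[OF ij(1)] by (simp add: power2_eq_square)
  next
    case False
    have "indep_vars (\<lambda>_. borel) (\<lambda>i \<omega>. f i (c i \<omega>)) {i, j}"
      using ij by (intro indep_vars_compose2[OF indep_vars_subset[OF indep]]) auto
    then have "integrable M (\<lambda>\<omega>. \<Prod>k\<in>{i, j}. f k (c k \<omega>))"
      "expectation (\<lambda>\<omega>. \<Prod>k\<in>{i, j}. f k (c k \<omega>)) = (\<Prod>k\<in>{i, j}. expectation (\<lambda>\<omega>. f k (c k \<omega>)))"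
      using int ij by (auto intro!: indep_vars_integrable indep_vars_lebesgue_integral)
    then show ?thesis using False zero[OF ij(1)] by simp
  qed
  have eq: "(\<Sum>i=1..m. f i (c i \<omega>))\<^sup>2 = (\<Sum>i=1..m. \<Sum>j=1..m. f i (c i \<omega>) * f j (c j \<omega>))" for \<omega>
    by (simp add: power2_eq_square sum_product)
  show "integrable M (\<lambda>\<omega>. (\<Sum>i=1..m. f i (c i \<omega>))\<^sup>2)"
    unfolding eq by (intro Bochner_Integration.integrable_sum) (use prod in auto)
  have "expectation (\<lambda>\<omega>. (\<Sum>i=1..m. f i (c i \<omega>))\<^sup>2) =
      (\<Sum>i=1..m. expectation (\<lambda>\<omega>. \<Sum>j=1..m. f i (c i \<omega>) * f j (c j \<omega>)))"
    unfolding eq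
    by (intro Bochner_Integration.integral_sum Bochner_Integration.integrable_sum) (use prod in auto)
  also have "\<dots> = (\<Sum>i=1..m. \<Sum>j=1..m. expectation (\<lambda>\<omega>. f i (c i \<omega>) * f j (c j \<omega>)))"
    by (intro sum.cong refl Bochner_Integration.integral_sum) (use prod in auto)
  also have "\<dots> = (\<Sum>i=1..m. \<Sum>j=1..m. if i = j then expectation (\<lambda>\<omega>. (f i (c i \<omega>))\<^sup>2) else 0)"
    using prod by (intro sum.cong) auto
  also have "\<dots> = (\<Sum>i=1..m. expectation (\<lambda>\<omega>. (f i (c i \<omega>))\<^sup>2))"
    by (intro sum.cong refl) (simp add: sum.delta)
  finally show "expectation (\<lambda>\<omega>. (\<Sum>i=1..m. f i (c i \<omega>))\<^sup>2) = (\<Sum>i=1..m. expectation (\<lambda>\<omega>. (f i (c i \<omega>))\<^sup>2))" .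
qed

lemma integrable_avg:
  fixes g :: "nat \<Rightarrow> 'w \<Rightarrow> 'v::{banach, second_countable_topology}"
  assumes "\<And>i. 1 \<le> i \<Longrightarrow> integrable M (g i)"
  shows "integrable M (\<lambda>\<omega>. avg m (\<lambda>i. g i \<omega>))"
  unfolding avg_def using assms by (intro integrable_scaleR_right Bochner_Integration.integrable_sum) auto

lemma expectation_avg:
  fixes g :: "nat \<Rightarrow> 'w \<Rightarrow> 'v::{banach, second_countable_topology}"
  assumes "\<And>i. 1 \<le> i \<Longrightarrow> integrable M (g i)"
  shows "(\<integral>\<omega>. avg m (\<lambda>i. g i \<omega>) \<partial>M) = avg m (\<lambda>i. \<integral>\<omega>. g i \<omega> \<partial>M)"
  unfolding avg_def using assms by (simp add: Bochner_Integration.integral_sum)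

lemma avg_mono_ge_1: "(\<And>i. 1 \<le> i \<Longrightarrow> f i \<le> g i) \<Longrightarrow> avg m f \<le> avg m g" for f :: "nat \<Rightarrow> real"
  by (auto simp add: avg_def intro!: divide_right_mono sum_mono)

lemma avg_cong: "(\<And>i. 1 \<le> i \<Longrightarrow> f i = g i) \<Longrightarrow> avg m f = avg m g"
  by (auto simp add: avg_def intro!: arg_cong[where f="\<lambda>x. _ *\<^sub>R x"] sum.cong)

text \<open>A fixed function \<open>g\<close> that is merely integrable, with deterministic weights. Truncate \<open>g\<close> at a
  level where the remainder is small in \<open>L\<^sup>1\<close>; the average of the truncated terms is small in \<open>L\<^sup>2\<close>.\<close>
lemma weighted_lln:
  fixes \<alpha> :: "nat \<Rightarrow> real" and g :: "'c \<Rightarrow> real"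
  assumes g [measurable]: "g \<in> borel_measurable borel" and int: "integrable M (\<lambda>\<omega>. g (c 1 \<omega>))"
    and \<alpha>2: "(\<lambda>m. avg m (\<lambda>i. (\<alpha> i)\<^sup>2) / m) \<longlonglongrightarrow> 0" and \<alpha>1: "\<And>m. avg m (\<lambda>i. \<bar>\<alpha> i\<bar>) \<le> A"
  shows "(\<lambda>m. \<integral>\<omega>. \<bar>avg m (\<lambda>i. \<alpha> i * (g (c i \<omega>) - (\<integral>\<omega>. g (c 1 \<omega>) \<partial>M)))\<bar> \<partial>M) \<longlonglongrightarrow> 0"
proof (rule LIMSEQ_I)
  fix r :: real assume r: "0 < r"
  note [measurable] = c_measurable
  have A: "0 \<le> A" using \<alpha>1[of 0] by (simp add: avg_def)
  define h where "h N x = (if \<bar>g x\<bar> \<le> real N then g x else 0)" for N x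
  have h [measurable]: "h N \<in> borel_measurable borel" for N unfolding h_def by measurable
  have h_bound: "\<bar>h N x\<bar> \<le> real N" for N x by (simp add: h_def)
  have int_h: "integrable M (\<lambda>\<omega>. h N (c i \<omega>))" if "1 \<le> i" for N i
    by (rule integrable_const_bound[of _ "real N"]) (use that h_bound in auto)
  have int_g: "integrable M (\<lambda>\<omega>. g (c i \<omega>))" if "1 \<le> i" for i
    using integrable_ident[OF g that] int by simp
  have "(\<lambda>N. expectation (\<lambda>\<omega>. \<bar>g (c 1 \<omega>) - h N (c 1 \<omega>)\<bar>)) \<longlonglongrightarrow> expectation (\<lambda>\<omega>. 0)"
  proof (rule integral_dominated_convergence)
    show "integrable M (\<lambda>\<omega>. \<bar>g (c 1 \<omega>)\<bar>)" using int by simp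
    show "AE \<omega> in M. (\<lambda>N. \<bar>g (c 1 \<omega>) - h N (c 1 \<omega>)\<bar>) \<longlonglongrightarrow> 0"
    proof (rule AE_I2)
      fix \<omega>
      obtain N0 where "\<bar>g (c 1 \<omega>)\<bar> \<le> real N0" using real_arch_simple by blast
      then have "eventually (\<lambda>N. \<bar>g (c 1 \<omega>) - h N (c 1 \<omega>)\<bar> = 0) sequentially"
        by (intro eventually_sequentiallyI[of N0]) (auto simp: h_def)
      then show "(\<lambda>N. \<bar>g (c 1 \<omega>) - h N (c 1 \<omega>)\<bar>) \<longlonglongrightarrow> 0" by (rule tendsto_eventually)
    qed
  qed (auto simp: h_def)
  then have "eventually (\<lambda>N. expectation (\<lambda>\<omega>. \<bar>g (c 1 \<omega>) - h N (c 1 \<omega>)\<bar>) < r / (6 * (A + 1))) sequentially"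
    using r A by (intro order_tendstoD(2)) auto
  then obtain N where N: "expectation (\<lambda>\<omega>. \<bar>g (c 1 \<omega>) - h N (c 1 \<omega>)\<bar>) < r / (6 * (A + 1))"
    by (auto simp: eventually_sequentially)
  define \<mu>g where "\<mu>g = (\<integral>\<omega>. g (c 1 \<omega>) \<partial>M)"
  define \<mu>h where "\<mu>h = (\<integral>\<omega>. h N (c 1 \<omega>) \<partial>M)"
  define \<eta> where "\<eta> = expectation (\<lambda>\<omega>. \<bar>g (c 1 \<omega>) - h N (c 1 \<omega>)\<bar>)"
  have \<mu>gh: "\<bar>\<mu>g - \<mu>h\<bar> \<le> \<eta>"
  proof -
    have "\<mu>g - \<mu>h = (\<integral>\<omega>. g (c 1 \<omega>) - h N (c 1 \<omega>) \<partial>M)"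
      unfolding \<mu>g_def \<mu>h_def by (rule Bochner_Integration.integral_diff[symmetric, OF int int_h]) simp
    then show ?thesis unfolding \<eta>_def by (simp only: integral_abs_bound)
  qed
  have \<mu>h_bound: "\<bar>\<mu>h\<bar> \<le> real N"
  proof -
    have "\<bar>\<mu>h\<bar> \<le> expectation (\<lambda>\<omega>. \<bar>h N (c 1 \<omega>)\<bar>)" unfolding \<mu>h_def by (rule integral_abs_bound)
    also have "\<dots> \<le> expectation (\<lambda>\<omega>. real N)" using int_h[of 1] h_bound by (intro integral_mono) auto
    finally show ?thesis by (simp add: prob_space)
  qed
  define H where "H m \<omega> = avg m (\<lambda>i. \<alpha> i * (h N (c i \<omega>) - \<mu>h))" for m \<omega>
  define \<epsilon> where "\<epsilon> = r / 6"
  have \<epsilon>: "0 < \<epsilon>" using r by (simp add: \<epsilon>_def)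
  have H_sq: "integrable M (\<lambda>\<omega>. (H m \<omega>)\<^sup>2)"
    "expectation (\<lambda>\<omega>. (H m \<omega>)\<^sup>2) \<le> 4 * (real N)\<^sup>2 * (avg m (\<lambda>i. (\<alpha> i)\<^sup>2) / m)" for m
  proof -
    have sq_bound: "(\<alpha> i * (h N x - \<mu>h))\<^sup>2 \<le> (\<alpha> i)\<^sup>2 * (2 * real N)\<^sup>2" for i x
    proof -
      have "\<bar>h N x - \<mu>h\<bar> \<le> \<bar>2 * real N\<bar>" using h_bound[of N x] \<mu>h_bound by linarith
      then have "(h N x - \<mu>h)\<^sup>2 \<le> (2 * real N)\<^sup>2" by (simp only: abs_le_square_iff)
      then show ?thesis by (simp only: power_mult_distrib mult_left_mono zero_le_power2)
    qed
    have sq_int: "integrable M (\<lambda>\<omega>. (\<alpha> i * (h N (c i \<omega>) - \<mu>h))\<^sup>2)" if "1 \<le> i" for i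
    proof (rule integrable_const_bound)
      show "AE \<omega> in M. norm ((\<alpha> i * (h N (c i \<omega>) - \<mu>h))\<^sup>2) \<le> (\<alpha> i)\<^sup>2 * (2 * real N)\<^sup>2"
        using sq_bound[of i "c i _"] by simp
      show "(\<lambda>\<omega>. (\<alpha> i * (h N (c i \<omega>) - \<mu>h))\<^sup>2) \<in> borel_measurable M" using that by measurable
    qed
    have sq_le: "expectation (\<lambda>\<omega>. (\<alpha> i * (h N (c i \<omega>) - \<mu>h))\<^sup>2) \<le> 4 * (real N)\<^sup>2 * (\<alpha> i)\<^sup>2" if "1 \<le> i" for i
    proof -
      have "expectation (\<lambda>\<omega>. (\<alpha> i * (h N (c i \<omega>) - \<mu>h))\<^sup>2) \<le> expectation (\<lambda>\<omega>. (\<alpha> i)\<^sup>2 * (2 * real N)\<^sup>2)"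
        using sq_int[OF that] sq_bound by (intro integral_mono) auto
      then show ?thesis by (simp add: prob_space power_mult_distrib mult_ac)
    qed
    have zero: "expectation (\<lambda>\<omega>. \<alpha> i * (h N (c i \<omega>) - \<mu>h)) = 0" if "1 \<le> i" for i
      using expectation_ident[OF h that, of N] int_h[OF that, of N] by (simp add: \<mu>h_def prob_space)
    have meas: "(\<lambda>x. \<alpha> i * (h N x - \<mu>h)) \<in> borel_measurable borel" for i by measurable
    note sums = expectation_sum_sq[of "\<lambda>i x. \<alpha> i * (h N x - \<mu>h)", OF meas sq_int zero]
    have eq: "(H m \<omega>)\<^sup>2 = (1 / (real m)\<^sup>2) * (\<Sum>i=1..m. \<alpha> i * (h N (c i \<omega>) - \<mu>h))\<^sup>2" for \<omega>
      by (simp add: H_def avg_def power_divide)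
    show "integrable M (\<lambda>\<omega>. (H m \<omega>)\<^sup>2)" unfolding eq using sums(1)[of m] by (intro integrable_mult_right) auto
    have "expectation (\<lambda>\<omega>. (H m \<omega>)\<^sup>2) = (1 / (real m)\<^sup>2) * (\<Sum>i=1..m. expectation (\<lambda>\<omega>. (\<alpha> i * (h N (c i \<omega>) - \<mu>h))\<^sup>2))"
      unfolding eq using sums(2)[of m] by simp
    also have "\<dots> \<le> (1 / (real m)\<^sup>2) * (\<Sum>i=1..m. 4 * (real N)\<^sup>2 * (\<alpha> i)\<^sup>2)"
      using sq_le by (intro mult_left_mono sum_mono) auto
    also have "\<dots> = 4 * (real N)\<^sup>2 * (avg m (\<lambda>i. (\<alpha> i)\<^sup>2) / m)"
      by (simp add: avg_def sum_distrib_left[symmetric] power2_eq_square)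
    finally show "expectation (\<lambda>\<omega>. (H m \<omega>)\<^sup>2) \<le> 4 * (real N)\<^sup>2 * (avg m (\<lambda>i. (\<alpha> i)\<^sup>2) / m)" .
  qed
  have "(\<lambda>m. 4 * (real N)\<^sup>2 * (avg m (\<lambda>i. (\<alpha> i)\<^sup>2) / m)) \<longlonglongrightarrow> 4 * (real N)\<^sup>2 * 0"
    by (intro tendsto_intros \<alpha>2)
  then have "eventually (\<lambda>m. 4 * (real N)\<^sup>2 * (avg m (\<lambda>i. (\<alpha> i)\<^sup>2) / m) < \<epsilon>\<^sup>2) sequentially"
    using \<epsilon> by (intro order_tendstoD(2)) auto
  then obtain m0 where m0: "\<And>m. m0 \<le> m \<Longrightarrow> 4 * (real N)\<^sup>2 * (avg m (\<lambda>i. (\<alpha> i)\<^sup>2) / m) < \<epsilon>\<^sup>2"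
    by (auto simp: eventually_sequentially)
  have "norm ((\<integral>\<omega>. \<bar>avg m (\<lambda>i. \<alpha> i * (g (c i \<omega>) - \<mu>g))\<bar> \<partial>M) - 0) < r" if "m0 \<le> m" for m
  proof -
    define T where "T \<omega> = avg m (\<lambda>i. \<bar>\<alpha> i\<bar> * (\<bar>g (c i \<omega>) - h N (c i \<omega>)\<bar> + \<eta>))" for \<omega>
    have int_T: "integrable M T" unfolding T_def
      using int_g int_h by (intro integrable_avg integrable_mult_right Bochner_Integration.integrable_add) auto
    have "expectation T = avg m (\<lambda>i. \<bar>\<alpha> i\<bar> * (2 * \<eta>))"
    proof -
      have "expectation T = avg m (\<lambda>i. expectation (\<lambda>\<omega>. \<bar>\<alpha> i\<bar> * (\<bar>g (c i \<omega>) - h N (c i \<omega>)\<bar> + \<eta>)))"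
        unfolding T_def using int_g int_h
        by (intro expectation_avg integrable_mult_right Bochner_Integration.integrable_add) auto
      also have "\<dots> = avg m (\<lambda>i. \<bar>\<alpha> i\<bar> * (2 * \<eta>))"
      proof (rule avg_cong)
        fix i :: nat assume i: "1 \<le> i"
        have "expectation (\<lambda>\<omega>. \<bar>g (c i \<omega>) - h N (c i \<omega>)\<bar>) = \<eta>"
          unfolding \<eta>_def using i by (intro expectation_ident) auto
        then show "expectation (\<lambda>\<omega>. \<bar>\<alpha> i\<bar> * (\<bar>g (c i \<omega>) - h N (c i \<omega>)\<bar> + \<eta>)) = \<bar>\<alpha> i\<bar> * (2 * \<eta>)"
          using int_g[OF i] int_h[OF i, of N] by (simp add: prob_space)
      qed
      finally show ?thesis .
    qed
    also have "\<dots> = 2 * \<eta> * avg m (\<lambda>i. \<bar>\<alpha> i\<bar>)"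
      using avg_mult_left[of m "2 * \<eta>" "\<lambda>i. \<bar>\<alpha> i\<bar>"] by (simp add: mult_ac)
    also have "\<dots> \<le> 2 * \<eta> * A" using \<mu>gh \<alpha>1[of m] by (intro mult_left_mono) auto
    also have "\<dots> \<le> r / 3"
    proof -
      have "\<eta> * (A + 1) \<le> r / 6" using N A by (simp add: \<eta>_def field_simps)
      moreover have "0 \<le> \<eta>" using \<mu>gh by simp
      ultimately show ?thesis by (simp add: algebra_simps)
    qed
    finally have ET: "expectation T \<le> r / 3" .
    have "(\<integral>\<omega>. \<bar>avg m (\<lambda>i. \<alpha> i * (g (c i \<omega>) - \<mu>g))\<bar> \<partial>M) \<le> expectation (\<lambda>\<omega>. T \<omega> + (\<epsilon> + (H m \<omega>)\<^sup>2 / \<epsilon>))"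
    proof (rule integral_mono)
      show "integrable M (\<lambda>\<omega>. \<bar>avg m (\<lambda>i. \<alpha> i * (g (c i \<omega>) - \<mu>g))\<bar>)"
        using int_g by (intro integrable_abs integrable_avg integrable_mult_right Bochner_Integration.integrable_diff) auto
      show "integrable M (\<lambda>\<omega>. T \<omega> + (\<epsilon> + (H m \<omega>)\<^sup>2 / \<epsilon>))" using int_T H_sq(1) by auto
      fix \<omega>
      have "avg m (\<lambda>i. \<alpha> i * (g (c i \<omega>) - \<mu>g)) =
          avg m (\<lambda>i. \<alpha> i * ((g (c i \<omega>) - h N (c i \<omega>)) - (\<mu>g - \<mu>h))) + H m \<omega>"
        unfolding H_def avg_add[symmetric] by (rule arg_cong[where f="avg m"]) (auto simp: algebra_simps)
      moreover have "\<bar>avg m (\<lambda>i. \<alpha> i * ((g (c i \<omega>) - h N (c i \<omega>)) - (\<mu>g - \<mu>h)))\<bar> \<le> T \<omega>"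
      proof -
        have "\<bar>avg m (\<lambda>i. \<alpha> i * ((g (c i \<omega>) - h N (c i \<omega>)) - (\<mu>g - \<mu>h)))\<bar>
            \<le> avg m (\<lambda>i. \<bar>\<alpha> i * ((g (c i \<omega>) - h N (c i \<omega>)) - (\<mu>g - \<mu>h))\<bar>)"
          using norm_avg_le[of m "\<lambda>i. \<alpha> i * ((g (c i \<omega>) - h N (c i \<omega>)) - (\<mu>g - \<mu>h))"] by simp
        also have "\<dots> \<le> T \<omega>"
          unfolding T_def abs_mult using \<mu>gh by (intro avg_mono mult_left_mono) linarith+
        finally show ?thesis .
      qed
      \<comment> \<open>This bounds the first absolute moment by the second moment.\<close>
      moreover have "\<bar>H m \<omega>\<bar> \<le> \<epsilon> + (H m \<omega>)\<^sup>2 / \<epsilon>"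
      proof (cases "\<bar>H m \<omega>\<bar> \<le> \<epsilon>")
        case True
        moreover have "0 \<le> (H m \<omega>)\<^sup>2 / \<epsilon>" using \<epsilon> by simp
        ultimately show ?thesis by linarith
      next
        case False
        then have "\<epsilon> * \<bar>H m \<omega>\<bar> \<le> \<bar>H m \<omega>\<bar> * \<bar>H m \<omega>\<bar>" by (intro mult_right_mono) auto
        then have "\<bar>H m \<omega>\<bar> \<le> (H m \<omega>)\<^sup>2 / \<epsilon>" using \<epsilon> by (simp add: field_simps power2_eq_square)
        then show ?thesis using \<epsilon> by linarith
      qed
      ultimately show "\<bar>avg m (\<lambda>i. \<alpha> i * (g (c i \<omega>) - \<mu>g))\<bar> \<le> T \<omega> + (\<epsilon> + (H m \<omega>)\<^sup>2 / \<epsilon>)" by linarith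
    qed
    also have "\<dots> = expectation T + (\<epsilon> + expectation (\<lambda>\<omega>. (H m \<omega>)\<^sup>2) / \<epsilon>)"
      using int_T H_sq(1)[of m] by (simp add: prob_space)
    also have "\<dots> \<le> r / 3 + (\<epsilon> + \<epsilon>\<^sup>2 / \<epsilon>)"
      using ET H_sq(2)[of m] m0[OF that] \<epsilon> by (intro add_mono divide_right_mono) auto
    also have "\<dots> < r" using r by (simp add: \<epsilon>_def power2_eq_square)
    finally show ?thesis by (simp add: integral_nonneg)
  qed
  then show "\<exists>m0. \<forall>m\<ge>m0. norm ((\<integral>\<omega>. \<bar>avg m (\<lambda>i. \<alpha> i * (g (c i \<omega>) - (\<integral>\<omega>. g (c 1 \<omega>) \<partial>M)))\<bar> \<partial>M) - 0) < r"
    unfolding \<mu>g_def by blast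
qed

end

section \<open>A central limit theorem for weighted iid terms\<close>

lemma abs_exp_taylor1:
  fixes x :: real assumes "0 \<le> x" shows "\<bar>(1 - x) - exp (- x)\<bar> \<le> x\<^sup>2"
proof -
  have 1: "1 - x \<le> exp (- x)" using exp_ge_add_one_self[of "- x"] by simp
  have "1 / exp x \<le> 1 / (1 + x)"
    using assms exp_ge_add_one_self[of x] by (intro divide_left_mono) auto
  also have "\<dots> \<le> 1 - x + x\<^sup>2"
    using assms by (simp add: field_simps power2_eq_square)
  finally have "exp (- x) \<le> 1 - x + x\<^sup>2" by (simp add: exp_minus inverse_eq_divide)
  then show ?thesis using 1 by linarith
qed

context iid_vectors begin

text \<open>The domination \<open>\<bar>f\<^sub>i\<bar> \<le> \<gamma>\<^sub>i G\<close> by multiples of one square integrable function, with \<open>\<gamma>\<^sub>i\<close> of smaller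
  order than \<open>\<surd>m\<close> uniformly in \<open>i \<le> m\<close>, implies the Lindeberg condition: the error of the second order
  expansion of the \<open>i\<close>th characteristic function is at most \<open>\<gamma>\<^sub>i\<^sup>2 / m\<close> times
  \<open>E min (6 G\<^sup>2) (\<epsilon>\<^sub>m G\<^sup>3)\<close>, which tends to zero by dominated convergence.\<close>
lemma weighted_clt:
  fixes f :: "nat \<Rightarrow> 'c \<Rightarrow> real" and G :: "'c \<Rightarrow> real" and \<gamma> :: "nat \<Rightarrow> real" and \<epsilon> :: "nat \<Rightarrow> real"
  assumes f [measurable]: "\<And>i. f i \<in> borel_measurable borel"
    and G [measurable]: "G \<in> borel_measurable borel" and G_nonneg: "\<And>x. 0 \<le> G x"
    and dom: "\<And>i x. \<bar>f i x\<bar> \<le> \<gamma> i * G x"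
    and G2: "integrable M (\<lambda>\<omega>. (G (c 1 \<omega>))\<^sup>2)"
    and zero: "\<And>i. 1 \<le> i \<Longrightarrow> expectation (\<lambda>\<omega>. f i (c i \<omega>)) = 0"
    and \<gamma>: "\<And>i. 0 \<le> \<gamma> i" "\<And>m. avg m (\<lambda>i. (\<gamma> i)\<^sup>2) \<le> A"
    and \<epsilon>: "\<epsilon> \<longlonglongrightarrow> 0" "\<And>m i. 1 \<le> i \<Longrightarrow> i \<le> m \<Longrightarrow> \<gamma> i \<le> \<epsilon> m * sqrt m"
    and var: "(\<lambda>m. avg m (\<lambda>i. expectation (\<lambda>\<omega>. (f i (c i \<omega>))\<^sup>2))) \<longlonglongrightarrow> v"
  shows "(\<lambda>m. CLINT \<omega>|M. iexp ((\<Sum>i=1..m. f i (c i \<omega>)) / sqrt m)) \<longlonglongrightarrow> complex_of_real (exp (- v / 2))"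
proof -
  note [measurable] = c_measurable
  define \<Gamma> where "\<Gamma> = expectation (\<lambda>\<omega>. (G (c 1 \<omega>))\<^sup>2)"
  define e where "e m = expectation (\<lambda>\<omega>. min (6 * (G (c 1 \<omega>))\<^sup>2) (\<bar>\<epsilon> m\<bar> * (G (c 1 \<omega>))^3))" for m
  have \<Gamma>: "0 \<le> \<Gamma>" by (simp add: \<Gamma>_def)
  have G2i: "integrable M (\<lambda>\<omega>. (G (c i \<omega>))\<^sup>2)" "expectation (\<lambda>\<omega>. (G (c i \<omega>))\<^sup>2) = \<Gamma>" if "1 \<le> i" for i
    using that G2 integrable_ident[of "\<lambda>x. (G x)\<^sup>2" i] expectation_ident[of "\<lambda>x. (G x)\<^sup>2" i]
    by (simp_all add: \<Gamma>_def)
  have e_lim: "e \<longlonglongrightarrow> 0"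
  proof -
    have "(\<lambda>m. e m) \<longlonglongrightarrow> expectation (\<lambda>\<omega>. 0)"
      unfolding e_def
    proof (rule integral_dominated_convergence)
      show "integrable M (\<lambda>\<omega>. 6 * (G (c 1 \<omega>))\<^sup>2)" using G2 by simp
      show "AE \<omega> in M. (\<lambda>m. min (6 * (G (c 1 \<omega>))\<^sup>2) (\<bar>\<epsilon> m\<bar> * (G (c 1 \<omega>))^3)) \<longlonglongrightarrow> 0"
      proof (rule AE_I2)
        fix \<omega>
        have "(\<lambda>m. min (6 * (G (c 1 \<omega>))\<^sup>2) (\<bar>\<epsilon> m\<bar> * (G (c 1 \<omega>))^3)) \<longlonglongrightarrow>
            min (6 * (G (c 1 \<omega>))\<^sup>2) (\<bar>0\<bar> * (G (c 1 \<omega>))^3)"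
          by (intro tendsto_intros \<epsilon>)
        then show "(\<lambda>m. min (6 * (G (c 1 \<omega>))\<^sup>2) (\<bar>\<epsilon> m\<bar> * (G (c 1 \<omega>))^3)) \<longlonglongrightarrow> 0" by simp
      qed
      show "AE \<omega> in M. norm (min (6 * (G (c 1 \<omega>))\<^sup>2) (\<bar>\<epsilon> m\<bar> * (G (c 1 \<omega>))^3)) \<le> 6 * (G (c 1 \<omega>))\<^sup>2" for m
        using G_nonneg by (intro AE_I2) (simp add: min_def)
    qed measurable
    then show ?thesis by simp
  qed
  have int_min: "integrable M (\<lambda>\<omega>. min (6 * (G (c 1 \<omega>))\<^sup>2) (\<bar>\<epsilon> m\<bar> * (G (c 1 \<omega>))^3))" for m
    by (rule Bochner_Integration.integrable_bound[of _ "\<lambda>\<omega>. 6 * (G (c 1 \<omega>))\<^sup>2"])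
      (use G2 G_nonneg in \<open>auto simp: min_def\<close>)
  have f2: "integrable M (\<lambda>\<omega>. (f i (c i \<omega>))\<^sup>2)" "expectation (\<lambda>\<omega>. (f i (c i \<omega>))\<^sup>2) \<le> (\<gamma> i)\<^sup>2 * \<Gamma>" if i: "1 \<le> i" for i
  proof -
    have le: "(f i x)\<^sup>2 \<le> (\<gamma> i)\<^sup>2 * (G x)\<^sup>2" for x
      using power_mono[OF dom[of i x], of 2] by (simp add: power_mult_distrib)
    show *: "integrable M (\<lambda>\<omega>. (f i (c i \<omega>))\<^sup>2)"
      by (rule Bochner_Integration.integrable_bound[of _ "\<lambda>\<omega>. (\<gamma> i)\<^sup>2 * (G (c i \<omega>))\<^sup>2"])
        (use i G2i(1)[OF i] le in auto)
    have "expectation (\<lambda>\<omega>. (f i (c i \<omega>))\<^sup>2) \<le> expectation (\<lambda>\<omega>. (\<gamma> i)\<^sup>2 * (G (c i \<omega>))\<^sup>2)"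
      by (intro integral_mono * le integrable_mult_right G2i(1)[OF i])
    then show "expectation (\<lambda>\<omega>. (f i (c i \<omega>))\<^sup>2) \<le> (\<gamma> i)\<^sup>2 * \<Gamma>" using G2i(2)[OF i] by simp
  qed
  define x where "x m i = expectation (\<lambda>\<omega>. (f i (c i \<omega>))\<^sup>2) / (2 * m)" for m :: nat and i
  define \<phi> where "\<phi> m i = char (distr M borel (\<lambda>\<omega>. f i (c i \<omega>) / sqrt m)) 1" for m :: nat and i
  have x_nonneg: "0 \<le> x m i" for m i by (simp add: x_def)
  have char: "(CLINT \<omega>|M. iexp ((\<Sum>i=1..m. f i (c i \<omega>)) / sqrt m)) = (\<Prod>i=1..m. \<phi> m i)" for m
  proof -
    have "indep_vars (\<lambda>_. borel) (\<lambda>i \<omega>. f i (c i \<omega>) / sqrt m) {1..m}"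
      by (intro indep_vars_compose2[OF indep_vars_subset[OF indep]]) auto
    from char_distr_sum[OF this, of 1]
    have "char (distr M borel (\<lambda>\<omega>. \<Sum>i=1..m. f i (c i \<omega>) / sqrt m)) 1 = (\<Prod>i=1..m. \<phi> m i)"
      by (simp add: \<phi>_def)
    moreover have "(\<lambda>\<omega>. \<Sum>i=1..m. f i (c i \<omega>) / sqrt m) \<in> borel_measurable M" by measurable
    ultimately show ?thesis by (simp add: char_def integral_distr sum_divide_distrib)
  qed
  have \<phi>_close: "norm (\<phi> m i - complex_of_real (exp (- x m i))) \<le> (\<gamma> i)\<^sup>2 / m * (e m / 6 + \<bar>\<epsilon> m\<bar>\<^sup>2 * \<Gamma>\<^sup>2)"
    if i: "1 \<le> i" "i \<le> m" for m i
  proof -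
    have m: "0 < real m" using i by simp
    let ?X = "\<lambda>\<omega>. f i (c i \<omega>) / sqrt m"
    have int1: "integrable M (\<lambda>\<omega>. f i (c i \<omega>))"
      by (rule square_integrable_imp_integrable[OF _ f2(1)]) (use i in measurable)
    have X2: "(?X \<omega>)\<^sup>2 = (f i (c i \<omega>))\<^sup>2 / m" for \<omega> using m by (simp add: power_divide)
    have "cmod (\<phi> m i - (1 - 1\<^sup>2 * (2 * x m i) / 2))
        \<le> (1\<^sup>2 / 6) * expectation (\<lambda>\<omega>. min (6 * (?X \<omega>)\<^sup>2) (\<bar>1\<bar> * \<bar>?X \<omega>\<bar>^3))"
      unfolding \<phi>_def
    proof (rule char_approx3'[where X="?X"])
      show EX: "expectation ?X = 0" using zero[OF i(1)] by simp
      show "variance ?X = 2 * x m i" unfolding EX diff_zero X2 x_def by simp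
      show "integrable M (\<lambda>\<omega>. (?X \<omega>)\<^sup>2)" unfolding X2 using f2(1)[OF i(1)] by simp
    qed (use i int1 in simp_all)
    also have "expectation (\<lambda>\<omega>. min (6 * (?X \<omega>)\<^sup>2) (\<bar>1\<bar> * \<bar>?X \<omega>\<bar>^3)) \<le>
        expectation (\<lambda>\<omega>. (\<gamma> i)\<^sup>2 / m * min (6 * (G (c i \<omega>))\<^sup>2) (\<bar>\<epsilon> m\<bar> * (G (c i \<omega>))^3))"
    proof (rule integral_mono)
      show "integrable M (\<lambda>\<omega>. (\<gamma> i)\<^sup>2 / m * min (6 * (G (c i \<omega>))\<^sup>2) (\<bar>\<epsilon> m\<bar> * (G (c i \<omega>))^3))"
        using integrable_ident[of "\<lambda>x. min (6 * (G x)\<^sup>2) (\<bar>\<epsilon> m\<bar> * (G x)^3)" i] int_min i(1)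
        by (intro integrable_mult_right) auto
      show "integrable M (\<lambda>\<omega>. min (6 * (?X \<omega>)\<^sup>2) (\<bar>1\<bar> * \<bar>?X \<omega>\<bar>^3))"
        by (rule Bochner_Integration.integrable_bound[of _ "\<lambda>\<omega>. 6 * ((f i (c i \<omega>))\<^sup>2 / m)"])
          (use f2(1)[OF i(1)] i in \<open>auto simp: X2 min_def\<close>)
      fix \<omega>
      have le: "\<bar>?X \<omega>\<bar> \<le> \<gamma> i * G (c i \<omega>) / sqrt m"
        using dom[of i "c i \<omega>"] m by (simp add: divide_right_mono)
      have "(?X \<omega>)\<^sup>2 \<le> (\<gamma> i * G (c i \<omega>) / sqrt m)\<^sup>2" using power_mono[OF le abs_ge_zero, of 2] unfolding power2_abs .
      then have 1: "(?X \<omega>)\<^sup>2 \<le> (\<gamma> i)\<^sup>2 / m * (G (c i \<omega>))\<^sup>2" using m by (simp add: power_divide power_mult_distrib)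
      have "\<bar>?X \<omega>\<bar>^3 \<le> (\<gamma> i * G (c i \<omega>) / sqrt m)^3" using le by (intro power_mono) auto
      also have "\<dots> = (\<gamma> i * G (c i \<omega>) / sqrt m)\<^sup>2 * (\<gamma> i / sqrt m * G (c i \<omega>))"
        by (simp add: power3_eq_cube power2_eq_square)
      also have "\<dots> = (\<gamma> i)\<^sup>2 / m * (G (c i \<omega>))\<^sup>2 * (\<gamma> i / sqrt m * G (c i \<omega>))"
        using m by (simp add: power_divide power_mult_distrib)
      also have "\<dots> \<le> (\<gamma> i)\<^sup>2 / m * (G (c i \<omega>))\<^sup>2 * (\<bar>\<epsilon> m\<bar> * G (c i \<omega>))"
      proof (intro mult_left_mono mult_right_mono G_nonneg)
        have "\<gamma> i / sqrt m \<le> \<epsilon> m" using \<epsilon>(2)[OF i] m by (simp add: divide_le_eq)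
        then show "\<gamma> i / sqrt m \<le> \<bar>\<epsilon> m\<bar>" by simp
      qed auto
      also have "\<dots> = (\<gamma> i)\<^sup>2 / m * (\<bar>\<epsilon> m\<bar> * (G (c i \<omega>))^3)"
        by (simp add: power3_eq_cube power2_eq_square)
      finally have 2: "\<bar>?X \<omega>\<bar>^3 \<le> (\<gamma> i)\<^sup>2 / m * (\<bar>\<epsilon> m\<bar> * (G (c i \<omega>))^3)" .
      have min_le: "min x y \<le> c * min p q" if "x \<le> c * p" "y \<le> c * q" for x y c p q :: real
        using that by (cases "p \<le> q") (auto simp: min_def)
      show "min (6 * (?X \<omega>)\<^sup>2) (\<bar>1\<bar> * \<bar>?X \<omega>\<bar>^3)
          \<le> (\<gamma> i)\<^sup>2 / m * min (6 * (G (c i \<omega>))\<^sup>2) (\<bar>\<epsilon> m\<bar> * (G (c i \<omega>))^3)"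
      proof (rule min_le)
        have "6 * (?X \<omega>)\<^sup>2 \<le> 6 * ((\<gamma> i)\<^sup>2 / m * (G (c i \<omega>))\<^sup>2)" using 1 by linarith
        then show "6 * (?X \<omega>)\<^sup>2 \<le> (\<gamma> i)\<^sup>2 / m * (6 * (G (c i \<omega>))\<^sup>2)" by (simp only: mult_ac)
        show "\<bar>1\<bar> * \<bar>?X \<omega>\<bar>^3 \<le> (\<gamma> i)\<^sup>2 / m * (\<bar>\<epsilon> m\<bar> * (G (c i \<omega>))^3)"
          using 2 by simp
      qed
    qed
    also have "expectation (\<lambda>\<omega>. (\<gamma> i)\<^sup>2 / m * min (6 * (G (c i \<omega>))\<^sup>2) (\<bar>\<epsilon> m\<bar> * (G (c i \<omega>))^3)) = (\<gamma> i)\<^sup>2 / m * e m"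
      using expectation_ident[of "\<lambda>x. min (6 * (G x)\<^sup>2) (\<bar>\<epsilon> m\<bar> * (G x)^3)" i] i(1) by (simp add: e_def)
    finally have 1: "norm (\<phi> m i - complex_of_real (1 - x m i)) \<le> (\<gamma> i)\<^sup>2 / m * (e m / 6)"
      by simp
    have xa: "x m i \<le> (\<gamma> i)\<^sup>2 / m * \<Gamma>"
      using f2(2)[OF i(1)] m mult_nonneg_nonneg[OF zero_le_power2[of "\<gamma> i"] \<Gamma>]
      by (simp add: x_def field_simps)
    have "(\<gamma> i)\<^sup>2 / m \<le> \<bar>\<epsilon> m\<bar>\<^sup>2"
    proof -
      have "(\<gamma> i)\<^sup>2 \<le> (\<epsilon> m * sqrt m)\<^sup>2" using \<epsilon>(2)[OF i] \<gamma>(1) by (intro power_mono) auto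
      then show ?thesis using m by (simp add: power_mult_distrib divide_le_eq)
    qed
    from order_trans[OF xa mult_right_mono[OF this \<Gamma>]]
    have xb: "x m i \<le> \<bar>\<epsilon> m\<bar>\<^sup>2 * \<Gamma>" .
    have "0 \<le> (\<gamma> i)\<^sup>2 / m * \<Gamma>" using \<Gamma> by simp
    then have "(x m i)\<^sup>2 \<le> ((\<gamma> i)\<^sup>2 / m * \<Gamma>) * (\<bar>\<epsilon> m\<bar>\<^sup>2 * \<Gamma>)"
      unfolding power2_eq_square[of "x m i"] using mult_mono[OF xa xb _ x_nonneg[of m i]] by blast
    then have "\<bar>(1 - x m i) - exp (- x m i)\<bar> \<le> (\<gamma> i)\<^sup>2 / m * (\<bar>\<epsilon> m\<bar>\<^sup>2 * \<Gamma>\<^sup>2)"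
      using abs_exp_taylor1[OF x_nonneg[of m i]] by (simp add: power2_eq_square[of \<Gamma>] mult_ac)
    then have 2: "norm (complex_of_real (1 - x m i) - complex_of_real (exp (- x m i))) \<le> (\<gamma> i)\<^sup>2 / m * (\<bar>\<epsilon> m\<bar>\<^sup>2 * \<Gamma>\<^sup>2)"
      unfolding of_real_diff[symmetric] norm_of_real .
    show ?thesis
      using norm_triangle_ineq[of "\<phi> m i - complex_of_real (1 - x m i)" "complex_of_real (1 - x m i) - complex_of_real (exp (- x m i))"] 1 2
      by (simp add: distrib_left)
  qed
  have "(\<lambda>m. (\<Prod>i=1..m. \<phi> m i) - (\<Prod>i=1..m. complex_of_real (exp (- x m i)))) \<longlonglongrightarrow> 0"
  proof (rule Lim_null_comparison)
    show "eventually (\<lambda>m. norm ((\<Prod>i=1..m. \<phi> m i) - (\<Prod>i=1..m. complex_of_real (exp (- x m i))))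
        \<le> A * (\<bar>e m\<bar> / 6 + \<bar>\<epsilon> m\<bar>\<^sup>2 * \<Gamma>\<^sup>2)) sequentially"
    proof (rule always_eventually, rule allI)
      fix m
      have "norm ((\<Prod>i=1..m. \<phi> m i) - (\<Prod>i=1..m. complex_of_real (exp (- x m i))))
          \<le> (\<Sum>i=1..m. norm (\<phi> m i - complex_of_real (exp (- x m i))))"
      proof (rule norm_prod_diff)
        fix i assume i: "i \<in> {1..m}"
        have i1: "1 \<le> i" using i by simp
        interpret r: real_distribution "distr M borel (\<lambda>\<omega>. f i (c i \<omega>) / sqrt m)"
          by (rule real_distribution_distr) (use i1 in measurable)
        show "norm (\<phi> m i) \<le> 1" unfolding \<phi>_def by (rule r.cmod_char_le_1)
        show "norm (complex_of_real (exp (- x m i))) \<le> 1" using x_nonneg[of m i] by simp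
      qed
      also have "\<dots> \<le> (\<Sum>i=1..m. (\<gamma> i)\<^sup>2 / m * (e m / 6 + \<bar>\<epsilon> m\<bar>\<^sup>2 * \<Gamma>\<^sup>2))"
        by (intro sum_mono \<phi>_close) auto
      also have "\<dots> = avg m (\<lambda>i. (\<gamma> i)\<^sup>2) * (e m / 6 + \<bar>\<epsilon> m\<bar>\<^sup>2 * \<Gamma>\<^sup>2)"
        by (simp add: avg_def sum_distrib_right sum_divide_distrib)
      also have "\<dots> \<le> A * (\<bar>e m\<bar> / 6 + \<bar>\<epsilon> m\<bar>\<^sup>2 * \<Gamma>\<^sup>2)"
      proof -
        have "avg m (\<lambda>i. (\<gamma> i)\<^sup>2) * (e m / 6 + \<bar>\<epsilon> m\<bar>\<^sup>2 * \<Gamma>\<^sup>2) \<le> avg m (\<lambda>i. (\<gamma> i)\<^sup>2) * (\<bar>e m\<bar> / 6 + \<bar>\<epsilon> m\<bar>\<^sup>2 * \<Gamma>\<^sup>2)"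
          by (intro mult_left_mono add_right_mono divide_right_mono avg_nonneg) auto
        also have "\<dots> \<le> A * (\<bar>e m\<bar> / 6 + \<bar>\<epsilon> m\<bar>\<^sup>2 * \<Gamma>\<^sup>2)" by (intro mult_right_mono \<gamma>) auto
        finally show ?thesis .
      qed
      finally show "norm ((\<Prod>i=1..m. \<phi> m i) - (\<Prod>i=1..m. complex_of_real (exp (- x m i))))
        \<le> A * (\<bar>e m\<bar> / 6 + \<bar>\<epsilon> m\<bar>\<^sup>2 * \<Gamma>\<^sup>2)" .
    qed
    have "(\<lambda>m. A * (\<bar>e m\<bar> / 6 + \<bar>\<epsilon> m\<bar>\<^sup>2 * \<Gamma>\<^sup>2)) \<longlonglongrightarrow> A * (\<bar>0\<bar> / 6 + \<bar>0\<bar>\<^sup>2 * \<Gamma>\<^sup>2)"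
      by (intro tendsto_intros e_lim \<epsilon>) auto
    then show "(\<lambda>m. A * (\<bar>e m\<bar> / 6 + \<bar>\<epsilon> m\<bar>\<^sup>2 * \<Gamma>\<^sup>2)) \<longlonglongrightarrow> 0" by simp
  qed
  moreover have "(\<lambda>m. \<Prod>i=1..m. complex_of_real (exp (- x m i))) \<longlonglongrightarrow> complex_of_real (exp (- v / 2))"
  proof -
    have "(\<Prod>i=1..m. complex_of_real (exp (- x m i))) =
        complex_of_real (exp (- avg m (\<lambda>i. expectation (\<lambda>\<omega>. (f i (c i \<omega>))\<^sup>2)) / 2))" for m
    proof -
      have "(\<Prod>i=1..m. exp (- x m i)) = exp (\<Sum>i=1..m. - x m i)" by (simp add: exp_sum)
      also have "(\<Sum>i=1..m. - x m i) = - avg m (\<lambda>i. expectation (\<lambda>\<omega>. (f i (c i \<omega>))\<^sup>2)) / 2"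
        by (simp add: x_def avg_def sum_negf sum_divide_distrib[symmetric])
      finally show ?thesis by (simp only: of_real_prod[symmetric])
    qed
    then show ?thesis by (simp only:) (intro tendsto_intros var; simp)
  qed
  ultimately show ?thesis
    unfolding char by (rule Lim_transform[rotated])
qed

end

section \<open>Convergence to the chi-squared law\<close>

abbreviation std_normal_product :: "nat \<Rightarrow> (nat \<Rightarrow> real) measure" where
  "std_normal_product k \<equiv> Pi\<^sub>M {..<k} (\<lambda>_. std_normal_distribution)"

lemma borel_measurable_vec:
  fixes f :: "'a \<Rightarrow> 'b::euclidean_space^'k"
  assumes "\<And>j. (\<lambda>x. f x $ j) \<in> borel_measurable M"
  shows "f \<in> borel_measurable M"
proof -
  have "(\<lambda>x. f x \<bullet> axis j u) \<in> borel_measurable M" for j u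
    unfolding inner_axis by (intro borel_measurable_inner assms borel_measurable_const)
  then show ?thesis
    by (subst borel_measurable_euclidean_space) (auto simp: Basis_vec_def)
qed

lemma prob_space_std_normal_product: "prob_space (std_normal_product k)"
  by (intro prob_space_PiM prob_space_normal_density) auto

lemma char_std_normal_product:
  "(CLINT x|std_normal_product k. iexp (\<Sum>i<k. x i * y i)) = complex_of_real (exp (- (\<Sum>i<k. (y i)\<^sup>2) / 2))"
proof -
  interpret product_sigma_finite "\<lambda>_::nat. std_normal_distribution"
    by (intro product_sigma_finite.intro prob_space_imp_sigma_finite prob_space_normal_density) auto
  interpret n: prob_space std_normal_distribution by (rule prob_space_normal_density) auto
  have "(CLINT x|std_normal_product k. iexp (\<Sum>i<k. x i * y i)) =
      (CLINT x|std_normal_product k. (\<Prod>i<k. iexp (x i * y i)))"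
    by (simp add: sum_distrib_left exp_sum)
  also have "\<dots> = (\<Prod>i<k. CLINT x|std_normal_distribution. iexp (x * y i))"
    by (rule product_integral_prod) (auto intro!: n.integrable_const_bound[of _ 1])
  also have "\<dots> = (\<Prod>i<k. char std_normal_distribution (y i))"
    by (simp add: char_def mult.commute)
  also have "\<dots> = complex_of_real (\<Prod>i<k. exp (- (y i)\<^sup>2 / 2))"
    by (simp add: char_std_normal_distribution)
  also have "(\<Prod>i<k. exp (- (y i)\<^sup>2 / 2)) = exp (\<Sum>i<k. - (y i)\<^sup>2 / 2)"
    by (simp add: exp_sum)
  also have "(\<Sum>i<k. - (y i)\<^sup>2 / 2) = - (\<Sum>i<k. (y i)\<^sup>2) / 2"
    by (simp add: sum_negf sum_divide_distrib[symmetric])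
  finally show ?thesis .
qed

lemma chi_squared_eq: "chi_squared k = distr (std_normal_product k) borel (\<lambda>x. \<Sum>i<k. (x i)\<^sup>2)"
  by (simp add: chi_squared_def)

lemma sum_sq_measurable: "(\<lambda>x. \<Sum>i<k. (x i)\<^sup>2) \<in> borel_measurable (std_normal_product k)"
  by measurable

lemma real_distribution_chi_squared: "real_distribution (chi_squared k)"
proof -
  interpret prob_space "std_normal_product k" by (rule prob_space_std_normal_product)
  show ?thesis unfolding chi_squared_eq by (intro real_distribution_distr sum_sq_measurable)
qed

text \<open>\<open>exp (- k \<parallel>y\<parallel>\<^sup>2)\<close> is the average of \<open>exp (i s \<xi> \<bullet> y)\<close> over a standard Gaussian vector \<open>\<xi>\<close>, with
  \<open>s\<^sup>2 = 2 k\<close>. By Fubini the Laplace transform of \<open>\<parallel>Y\<^sub>m\<parallel>\<^sup>2\<close> is the Gaussian average of the characteristic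
  function of \<open>Y\<^sub>m\<close>, and dominated convergence applies. The limit
  \<open>E exp (- k \<parallel>\<xi>\<parallel>\<^sup>2)\<close> is the Laplace transform of the chi-squared law by definition.\<close>
lemma (in prob_space) laplace_norm_sq_tendsto:
  fixes Y :: "nat \<Rightarrow> 'a \<Rightarrow> real^'d"
  assumes Y [measurable]: "\<And>m. Y m \<in> borel_measurable M"
    and char: "\<And>t. (\<lambda>m. CLINT \<omega>|M. iexp (t \<bullet> Y m \<omega>)) \<longlonglongrightarrow> complex_of_real (exp (- (norm t)\<^sup>2 / 2))"
  shows "(\<lambda>m. expectation (\<lambda>\<omega>. exp (- (real k * (norm (Y m \<omega>))\<^sup>2)))) \<longlonglongrightarrow>
    (\<integral>x. exp (- (real k * x)) \<partial>chi_squared CARD('d))"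
proof -
  let ?N = "std_normal_product CARD('d)"
  interpret N: prob_space ?N by (rule prob_space_std_normal_product)
  interpret P: pair_sigma_finite ?N M by standard
  interpret PP: pair_prob_space ?N M ..
  \<comment> \<open>The chi-squared law is defined on coordinates \<open>0, \<dots>, d - 1\<close>; the vectors are indexed by a type.\<close>
  obtain h where h: "bij_betw h {..<CARD('d)} (UNIV :: 'd set)"
    using ex_bij_betw_nat_finite[of "UNIV :: 'd set"] by (auto simp: atLeast0LessThan)
  define s where "s = sqrt (2 * real k)"
  define \<xi> :: "(nat \<Rightarrow> real) \<Rightarrow> real^'d" where "\<xi> x = (\<chi> j. x (inv_into {..<CARD('d)} h j))" for x
  have \<xi>h: "\<xi> x $ h i = x i" if "i < CARD('d)" for x i
    using h that by (simp add: \<xi>_def bij_betw_inv_into_left)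
  have sum_h: "(\<Sum>j\<in>UNIV. F j) = (\<Sum>i<CARD('d). F (h i))" for F :: "'d \<Rightarrow> real"
    by (rule sum.reindex_bij_betw[OF h, symmetric])
  have inner: "\<xi> x \<bullet> y = (\<Sum>i<CARD('d). x i * y $ h i)" for x y
    unfolding inner_vec_def sum_h by (intro sum.cong) (simp_all add: \<xi>h)
  have norm_\<xi>: "(norm (\<xi> x))\<^sup>2 = (\<Sum>i<CARD('d). (x i)\<^sup>2)" for x
    unfolding power2_norm_eq_inner inner by (intro sum.cong) (simp_all add: \<xi>h power2_eq_square)
  have norm_y: "(norm y)\<^sup>2 = (\<Sum>i<CARD('d). (y $ h i)\<^sup>2)" for y :: "real^'d"
    unfolding power2_norm_eq_inner inner_vec_def sum_h by (simp add: power2_eq_square)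
  have comp: "(\<lambda>x. x (inv_into {..<CARD('d)} h j)) \<in> borel_measurable ?N" for j
    by (rule measurable_component_singleton[where M="\<lambda>_. std_normal_distribution", simplified])
      (use h inv_into_into[of j h "{..<CARD('d)}"] in \<open>auto simp: bij_betw_def\<close>)
  have \<xi>_meas [measurable]: "\<xi> \<in> borel_measurable ?N"
    by (rule borel_measurable_vec) (simp add: \<xi>_def comp)
  have s2: "s\<^sup>2 = 2 * real k" by (simp add: s_def)
  have mix: "complex_of_real (exp (- (real k * (norm y)\<^sup>2))) = (CLINT x|?N. iexp ((s *\<^sub>R \<xi> x) \<bullet> y))" for y
  proof -
    have "(CLINT x|?N. iexp ((s *\<^sub>R \<xi> x) \<bullet> y)) = (CLINT x|?N. iexp (\<Sum>i<CARD('d). x i * (s * y $ h i)))"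
      by (simp add: inner sum_distrib_left mult_ac)
    also have "\<dots> = complex_of_real (exp (- (\<Sum>i<CARD('d). (s * y $ h i)\<^sup>2) / 2))"
      by (rule char_std_normal_product)
    also have "(\<Sum>i<CARD('d). (s * y $ h i)\<^sup>2) = s\<^sup>2 * (norm y)\<^sup>2"
      by (simp add: norm_y power_mult_distrib sum_distrib_left)
    finally show ?thesis by (simp add: s2)
  qed
  have swap: "complex_of_real (expectation (\<lambda>\<omega>. exp (- (real k * (norm (Y m \<omega>))\<^sup>2)))) =
      (CLINT x|?N. CLINT \<omega>|M. iexp ((s *\<^sub>R \<xi> x) \<bullet> Y m \<omega>))" for m
  proof -
    have "complex_of_real (expectation (\<lambda>\<omega>. exp (- (real k * (norm (Y m \<omega>))\<^sup>2)))) =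
        (CLINT \<omega>|M. CLINT x|?N. iexp ((s *\<^sub>R \<xi> x) \<bullet> Y m \<omega>))"
      unfolding mix[symmetric] by (rule integral_complex_of_real[symmetric])
    also have "\<dots> = (CLINT x|?N. CLINT \<omega>|M. iexp ((s *\<^sub>R \<xi> x) \<bullet> Y m \<omega>))"
    proof (rule P.Fubini_integral)
      show "integrable (?N \<Otimes>\<^sub>M M) (\<lambda>(x, \<omega>). iexp ((s *\<^sub>R \<xi> x) \<bullet> Y m \<omega>))"
        by (rule PP.integrable_const_bound[of _ 1]) (auto simp: split_beta')
    qed
    finally show ?thesis .
  qed
  have "(\<lambda>m. CLINT x|?N. CLINT \<omega>|M. iexp ((s *\<^sub>R \<xi> x) \<bullet> Y m \<omega>)) \<longlonglongrightarrow>
      (CLINT x|?N. complex_of_real (exp (- (norm (s *\<^sub>R \<xi> x))\<^sup>2 / 2)))"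
  proof (rule integral_dominated_convergence[where w="\<lambda>_. 1"])
    show "AE x in ?N. norm (CLINT \<omega>|M. iexp ((s *\<^sub>R \<xi> x) \<bullet> Y m \<omega>)) \<le> 1" for m
    proof (rule AE_I2)
      fix x
      have "norm (CLINT \<omega>|M. iexp ((s *\<^sub>R \<xi> x) \<bullet> Y m \<omega>)) \<le> expectation (\<lambda>\<omega>. norm (iexp ((s *\<^sub>R \<xi> x) \<bullet> Y m \<omega>)))"
        by (rule integral_norm_bound)
      then show "norm (CLINT \<omega>|M. iexp ((s *\<^sub>R \<xi> x) \<bullet> Y m \<omega>)) \<le> 1" by (simp add: prob_space)
    qed
    show "AE x in ?N. (\<lambda>m. CLINT \<omega>|M. iexp ((s *\<^sub>R \<xi> x) \<bullet> Y m \<omega>)) \<longlonglongrightarrow>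
        complex_of_real (exp (- (norm (s *\<^sub>R \<xi> x))\<^sup>2 / 2))"
      using char by (intro AE_I2)
  qed measurable
  also have "(CLINT x|?N. complex_of_real (exp (- (norm (s *\<^sub>R \<xi> x))\<^sup>2 / 2))) =
      complex_of_real (\<integral>x. exp (- (real k * (\<Sum>i<CARD('d). (x i)\<^sup>2))) \<partial>?N)"
    by (simp add: power_mult_distrib s2 norm_\<xi>)
  also have "(\<integral>x. exp (- (real k * (\<Sum>i<CARD('d). (x i)\<^sup>2))) \<partial>?N) = (\<integral>x. exp (- (real k * x)) \<partial>chi_squared CARD('d))"
    unfolding chi_squared_eq by (subst integral_distr[OF sum_sq_measurable]) auto
  finally show ?thesis unfolding swap[symmetric] by (simp add: tendsto_of_real_iff)
qed

text \<open>In the variable \<open>u = exp (- x)\<close> a continuous step function on the half-line becomes a continuous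
  function on \<open>[0, 1]\<close> that vanishes near \<open>0\<close>; the Weierstrass theorem applies to it.\<close>
lemma cts_step_neg_ln_approx:
  assumes ab: "a < b" and e: "0 < e"
  obtains \<beta> :: "nat \<Rightarrow> real" and n where
    "\<And>x. 0 \<le> x \<Longrightarrow> \<bar>cts_step a b x - (\<Sum>i\<le>n. \<beta> i * exp (- (real i * x)))\<bar> < e"
proof -
  define g where "g u = (if u \<le> 0 then 0 else cts_step a b (- ln u))" for u :: real
  have "isCont g u" for u
  proof (cases "0 < u")
    case True
    have "isCont (cts_step a b) y" for y
      using cts_step_uniformly_continuous[OF ab] uniformly_continuous_imp_continuous
        continuous_on_eq_continuous_at open_UNIV by blast
    then have cont: "isCont (\<lambda>u. cts_step a b (- ln u)) u"
      using True by (intro isCont_o2[of _ "\<lambda>u. - ln u" "cts_step a b"] continuous_intros) auto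
    have ev: "eventually (\<lambda>u. g u = cts_step a b (- ln u)) (nhds u)"
      using eventually_nhds_in_open[of "{0<..}" u] True by (auto elim!: eventually_mono simp: g_def)
    show ?thesis unfolding isCont_cong[OF ev] by (rule cont)
  next
    case False
    have zero: "g v = 0" if "v < exp (- b)" for v
    proof (cases "0 < v")
      case True
      then have "ln v < - b" using that by (metis exp_gt_zero ln_exp ln_less_cancel_iff)
      then show ?thesis using ab by (simp add: g_def cts_step_def)
    qed (simp add: g_def)
    have "u < exp (- b)" using False exp_gt_zero[of "- b"] by linarith
    then have ev: "eventually (\<lambda>v. g v = 0) (nhds u)"
      using eventually_nhds_in_open[of "{..<exp (- b)}" u] zero by (auto elim!: eventually_mono)
    show ?thesis unfolding isCont_cong[OF ev] by (rule continuous_const)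
  qed
  then have "continuous_on {0..1} g" by (intro continuous_at_imp_continuous_on) auto
  then obtain p where p: "real_polynomial_function p" "\<And>u. u \<in> {0..1} \<Longrightarrow> \<bar>g u - p u\<bar> < e"
    using Stone_Weierstrass_real_polynomial_function[of "{0..1}" g e] e by auto
  obtain \<beta> n where \<beta>: "p = (\<lambda>x. \<Sum>i\<le>n. \<beta> i * x ^ i)" using p(1) real_polynomial_function_iff_sum by blast
  have "\<bar>cts_step a b x - (\<Sum>i\<le>n. \<beta> i * exp (- (real i * x)))\<bar> < e" if "0 \<le> x" for x
  proof -
    have "g (exp (- x)) = cts_step a b x" by (simp add: g_def)
    moreover have "exp (- x) ^ i = exp (- (real i * x))" for i
      by (simp add: exp_of_nat_mult[symmetric])
    ultimately show ?thesis using p(2)[of "exp (- x)"] that by (simp add: \<beta>)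
  qed
  then show thesis by (rule that)
qed

lemma cts_step_bounds: "a < b \<Longrightarrow> 0 \<le> cts_step a b x" "a < b \<Longrightarrow> cts_step a b x \<le> 1"
  by (auto simp: cts_step_def)

lemma cts_step_measurable [measurable]: "a < b \<Longrightarrow> cts_step a b \<in> borel_measurable borel"
  using cts_step_uniformly_continuous[of a b] uniformly_continuous_imp_continuous
    borel_measurable_continuous_onI by blast

lemma cts_step_lipschitz:
  assumes "a < b" shows "\<bar>cts_step a b x - cts_step a b y\<bar> \<le> \<bar>x - y\<bar> / (b - a)"
proof -
  have eq: "cts_step a b z = max 0 (min 1 ((b - z) / (b - a)))" for z
    using assms by (auto simp: cts_step_def max_def min_def field_simps)
  have "\<bar>max 0 (min 1 u) - max 0 (min 1 v)\<bar> \<le> \<bar>u - v\<bar>" for u v :: real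
    by (auto simp: max_def min_def)
  then have "\<bar>cts_step a b x - cts_step a b y\<bar> \<le> \<bar>(b - x) / (b - a) - (b - y) / (b - a)\<bar>"
    unfolding eq .
  also have "\<dots> = \<bar>x - y\<bar> / (b - a)"
    using assms by (simp add: diff_divide_distrib[symmetric] abs_minus_commute)
  finally show ?thesis .
qed

text \<open>The Laplace transforms at the natural numbers are the moments of \<open>exp (- U)\<close>, a random variable with
  values in \<open>[0, 1]\<close>; by \<open>cts_step_neg_ln_approx\<close> they control the integrals of step functions.\<close>
lemma (in prob_space) laplace_imp_cts_step:
  fixes U :: "nat \<Rightarrow> 'a \<Rightarrow> real"
  assumes U [measurable]: "\<And>m. U m \<in> borel_measurable M" and U_nonneg: "\<And>m \<omega>. 0 \<le> U m \<omega>"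
    and P: "real_distribution P" and P_nonneg: "AE x in P. 0 \<le> x"
    and lap: "\<And>k::nat. (\<lambda>m. expectation (\<lambda>\<omega>. exp (- (real k * U m \<omega>)))) \<longlonglongrightarrow> (\<integral>x. exp (- (real k * x)) \<partial>P)"
    and ab: "a < b"
  shows "(\<lambda>m. expectation (\<lambda>\<omega>. cts_step a b (U m \<omega>))) \<longlonglongrightarrow> (\<integral>x. cts_step a b x \<partial>P)"
proof (rule LIMSEQ_I)
  fix r :: real assume r: "0 < r"
  interpret P: real_distribution P by fact
  obtain \<beta> :: "nat \<Rightarrow> real" and n where \<beta>:
    "\<And>x. 0 \<le> x \<Longrightarrow> \<bar>cts_step a b x - (\<Sum>i\<le>n. \<beta> i * exp (- (real i * x)))\<bar> < r / 3"
    using cts_step_neg_ln_approx[OF ab, of "r / 3"] r by auto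
  let ?p = "\<lambda>x. \<Sum>i\<le>n. \<beta> i * exp (- (real i * x))"
  have int_exp: "integrable M (\<lambda>\<omega>. exp (- (real k * U m \<omega>)))" for k m
    by (rule integrable_const_bound[of _ 1]) (use U_nonneg in auto)
  have int_exp_P: "integrable P (\<lambda>x. exp (- (real k * x)))" for k
    by (rule P.integrable_const_bound[of _ 1]) (use P_nonneg in \<open>auto elim!: eventually_mono\<close>)
  have int_cts: "integrable M (\<lambda>\<omega>. cts_step a b (U m \<omega>))" for m
    by (rule integrable_const_bound[of _ 1]) (use cts_step_bounds[OF ab] cts_step_measurable[OF ab] in auto)
  have M_close: "\<bar>expectation (\<lambda>\<omega>. cts_step a b (U m \<omega>)) - (\<Sum>i\<le>n. \<beta> i * expectation (\<lambda>\<omega>. exp (- (real i * U m \<omega>))))\<bar> \<le> r / 3" for m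
  proof -
    have "expectation (\<lambda>\<omega>. cts_step a b (U m \<omega>)) - (\<Sum>i\<le>n. \<beta> i * expectation (\<lambda>\<omega>. exp (- (real i * U m \<omega>))))
        = expectation (\<lambda>\<omega>. cts_step a b (U m \<omega>) - ?p (U m \<omega>))"
      using int_exp int_cts by (simp add: Bochner_Integration.integral_sum)
    also have "\<bar>\<dots>\<bar> \<le> expectation (\<lambda>\<omega>. \<bar>cts_step a b (U m \<omega>) - ?p (U m \<omega>)\<bar>)" by (rule integral_abs_bound)
    also have "\<dots> \<le> expectation (\<lambda>\<omega>. r / 3)"
      using int_exp int_cts \<beta>[OF U_nonneg] by (intro integral_mono integrable_abs Bochner_Integration.integrable_diff) (auto intro: less_imp_le)
    finally show ?thesis by (simp add: prob_space)
  qed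
  have P_close: "\<bar>(\<integral>x. cts_step a b x \<partial>P) - (\<Sum>i\<le>n. \<beta> i * (\<integral>x. exp (- (real i * x)) \<partial>P))\<bar> \<le> r / 3"
  proof -
    have "(\<integral>x. cts_step a b x \<partial>P) - (\<Sum>i\<le>n. \<beta> i * (\<integral>x. exp (- (real i * x)) \<partial>P)) = (\<integral>x. cts_step a b x - ?p x \<partial>P)"
      using int_exp_P P.integrable_cts_step[OF ab] by (simp add: Bochner_Integration.integral_sum)
    also have "\<bar>\<dots>\<bar> \<le> (\<integral>x. \<bar>cts_step a b x - ?p x\<bar> \<partial>P)" by (rule integral_abs_bound)
    also have "\<dots> \<le> (\<integral>x. r / 3 \<partial>P)"
      using int_exp_P P.integrable_cts_step[OF ab] P_nonneg \<beta>
      by (intro integral_mono_AE integrable_abs Bochner_Integration.integrable_diff) (auto intro: less_imp_le elim!: eventually_mono)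
    finally show ?thesis using P.prob_space by simp
  qed
  have "(\<lambda>m. \<Sum>i\<le>n. \<beta> i * expectation (\<lambda>\<omega>. exp (- (real i * U m \<omega>)))) \<longlonglongrightarrow> (\<Sum>i\<le>n. \<beta> i * (\<integral>x. exp (- (real i * x)) \<partial>P))"
    by (intro tendsto_intros lap)
  from LIMSEQ_D[OF this, of "r / 3"] r obtain m0 where m0: "\<And>m. m0 \<le> m \<Longrightarrow>
    \<bar>(\<Sum>i\<le>n. \<beta> i * expectation (\<lambda>\<omega>. exp (- (real i * U m \<omega>)))) - (\<Sum>i\<le>n. \<beta> i * (\<integral>x. exp (- (real i * x)) \<partial>P))\<bar> < r / 3"
    by auto
  show "\<exists>m0. \<forall>m\<ge>m0. norm (expectation (\<lambda>\<omega>. cts_step a b (U m \<omega>)) - (\<integral>x. cts_step a b x \<partial>P)) < r"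
  proof (intro exI[of _ m0] allI impI)
    fix m assume "m0 \<le> m"
    then show "norm (expectation (\<lambda>\<omega>. cts_step a b (U m \<omega>)) - (\<integral>x. cts_step a b x \<partial>P)) < r"
      using m0[of m] M_close[of m] P_close unfolding real_norm_def by linarith
  qed
qed

text \<open>Slutsky's lemma, with the Lipschitz functions \<open>cts_step\<close> as test functions.\<close>
lemma (in prob_space) cts_step_slutsky:
  fixes T U :: "nat \<Rightarrow> 'a \<Rightarrow> real"
  assumes [measurable]: "\<And>m. T m \<in> borel_measurable M" "\<And>m. U m \<in> borel_measurable M"
    and close: "\<And>\<epsilon>. 0 < \<epsilon> \<Longrightarrow> (\<lambda>m. prob {\<omega>\<in>space M. \<epsilon> \<le> \<bar>T m \<omega> - U m \<omega>\<bar>}) \<longlonglongrightarrow> 0"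
    and lim: "(\<lambda>m. expectation (\<lambda>\<omega>. cts_step a b (U m \<omega>))) \<longlonglongrightarrow> l" and ab: "a < b"
  shows "(\<lambda>m. expectation (\<lambda>\<omega>. cts_step a b (T m \<omega>))) \<longlonglongrightarrow> l"
proof -
  note [measurable] = cts_step_measurable[OF ab]
  have int: "integrable M (\<lambda>\<omega>. cts_step a b (X \<omega>))" if "X \<in> borel_measurable M" for X
    by (rule integrable_const_bound[of _ 1]) (use that cts_step_bounds[OF ab] in auto)
  have "(\<lambda>m. expectation (\<lambda>\<omega>. cts_step a b (T m \<omega>)) - expectation (\<lambda>\<omega>. cts_step a b (U m \<omega>))) \<longlonglongrightarrow> 0"
  proof (rule LIMSEQ_I)
    fix r :: real assume r: "0 < r"
    define \<epsilon> where "\<epsilon> = r / 2 * (b - a)"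
    have \<epsilon>: "0 < \<epsilon>" using r ab by (simp add: \<epsilon>_def)
    have bound: "\<bar>expectation (\<lambda>\<omega>. cts_step a b (T m \<omega>)) - expectation (\<lambda>\<omega>. cts_step a b (U m \<omega>))\<bar>
        \<le> r / 2 + prob {\<omega>\<in>space M. \<epsilon> \<le> \<bar>T m \<omega> - U m \<omega>\<bar>}" for m
    proof -
      let ?A = "{\<omega>\<in>space M. \<epsilon> \<le> \<bar>T m \<omega> - U m \<omega>\<bar>}"
      have "expectation (\<lambda>\<omega>. cts_step a b (T m \<omega>)) - expectation (\<lambda>\<omega>. cts_step a b (U m \<omega>))
          = expectation (\<lambda>\<omega>. cts_step a b (T m \<omega>) - cts_step a b (U m \<omega>))"
        by (rule Bochner_Integration.integral_diff[symmetric]) (auto intro: int)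
      also have "\<bar>\<dots>\<bar> \<le> expectation (\<lambda>\<omega>. \<bar>cts_step a b (T m \<omega>) - cts_step a b (U m \<omega>)\<bar>)" by (rule integral_abs_bound)
      also have "\<dots> \<le> expectation (\<lambda>\<omega>. r / 2 + indicator ?A \<omega>)"
      proof (rule integral_mono)
        show "integrable M (\<lambda>\<omega>. \<bar>cts_step a b (T m \<omega>) - cts_step a b (U m \<omega>)\<bar>)"
          by (intro integrable_abs Bochner_Integration.integrable_diff int) auto
        show "integrable M (\<lambda>\<omega>. r / 2 + indicator ?A \<omega> :: real)"
          by (intro Bochner_Integration.integrable_add) (auto simp: emeasure_eq_measure)
        fix \<omega> assume \<omega>: "\<omega> \<in> space M"
        show "\<bar>cts_step a b (T m \<omega>) - cts_step a b (U m \<omega>)\<bar> \<le> r / 2 + indicator ?A \<omega>"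
        proof (cases "\<epsilon> \<le> \<bar>T m \<omega> - U m \<omega>\<bar>")
          case True
          then have "indicator ?A \<omega> = (1::real)" using \<omega> by simp
          then show ?thesis
            using cts_step_bounds[OF ab, of "T m \<omega>"] cts_step_bounds[OF ab, of "U m \<omega>"] r by linarith
        next
          case False
          have "\<bar>cts_step a b (T m \<omega>) - cts_step a b (U m \<omega>)\<bar> \<le> \<bar>T m \<omega> - U m \<omega>\<bar> / (b - a)"
            by (rule cts_step_lipschitz[OF ab])
          also have "\<dots> \<le> \<epsilon> / (b - a)" using False ab by (intro divide_right_mono) auto
          also have "\<dots> = r / 2" unfolding \<epsilon>_def using ab by (intro nonzero_mult_div_cancel_right) simp
          also have "\<dots> \<le> r / 2 + indicator ?A \<omega>" by simp
          finally show ?thesis .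
        qed
      qed
      also have "\<dots> = r / 2 + prob ?A"
        by (subst Bochner_Integration.integral_add) (auto simp: prob_space emeasure_eq_measure)
      finally show ?thesis .
    qed
    from LIMSEQ_D[OF close[OF \<epsilon>], of "r / 2"] r
    obtain m0 where m0: "\<And>m. m0 \<le> m \<Longrightarrow> prob {\<omega>\<in>space M. \<epsilon> \<le> \<bar>T m \<omega> - U m \<omega>\<bar>} < r / 2" by auto
    show "\<exists>m0. \<forall>m\<ge>m0. norm (expectation (\<lambda>\<omega>. cts_step a b (T m \<omega>)) - expectation (\<lambda>\<omega>. cts_step a b (U m \<omega>)) - 0) < r"
    proof (intro exI[of _ m0] allI impI)
      fix m assume "m0 \<le> m"
      then show "norm (expectation (\<lambda>\<omega>. cts_step a b (T m \<omega>)) - expectation (\<lambda>\<omega>. cts_step a b (U m \<omega>)) - 0) < r"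
        using m0[of m] bound[of m] by simp
    qed
  qed
  from tendsto_add[OF this lim] show ?thesis by simp
qed

lemma (in prob_space) weak_conv_chi_squaredI:
  fixes Y :: "nat \<Rightarrow> 'a \<Rightarrow> real^'d" and T :: "nat \<Rightarrow> 'a \<Rightarrow> real"
  assumes Y [measurable]: "\<And>m. Y m \<in> borel_measurable M" and T [measurable]: "\<And>m. T m \<in> borel_measurable M"
    and char: "\<And>t. (\<lambda>m. CLINT \<omega>|M. iexp (t \<bullet> Y m \<omega>)) \<longlonglongrightarrow> complex_of_real (exp (- (norm t)\<^sup>2 / 2))"
    and close: "\<And>\<epsilon>. 0 < \<epsilon> \<Longrightarrow> (\<lambda>m. prob {\<omega>\<in>space M. \<epsilon> \<le> \<bar>T m \<omega> - (norm (Y m \<omega>))\<^sup>2\<bar>}) \<longlonglongrightarrow> 0"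
  shows "weak_conv_m (\<lambda>m. distr M borel (T m)) (chi_squared CARD('d))"
proof (rule integral_cts_step_conv_imp_weak_conv)
  show "real_distribution (distr M borel (T m))" for m by (rule real_distribution_distr) simp
  show chi: "real_distribution (chi_squared CARD('d))" by (rule real_distribution_chi_squared)
  fix a b :: real assume ab: "a < b"
  have nonneg: "AE x in chi_squared CARD('d). 0 \<le> x"
    unfolding chi_squared_eq by (subst AE_distr_iff[OF sum_sq_measurable]) (auto intro!: AE_I2 sum_nonneg)
  have "(\<lambda>m. expectation (\<lambda>\<omega>. cts_step a b ((norm (Y m \<omega>))\<^sup>2))) \<longlonglongrightarrow> (\<integral>x. cts_step a b x \<partial>chi_squared CARD('d))"
    by (rule laplace_imp_cts_step[OF _ _ chi nonneg laplace_norm_sq_tendsto[OF Y char] ab]) auto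
  then have "(\<lambda>m. expectation (\<lambda>\<omega>. cts_step a b (T m \<omega>))) \<longlonglongrightarrow> (\<integral>x. cts_step a b x \<partial>chi_squared CARD('d))"
    by (intro cts_step_slutsky[OF T _ close _ ab]) auto
  then show "(\<lambda>m. integral\<^sup>L (distr M borel (T m)) (cts_step a b)) \<longlonglongrightarrow> integral\<^sup>L (chi_squared CARD('d)) (cts_step a b)"
    by (simp add: integral_distr cts_step_measurable[OF ab])
qed

section \<open>Measurability of the statistic\<close>

lemma borel_measurable_bilinear:
  fixes h :: "'x::{second_countable_topology,real_normed_vector} \<Rightarrow> 'y::{second_countable_topology,real_normed_vector} \<Rightarrow> 'z::real_normed_vector"
  assumes "bounded_bilinear h" "f \<in> borel_measurable M" "g \<in> borel_measurable M"
  shows "(\<lambda>x. h (f x) (g x)) \<in> borel_measurable M"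
  by (rule borel_measurable_continuous_Pair[OF assms(2,3)])
    (intro bounded_bilinear.continuous_on[OF assms(1)] continuous_intros)

lemma borel_measurable_linear:
  fixes h :: "'x::{real_normed_vector} \<Rightarrow> 'z::real_normed_vector"
  assumes "bounded_linear h" "f \<in> borel_measurable M"
  shows "(\<lambda>x. h (f x)) \<in> borel_measurable M"
  by (rule measurable_compose[OF assms(2) borel_measurable_continuous_onI])
    (rule linear_continuous_on[OF assms(1)])

lemmas [measurable (raw)] =
  borel_measurable_bilinear[OF bounded_bilinear_matrix_mult]
  borel_measurable_bilinear[OF bounded_bilinear_matrix_vector_mult]
  borel_measurable_bilinear[OF bounded_bilinear_outer]
  borel_measurable_linear[OF bounded_linear_transpose]
  borel_measurable_linear[OF bounded_linear_trace]
  measurable_compose[OF _ measurable_matrix_inv]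

lemma borel_measurable_avg:
  fixes f :: "nat \<Rightarrow> 'a \<Rightarrow> 'v::{second_countable_topology,real_normed_vector}"
  assumes "\<And>i. 1 \<le> i \<Longrightarrow> f i \<in> borel_measurable M"
  shows "(\<lambda>\<omega>. avg m (\<lambda>i. f i \<omega>)) \<in> borel_measurable M"
  unfolding avg_def using assms
  by (intro borel_measurable_scaleR borel_measurable_const borel_measurable_sum) auto

text \<open>Written with rational lower bounds on the quadratic form, positive definiteness is a countable union
  of closed conditions, hence Borel.\<close>
lemma pos_def_iff: "pos_def S \<longleftrightarrow> transpose S = S \<and> (\<exists>k::nat. \<forall>x. (norm x)\<^sup>2 / real (Suc k) \<le> x \<bullet> (S *v x))"
proof
  assume S: "pos_def S"
  obtain e where e: "0 < e" "\<And>x. e * (norm x)\<^sup>2 \<le> x \<bullet> (S *v x)" using pos_def_lower_bound[OF S] by blast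
  obtain k :: nat where k: "inverse (real (Suc k)) < e" using reals_Archimedean[OF e(1)] by blast
  have "(norm x)\<^sup>2 / real (Suc k) \<le> x \<bullet> (S *v x)" for x
  proof -
    have "(norm x)\<^sup>2 / real (Suc k) = inverse (real (Suc k)) * (norm x)\<^sup>2" by (simp add: divide_inverse)
    also have "\<dots> \<le> e * (norm x)\<^sup>2" using k by (intro mult_right_mono) auto
    also have "\<dots> \<le> x \<bullet> (S *v x)" by (rule e)
    finally show ?thesis .
  qed
  then show "transpose S = S \<and> (\<exists>k::nat. \<forall>x. (norm x)\<^sup>2 / real (Suc k) \<le> x \<bullet> (S *v x))"
    using pos_def_sym[OF S] by blast
next
  assume S: "transpose S = S \<and> (\<exists>k::nat. \<forall>x. (norm x)\<^sup>2 / real (Suc k) \<le> x \<bullet> (S *v x))"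
  then obtain k :: nat where k: "\<And>x. (norm x)\<^sup>2 / real (Suc k) \<le> x \<bullet> (S *v x)" by blast
  have "0 < x \<bullet> (S *v x)" if "x \<noteq> 0" for x
  proof -
    have "0 < (norm x)\<^sup>2 / real (Suc k)" using that by simp
    then show ?thesis using k[of x] by linarith
  qed
  then show "pos_def S" using S by (simp add: pos_def_def)
qed

lemma sets_pos_def: "{S::real^'k^'k. pos_def S} \<in> sets borel"
proof -
  have "closed {S::real^'k^'k. transpose S = S}"
    by (rule closed_Collect_eq[OF linear_continuous_on[OF bounded_linear_transpose] continuous_on_id])
  moreover have "closed {S::real^'k^'k. \<forall>x. (norm x)\<^sup>2 / real (Suc k) \<le> x \<bullet> (S *v x)}" for k
    by (intro closed_Collect_all closed_Collect_le continuous_on_inner continuous_on_const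
        linear_continuous_on bounded_bilinear.bounded_linear_left[OF bounded_bilinear_matrix_vector_mult])
  moreover have "{S::real^'k^'k. pos_def S} = {S. transpose S = S} \<inter>
      (\<Union>k. {S. \<forall>x. (norm x)\<^sup>2 / real (Suc k) \<le> x \<bullet> (S *v x)})"
    by (auto simp: pos_def_iff)
  ultimately show ?thesis by (auto intro!: sets.Int sets.countable_UN)
qed

lemma sets_invertible: "{A::real^'k^'k. invertible A} \<in> sets borel"
  unfolding invertible_det_nz
  by (intro borel_open open_Collect_neq continuous_intros continuous_on_det)

lemma borel_infty_Some: "open U \<Longrightarrow> Some ` U \<in> sets borel_infty"
  unfolding borel_infty_def by (intro in_measure_of) auto

lemma space_borel_infty: "space borel_infty = UNIV"
  by (simp add: borel_infty_def)

text \<open>\<open>{None}\<close> is measurable as the complement of the open set of all finite points.\<close>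
lemma measurable_the_default:
  "case_option d (\<lambda>x. x) \<in> measurable borel_infty (borel :: 'a::topological_space measure)"
proof (rule borel_measurableI)
  fix U :: "'a set" assume U: "open U"
  have "{None} = UNIV - Some ` (UNIV :: 'a set)" by (auto simp: image_def)
  then have None: "{None :: 'a option} \<in> sets borel_infty"
    using sets.compl_sets[OF borel_infty_Some[OF open_UNIV]] by (simp add: space_borel_infty)
  have "case_option d (\<lambda>x. x) -` U = Some ` U \<union> (if d \<in> U then {None} else {})"
    by (auto split: option.splits)
  then show "case_option d (\<lambda>x. x) -` U \<inter> space borel_infty \<in> sets borel_infty"
    using sets.Un[OF borel_infty_Some[OF U] None] borel_infty_Some[OF U] by (simp add: space_borel_infty)
qed

lemma statistics_measurable:
  fixes a :: "nat \<Rightarrow> 'w \<Rightarrow> real^'n" and b :: "nat \<Rightarrow> 'w \<Rightarrow> real^'d" and X :: "'w \<Rightarrow> real^'d^'n"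
  assumes a [measurable]: "\<And>i. 1 \<le> i \<Longrightarrow> a i \<in> borel_measurable M"
    and b [measurable]: "\<And>i. 1 \<le> i \<Longrightarrow> b i \<in> borel_measurable M"
    and X [measurable]: "X \<in> borel_measurable M"
  shows "(\<lambda>\<omega>. V_hat m (\<lambda>i. a i \<omega>) (\<lambda>i. b i \<omega>) (X \<omega>)) \<in> borel_measurable M"
    and "(\<lambda>\<omega>. Sigma_T_hat m (\<lambda>i. a i \<omega>) (\<lambda>i. b i \<omega>) (X \<omega>)) \<in> borel_measurable M"
    and "(\<lambda>\<omega>. T0_stat m (\<lambda>i. a i \<omega>) (\<lambda>i. b i \<omega>) (X \<omega>)) \<in> borel_measurable M"
proof -
  note [measurable] = borel_measurable_avg
  have [measurable]: "(\<lambda>\<omega>. sigma2_hat m (\<lambda>i. a i \<omega>) (\<lambda>i. b i \<omega>) (X \<omega>)) \<in> borel_measurable M"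
    unfolding sigma2_hat_def by measurable
  show V [measurable]: "(\<lambda>\<omega>. V_hat m (\<lambda>i. a i \<omega>) (\<lambda>i. b i \<omega>) (X \<omega>)) \<in> borel_measurable M"
    unfolding V_hat_def by measurable
  show "(\<lambda>\<omega>. T0_stat m (\<lambda>i. a i \<omega>) (\<lambda>i. b i \<omega>) (X \<omega>)) \<in> borel_measurable M"
    unfolding T0_stat_def by measurable
  show "(\<lambda>\<omega>. Sigma_T_hat m (\<lambda>i. a i \<omega>) (\<lambda>i. b i \<omega>) (X \<omega>)) \<in> borel_measurable M"
    unfolding Sigma_T_hat_def S_hat_def est_fun_def Let_def by measurable
qed

text \<open>Where the statistic is defined, \<open>\<parallel>\<Sigma>\<^sup>-\<^sup>1\<^sup>/\<^sup>2 T\<parallel>\<^sup>2 = T\<^sup>T \<Sigma>\<^sup>-\<^sup>1 T\<close>, so the measurability of the square root is not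
  an issue.\<close>
lemma T2_measurable:
  fixes a :: "nat \<Rightarrow> 'w \<Rightarrow> real^'n" and b :: "nat \<Rightarrow> 'w \<Rightarrow> real^'d" and Xh :: "'w \<Rightarrow> (real^'d^'n) option"
  assumes a: "\<And>i. 1 \<le> i \<Longrightarrow> a i \<in> borel_measurable M"
    and b: "\<And>i. 1 \<le> i \<Longrightarrow> b i \<in> borel_measurable M"
    and Xh: "Xh \<in> measurable M borel_infty" and Z: "Z \<in> borel_measurable M"
  shows "(\<lambda>\<omega>. if T2_defined m (\<lambda>i. a i \<omega>) (\<lambda>i. b i \<omega>) (Xh \<omega>)
    then T2_stat m (\<lambda>i. a i \<omega>) (\<lambda>i. b i \<omega>) (the (Xh \<omega>)) else Z \<omega>) \<in> borel_measurable M"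
proof -
  define X where "X \<omega> = (case Xh \<omega> of None \<Rightarrow> 0 | Some x \<Rightarrow> x)" for \<omega>
  have X: "X \<in> borel_measurable M"
    unfolding X_def by (rule measurable_compose[OF Xh measurable_the_default])
  note stat = statistics_measurable[OF a b X]
  define P where "P \<omega> \<longleftrightarrow> 1 \<le> m \<and> Xh \<omega> \<in> Some ` UNIV \<and> invertible (V_hat m (\<lambda>i. a i \<omega>) (\<lambda>i. b i \<omega>) (X \<omega>))
    \<and> pos_def (Sigma_T_hat m (\<lambda>i. a i \<omega>) (\<lambda>i. b i \<omega>) (X \<omega>))" for \<omega>
  have P: "T2_defined m (\<lambda>i. a i \<omega>) (\<lambda>i. b i \<omega>) (Xh \<omega>) \<longleftrightarrow> P \<omega>" for \<omega>
    by (auto simp: T2_defined_def P_def X_def)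
  have "{\<omega> \<in> space M. P \<omega>} \<in> sets M"
    unfolding P_def
    using measurable_sets_Collect[OF Xh, where P="\<lambda>x. x \<in> Some ` UNIV"] borel_infty_Some[OF open_UNIV]
      measurable_sets_Collect[OF stat(1), where P=invertible] sets_invertible
      measurable_sets_Collect[OF stat(2), where P=pos_def] sets_pos_def
    by (intro sets.sets_Collect_conj sets.sets_Collect_const) (simp_all add: space_borel_infty)
  then have pred: "Measurable.pred M P" by (simp add: pred_def)
  let ?Q = "\<lambda>\<omega>. real m * (T0_stat m (\<lambda>i. a i \<omega>) (\<lambda>i. b i \<omega>) (X \<omega>) \<bullet>
      (matrix_inv (Sigma_T_hat m (\<lambda>i. a i \<omega>) (\<lambda>i. b i \<omega>) (X \<omega>)) *v T0_stat m (\<lambda>i. a i \<omega>) (\<lambda>i. b i \<omega>) (X \<omega>)))"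
  note [measurable] = stat pred Z
  have "(\<lambda>\<omega>. if P \<omega> then ?Q \<omega> else Z \<omega>) \<in> borel_measurable M" by measurable
  also have "(\<lambda>\<omega>. if P \<omega> then ?Q \<omega> else Z \<omega>) = (\<lambda>\<omega>. if T2_defined m (\<lambda>i. a i \<omega>) (\<lambda>i. b i \<omega>) (Xh \<omega>)
    then T2_stat m (\<lambda>i. a i \<omega>) (\<lambda>i. b i \<omega>) (the (Xh \<omega>)) else Z \<omega>)"
  proof
    fix \<omega>
    have "the (Xh \<omega>) = X \<omega>" if "P \<omega>" using that by (auto simp: P_def X_def)
    moreover have "pos_def (Sigma_T_hat m (\<lambda>i. a i \<omega>) (\<lambda>i. b i \<omega>) (X \<omega>))" if "P \<omega>" using that by (simp add: P_def)
    ultimately show "(if P \<omega> then ?Q \<omega> else Z \<omega>) = (if T2_defined m (\<lambda>i. a i \<omega>) (\<lambda>i. b i \<omega>) (Xh \<omega>)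
      then T2_stat m (\<lambda>i. a i \<omega>) (\<lambda>i. b i \<omega>) (the (Xh \<omega>)) else Z \<omega>)"
      by (auto simp: P T2_stat_def norm_inv_sqrt_matrix_mult)
  qed
  finally show ?thesis .
qed

lemma est_measurable:
  fixes a :: "nat \<Rightarrow> 'w \<Rightarrow> real^'n" and b :: "nat \<Rightarrow> 'w \<Rightarrow> real^'d"
  assumes "tls_estimator m est"
    and "\<And>i. 1 \<le> i \<Longrightarrow> a i \<in> borel_measurable M" "\<And>i. 1 \<le> i \<Longrightarrow> b i \<in> borel_measurable M"
  shows "(\<lambda>\<omega>. est (\<lambda>i\<in>{1..m}. (a i \<omega>, b i \<omega>))) \<in> measurable M borel_infty"
proof (rule measurable_compose[where g=est])
  show "(\<lambda>\<omega>. \<lambda>i\<in>{1..m}. (a i \<omega>, b i \<omega>)) \<in> measurable M (Pi\<^sub>M {1..m} (\<lambda>_. borel))"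
    using assms by (intro measurable_restrict borel_measurable_Pair) auto
  show "est \<in> measurable (Pi\<^sub>M {1..m} (\<lambda>_. borel)) borel_infty"
    using assms(1) by (simp add: tls_estimator_def)
qed

lemma tls_solution_cong:
  assumes "\<And>i. i \<in> {1..m} \<Longrightarrow> a i = a' i" "\<And>i. i \<in> {1..m} \<Longrightarrow> b i = b' i"
  shows "tls_solution m a b = tls_solution m a' b'"
proof -
  have "tls_feasible m a b = tls_feasible m a' b'"
    using assms by (auto simp: tls_feasible_def fun_eq_iff)
  then show ?thesis by (simp add: tls_solution_def fun_eq_iff)
qed

lemma tls_estimator_solution:
  assumes est: "tls_estimator m est" and ex: "\<exists>X da db. tls_solution m a b X da db"
  shows "\<exists>X da db. est (\<lambda>i\<in>{1..m}. (a i, b i)) = Some X \<and> tls_solution m a b X da db"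
proof -
  let ?D = "\<lambda>i\<in>{1..m}. (a i, b i)"
  have ext: "?D \<in> extensional {1..m}" by simp
  have eq: "tls_solution m (\<lambda>i. fst (?D i)) (\<lambda>i. snd (?D i)) = tls_solution m a b"
    by (rule tls_solution_cong) auto
  show ?thesis
    using bspec[OF conjunct2[OF est[unfolded tls_estimator_def Let_def]] ext]
    unfolding eq if_P[OF ex] .
qed

section \<open>Convergence to zero in mean\<close>

context prob_space begin

definition L1_null :: "(nat \<Rightarrow> 'a \<Rightarrow> 'v::{banach, second_countable_topology}) \<Rightarrow> bool" where
  "L1_null F \<longleftrightarrow> (\<forall>m. integrable M (F m)) \<and> (\<lambda>m. expectation (\<lambda>\<omega>. norm (F m \<omega>))) \<longlonglongrightarrow> 0"

lemma L1_null_const: "x \<longlonglongrightarrow> 0 \<Longrightarrow> L1_null (\<lambda>m \<omega>. x m)"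
  by (simp add: L1_null_def prob_space tendsto_norm_zero)

lemma L1_null_bound:
  assumes F: "\<And>m. F m \<in> borel_measurable M" and G: "L1_null G" and le: "\<And>m \<omega>. norm (F m \<omega>) \<le> norm (G m \<omega>)"
  shows "L1_null F"
proof -
  have int: "integrable M (F m)" for m
    by (rule Bochner_Integration.integrable_bound[of _ "G m"]) (use assms in \<open>auto simp: L1_null_def\<close>)
  have "(\<lambda>m. expectation (\<lambda>\<omega>. norm (F m \<omega>))) \<longlonglongrightarrow> 0"
  proof (rule Lim_null_comparison)
    show "eventually (\<lambda>m. norm (expectation (\<lambda>\<omega>. norm (F m \<omega>))) \<le> expectation (\<lambda>\<omega>. norm (G m \<omega>))) sequentially"
      using G int le by (intro always_eventually allI) (auto simp: L1_null_def integral_nonneg intro!: integral_mono)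
  qed (use G in \<open>simp add: L1_null_def\<close>)
  then show ?thesis using int by (simp add: L1_null_def)
qed

lemma L1_null_add:
  assumes "L1_null F" "L1_null G" shows "L1_null (\<lambda>m \<omega>. F m \<omega> + G m \<omega>)"
proof -
  have "(\<lambda>m. expectation (\<lambda>\<omega>. norm (F m \<omega> + G m \<omega>))) \<longlonglongrightarrow> 0"
  proof (rule Lim_null_comparison)
    show "eventually (\<lambda>m. norm (expectation (\<lambda>\<omega>. norm (F m \<omega> + G m \<omega>)))
        \<le> expectation (\<lambda>\<omega>. norm (F m \<omega>)) + expectation (\<lambda>\<omega>. norm (G m \<omega>))) sequentially"
    proof (intro always_eventually allI)
      fix m
      have "expectation (\<lambda>\<omega>. norm (F m \<omega> + G m \<omega>)) \<le> expectation (\<lambda>\<omega>. norm (F m \<omega>) + norm (G m \<omega>))"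
        using assms by (intro integral_mono norm_triangle_ineq) (auto simp: L1_null_def)
      then show "norm (expectation (\<lambda>\<omega>. norm (F m \<omega> + G m \<omega>)))
        \<le> expectation (\<lambda>\<omega>. norm (F m \<omega>)) + expectation (\<lambda>\<omega>. norm (G m \<omega>))"
        using assms by (simp add: L1_null_def integral_nonneg)
    qed
    show "(\<lambda>m. expectation (\<lambda>\<omega>. norm (F m \<omega>)) + expectation (\<lambda>\<omega>. norm (G m \<omega>))) \<longlonglongrightarrow> 0"
      using assms tendsto_add[of _ 0 sequentially _ 0] by (auto simp: L1_null_def)
  qed
  then show ?thesis using assms by (simp add: L1_null_def)
qed

lemma L1_null_sum:
  "finite I \<Longrightarrow> (\<And>j. j \<in> I \<Longrightarrow> L1_null (F j)) \<Longrightarrow> L1_null (\<lambda>m \<omega>. \<Sum>j\<in>I. F j m \<omega>)"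
  by (induction I rule: finite_induct) (auto intro: L1_null_add L1_null_const)

lemma L1_null_norm: "L1_null F \<Longrightarrow> L1_null (\<lambda>m \<omega>. norm (F m \<omega>))"
  by (simp add: L1_null_def)

lemma L1_null_cmult: "L1_null F \<Longrightarrow> L1_null (\<lambda>m \<omega>. k * F m \<omega>)" for k :: real
  using tendsto_mult_left[of "\<lambda>m. expectation (\<lambda>\<omega>. \<bar>F m \<omega>\<bar>)" 0 sequentially "\<bar>k\<bar>"]
  by (auto simp: L1_null_def abs_mult)

lemma L1_null_vec:
  fixes F :: "nat \<Rightarrow> 'a \<Rightarrow> 'v::euclidean_space^'k"
  assumes "\<And>j. L1_null (\<lambda>m \<omega>. F m \<omega> $ j)"
  shows "L1_null F"
proof (rule L1_null_bound)
  have "integrable M (\<lambda>\<omega>. F m \<omega> $ j)" for m j using assms[of j] by (simp add: L1_null_def)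
  then show "F m \<in> borel_measurable M" for m
    by (intro borel_measurable_vec borel_measurable_integrable)
  show "L1_null (\<lambda>m \<omega>. \<Sum>j\<in>UNIV. norm (F m \<omega> $ j))" by (intro L1_null_sum L1_null_norm assms) auto
  show "norm (F m \<omega>) \<le> norm (\<Sum>j\<in>UNIV. norm (F m \<omega> $ j))" for m \<omega>
    using L2_set_le_sum[of UNIV "\<lambda>j. norm (F m \<omega> $ j)"] by (simp add: norm_vec_def sum_nonneg)
qed

end

section \<open>The model: regressors\<close>

locale eiv_model = iid_vectors M c for M :: "'w measure" and c :: "nat \<Rightarrow> 'w \<Rightarrow> real^('n::finite + 'd::finite)" +
  fixes X0 :: "real^'d^'n" and a0 :: "nat \<Rightarrow> real^'n" and \<sigma> \<delta> :: real and \<mu>a :: "real^'n" and Sa :: "real^'n^'n"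
  assumes mean: "(\<integral>\<omega>. c 1 \<omega> \<partial>M) = 0"
    and sigma: "0 < \<sigma>"
    and cov: "cov_matrix M (c 1) = \<sigma>\<^sup>2 *\<^sub>R mat 1"
    and delta: "0 < \<delta>"
    and moment: "integrable M (\<lambda>\<omega>. norm (c 1 \<omega>) powr (4 + 2 * \<delta>))"
    and regressors: "(\<lambda>m. 1 / real m powr (1 + \<delta> / 2) * (\<Sum>i=1..m. norm (a0 i) powr (2 + \<delta>))) \<longlonglongrightarrow> 0"
    and third: "\<And>p q r. (\<integral>\<omega>. c 1 \<omega> $ p * c 1 \<omega> $ q * c 1 \<omega> $ r \<partial>M) = 0"
    and lim_mean: "(\<lambda>m. avg m a0) \<longlonglongrightarrow> \<mu>a"
    and lim_cov: "(\<lambda>m. avg m (\<lambda>i. outer (a0 i - \<mu>a) (a0 i - \<mu>a))) \<longlonglongrightarrow> Sa"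
    and nonsing: "invertible Sa"
begin

definition "V = Sa + outer \<mu>a \<mu>a"
definition "w = matrix_inv V *v \<mu>a"

lemma avg_a0_outer: "(\<lambda>m. avg m (\<lambda>i. outer (a0 i) (a0 i))) \<longlonglongrightarrow> V"
proof -
  have "(\<lambda>m. avg m (\<lambda>i. outer (a0 i - \<mu>a) (a0 i - \<mu>a)) + outer (avg m a0) \<mu>a + outer \<mu>a (avg m a0) - outer \<mu>a \<mu>a)
      \<longlonglongrightarrow> Sa + outer \<mu>a \<mu>a + outer \<mu>a \<mu>a - outer \<mu>a \<mu>a"
    by (intro tendsto_intros lim_cov lim_mean)
  moreover have "eventually (\<lambda>m. avg m (\<lambda>i. outer (a0 i - \<mu>a) (a0 i - \<mu>a)) + outer (avg m a0) \<mu>a + outer \<mu>a (avg m a0) - outer \<mu>a \<mu>a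
      = avg m (\<lambda>i. outer (a0 i) (a0 i))) sequentially"
    using eventually_gt_at_top[of 0]
  proof eventually_elim
    case (elim m)
    have 1: "outer (avg m a0) \<mu>a = avg m (\<lambda>i. outer (a0 i) \<mu>a)"
      by (rule avg_linear) (rule bounded_linear.linear[OF bounded_bilinear.bounded_linear_left[OF bounded_bilinear_outer]])
    have 2: "outer \<mu>a (avg m a0) = avg m (\<lambda>i. outer \<mu>a (a0 i))"
      by (rule avg_linear) (rule bounded_linear.linear[OF bounded_bilinear.bounded_linear_right[OF bounded_bilinear_outer]])
    have 3: "outer \<mu>a \<mu>a = avg m (\<lambda>i. outer \<mu>a \<mu>a)" using elim by (simp add: avg_def sum_constant_scaleR del: sum_constant)
    show ?case
      unfolding 1 2 by (subst 3) (simp add: avg_add[symmetric] avg_diff[symmetric]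
        bounded_bilinear.diff_left[OF bounded_bilinear_outer] bounded_bilinear.diff_right[OF bounded_bilinear_outer])
  qed
  ultimately show ?thesis by (simp add: V_def tendsto_cong add.commute)
qed

lemma avg_a0_quadratic: "(\<lambda>m. avg m (\<lambda>i. (x \<bullet> a0 i) * (y \<bullet> a0 i))) \<longlonglongrightarrow> x \<bullet> (V *v y)"
  unfolding avg_quadratic by (intro tendsto_intros avg_a0_outer)

lemma Sa_sym: "transpose Sa = Sa"
proof -
  have "(\<lambda>m. transpose (avg m (\<lambda>i. outer (a0 i - \<mu>a) (a0 i - \<mu>a)))) \<longlonglongrightarrow> transpose Sa"
    by (intro tendsto_intros lim_cov)
  moreover have "transpose (avg m (\<lambda>i. outer (a0 i - \<mu>a) (a0 i - \<mu>a))) = avg m (\<lambda>i. outer (a0 i - \<mu>a) (a0 i - \<mu>a))" for m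
    by (simp only: avg_transpose[symmetric] transpose_outer)
  ultimately show ?thesis by (simp only: LIMSEQ_unique[OF _ lim_cov])
qed

text \<open>As a limit of averages of squares.\<close>
lemma Sa_nonneg: "0 \<le> x \<bullet> (Sa *v x)"
proof (rule LIMSEQ_le_const)
  show "(\<lambda>m. avg m (\<lambda>i. (x \<bullet> (a0 i - \<mu>a)) * (x \<bullet> (a0 i - \<mu>a)))) \<longlonglongrightarrow> x \<bullet> (Sa *v x)"
    unfolding avg_quadratic by (intro tendsto_intros lim_cov)
  show "\<exists>N. \<forall>m\<ge>N. 0 \<le> avg m (\<lambda>i. (x \<bullet> (a0 i - \<mu>a)) * (x \<bullet> (a0 i - \<mu>a)))"
    by (auto intro!: avg_nonneg)
qed

text \<open>If \<open>x\<^sup>T S\<^sub>a x = 0\<close>, then \<open>x\<close> minimises the form, so \<open>S\<^sub>a x = 0\<close> and \<open>x = 0\<close> by nonsingularity.\<close>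
lemma pos_def_Sa: "pos_def Sa"
proof -
  have "0 < x \<bullet> (Sa *v x)" if "x \<noteq> 0" for x
  proof (rule ccontr)
    assume "\<not> 0 < x \<bullet> (Sa *v x)"
    then have zero: "x \<bullet> (Sa *v x) = 0" using Sa_nonneg[of x] by linarith
    define y where "y = Sa *v x"
    have "0 \<le> t * (2 * (y \<bullet> y)) + t\<^sup>2 * (y \<bullet> (Sa *v y))" for t
    proof -
      have "0 \<le> (x + t *\<^sub>R y) \<bullet> (Sa *v (x + t *\<^sub>R y))" by (rule Sa_nonneg)
      also have "\<dots> = x \<bullet> (Sa *v x) + t * (y \<bullet> (Sa *v x) + x \<bullet> (Sa *v y)) + t\<^sup>2 * (y \<bullet> (Sa *v y))"
        by (simp add: matrix_vector_right_distrib matrix_vector_mult_scaleR inner_add_left inner_add_right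
            power2_eq_square algebra_simps)
      also have "x \<bullet> (Sa *v y) = y \<bullet> y" using sym_inner[OF Sa_sym, of x y] by (simp add: y_def)
      also have "y \<bullet> (Sa *v x) = y \<bullet> y" by (simp add: y_def)
      finally show ?thesis by (simp add: zero)
    qed
    then have "2 * (y \<bullet> y) = 0" by (rule linear_term_zero)
    then have "Sa *v x = 0" by (simp add: y_def)
    then have "matrix_inv Sa *v (Sa *v x) = 0" by simp
    then have "x = 0" by (simp add: matrix_vector_mul_assoc matrix_inv_mult[OF nonsing])
    then show False using that by simp
  qed
  then show ?thesis by (simp add: pos_def_def Sa_sym)
qed

lemma V_quadratic: "x \<bullet> (V *v x) = x \<bullet> (Sa *v x) + (x \<bullet> \<mu>a)\<^sup>2"
  by (simp add: V_def matrix_vector_mult_add_rdistrib inner_add_right outer_mult_vec power2_eq_square inner_commute)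

lemma pos_def_V: "pos_def V"
proof -
  have "0 < x \<bullet> (V *v x)" if "x \<noteq> 0" for x
    using pos_def_pos[OF pos_def_Sa that] by (simp add: V_quadratic add_pos_nonneg)
  then show ?thesis by (simp add: pos_def_def V_def transpose_add transpose_outer Sa_sym)
qed

lemma V_w: "V *v w = \<mu>a"
  by (simp add: w_def matrix_vector_mul_assoc matrix_inv_mult pos_def_invertible pos_def_V)

text \<open>With \<open>\<theta> = \<mu>\<^sub>a\<^sup>T V\<^sup>-\<^sup>1 \<mu>\<^sub>a\<close> we have \<open>\<theta> - \<theta>\<^sup>2 = w\<^sup>T S\<^sub>a w\<close>, which is positive unless \<open>w = 0\<close>.\<close>
lemma mu_w_less_1: "\<mu>a \<bullet> w < 1"
proof (cases "w = 0")
  case False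
  have "w \<bullet> (V *v w) = w \<bullet> (Sa *v w) + (w \<bullet> \<mu>a)\<^sup>2" by (rule V_quadratic)
  then have "0 < \<mu>a \<bullet> w - (\<mu>a \<bullet> w)\<^sup>2"
    using pos_def_pos[OF pos_def_Sa False] by (simp add: V_w inner_commute)
  then have "0 < (\<mu>a \<bullet> w) * (1 - \<mu>a \<bullet> w)" by (simp add: power2_eq_square algebra_simps)
  then show ?thesis by (auto simp: zero_less_mult_iff)
qed simp

lemma avg_norm_a0_bounded: "\<exists>A. \<forall>m. avg m (\<lambda>i. (norm (a0 i))\<^sup>2) \<le> A"
proof -
  have "trace (outer x x) = (norm x)\<^sup>2" for x :: "real^'n"
    by (simp add: trace_def outer_def power2_norm_eq_inner inner_vec_def)
  then have "(\<lambda>m. avg m (\<lambda>i. (norm (a0 i))\<^sup>2)) = (\<lambda>m. trace (avg m (\<lambda>i. outer (a0 i) (a0 i))))"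
    by (simp add: avg_linear[OF bounded_linear.linear[OF bounded_linear_trace]])
  moreover have "(\<lambda>m. trace (avg m (\<lambda>i. outer (a0 i) (a0 i)))) \<longlonglongrightarrow> trace V"
    by (intro tendsto_intros avg_a0_outer)
  ultimately have "Bseq (\<lambda>m. avg m (\<lambda>i. (norm (a0 i))\<^sup>2))"
    by (simp only: convergent_imp_Bseq convergentI)
  then obtain A where "norm (avg m (\<lambda>i. (norm (a0 i))\<^sup>2)) \<le> A" for m unfolding Bseq_def by blast
  then have "\<forall>m. avg m (\<lambda>i. (norm (a0 i))\<^sup>2) \<le> A" by (simp add: abs_le_iff)
  then show ?thesis by blast
qed

definition "a0_sq_bound = (SOME A. \<forall>m. avg m (\<lambda>i. (norm (a0 i))\<^sup>2) \<le> A)"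

lemma avg_norm_a0_le: "avg m (\<lambda>i. (norm (a0 i))\<^sup>2) \<le> a0_sq_bound"
  using someI_ex[OF avg_norm_a0_bounded] by (simp add: a0_sq_bound_def)

text \<open>By \<open>norm_a0_le\<close> this is a rate with \<open>max {\<parallel>a\<^sup>0\<^sub>i\<parallel> | i \<le> m} \<le> max_rate m \<surd>m\<close>: every single summand in
  hypothesis \<open>regressors\<close> is bounded by the whole sum.\<close>
definition max_rate :: "nat \<Rightarrow> real" where
  "max_rate m = (1 / real m powr (1 + \<delta> / 2) * (\<Sum>i=1..m. norm (a0 i) powr (2 + \<delta>))) powr (1 / (2 + \<delta>))"

lemma max_rate_null: "max_rate \<longlonglongrightarrow> 0"
  unfolding max_rate_def[abs_def]
  by (rule tendsto_zero_powrI[OF regressors tendsto_const])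
    (use delta in \<open>auto intro!: always_eventually divide_nonneg_nonneg sum_nonneg\<close>)

lemma norm_a0_le: "1 \<le> i \<Longrightarrow> i \<le> m \<Longrightarrow> norm (a0 i) \<le> max_rate m * sqrt m"
proof -
  assume i: "1 \<le> i" "i \<le> m"
  then have m: "0 < real m" by simp
  let ?S = "\<Sum>i=1..m. norm (a0 i) powr (2 + \<delta>)"
  have S: "0 \<le> ?S" by (intro sum_nonneg) auto
  have "norm (a0 i) = (norm (a0 i) powr (2 + \<delta>)) powr (1 / (2 + \<delta>))"
    using delta by (simp add: powr_powr)
  also have "\<dots> \<le> ?S powr (1 / (2 + \<delta>))"
    using i delta by (intro powr_mono2 member_le_sum) auto
  also have "?S = (1 / real m powr (1 + \<delta> / 2) * ?S) * real m powr (1 + \<delta> / 2)"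
    using m by simp
  also have "\<dots> powr (1 / (2 + \<delta>)) = max_rate m * (real m powr (1 + \<delta> / 2)) powr (1 / (2 + \<delta>))"
    unfolding max_rate_def using S by (intro powr_mult)
  also have "(real m powr (1 + \<delta> / 2)) powr (1 / (2 + \<delta>)) = real m powr (1 / 2)"
    using delta by (simp add: powr_powr field_simps)
  finally show ?thesis using m by (simp add: powr_half_sqrt)
qed

text \<open>Two of the four factors are bounded by the maximum, the other two are averaged.\<close>
lemma avg_a0_pow4: "(\<lambda>m. avg m (\<lambda>i. (norm (a0 i))^4) / m) \<longlonglongrightarrow> 0"
proof (rule Lim_null_comparison)
  show "eventually (\<lambda>m. norm (avg m (\<lambda>i. (norm (a0 i))^4) / m) \<le> (max_rate m)\<^sup>2 * a0_sq_bound) sequentially"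
    using eventually_gt_at_top[of 0]
  proof eventually_elim
    case (elim m)
    have "(\<Sum>i=1..m. (norm (a0 i))^4) \<le> (\<Sum>i=1..m. ((max_rate m)\<^sup>2 * m) * (norm (a0 i))\<^sup>2)"
    proof (rule sum_mono)
      fix i assume "i \<in> {1..m}"
      then have "(norm (a0 i))\<^sup>2 \<le> (max_rate m * sqrt m)\<^sup>2" by (intro power_mono norm_a0_le) auto
      then have "(norm (a0 i))\<^sup>2 * (norm (a0 i))\<^sup>2 \<le> ((max_rate m)\<^sup>2 * m) * (norm (a0 i))\<^sup>2"
        by (intro mult_right_mono) (auto simp: power_mult_distrib)
      then show "(norm (a0 i))^4 \<le> ((max_rate m)\<^sup>2 * m) * (norm (a0 i))\<^sup>2"
        by (simp flip: power_add)
    qed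
    then have "avg m (\<lambda>i. (norm (a0 i))^4) \<le> avg m (\<lambda>i. ((max_rate m)\<^sup>2 * m) * (norm (a0 i))\<^sup>2)"
      by (simp add: avg_def divide_right_mono)
    also have "\<dots> \<le> ((max_rate m)\<^sup>2 * m) * a0_sq_bound"
      unfolding avg_mult_left by (intro mult_left_mono avg_norm_a0_le) auto
    finally have "avg m (\<lambda>i. (norm (a0 i))^4) / m \<le> (max_rate m)\<^sup>2 * a0_sq_bound"
      using elim by (simp add: divide_le_eq mult_ac)
    then show ?case by (simp add: avg_nonneg)
  qed
  have "(\<lambda>m. (max_rate m)\<^sup>2 * a0_sq_bound) \<longlonglongrightarrow> 0\<^sup>2 * a0_sq_bound" by (intro tendsto_intros max_rate_null)
  then show "(\<lambda>m. (max_rate m)\<^sup>2 * a0_sq_bound) \<longlonglongrightarrow> 0" by simp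
qed

text \<open>Weights of at most quadratic growth in the regressors are admissible in \<open>weighted_lln\<close>.\<close>
lemma weights:
  assumes "\<And>i. \<bar>\<alpha> i\<bar> \<le> K * (1 + (norm (a0 i))\<^sup>2)"
  shows "(\<lambda>m. avg m (\<lambda>i. (\<alpha> i)\<^sup>2) / m) \<longlonglongrightarrow> 0" and "avg m (\<lambda>i. \<bar>\<alpha> i\<bar>) \<le> K * (1 + a0_sq_bound)"
proof -
  have K: "0 \<le> K"
  proof (rule ccontr)
    assume "\<not> 0 \<le> K"
    then have "K * (1 + (norm (a0 0))\<^sup>2) < 0" by (simp add: mult_neg_pos add_pos_nonneg)
    then show False using assms[of 0] by linarith
  qed
  have const: "avg m (\<lambda>i. 1::real) \<le> 1" for m by (simp add: avg_def)
  have "avg m (\<lambda>i. \<bar>\<alpha> i\<bar>) \<le> avg m (\<lambda>i. K * (1 + (norm (a0 i))\<^sup>2))" by (intro avg_mono assms)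
  also have "\<dots> \<le> K * (1 + a0_sq_bound)"
    unfolding avg_mult_left avg_add using K const avg_norm_a0_le by (intro mult_left_mono add_mono) auto
  finally show "avg m (\<lambda>i. \<bar>\<alpha> i\<bar>) \<le> K * (1 + a0_sq_bound)" .
  show "(\<lambda>m. avg m (\<lambda>i. (\<alpha> i)\<^sup>2) / m) \<longlonglongrightarrow> 0"
  proof (rule Lim_null_comparison)
    have sq: "(\<alpha> i)\<^sup>2 \<le> 2 * K\<^sup>2 * 1 + 2 * K\<^sup>2 * (norm (a0 i))^4" for i
    proof -
      have "(\<alpha> i)\<^sup>2 \<le> (K * (1 + (norm (a0 i))\<^sup>2))\<^sup>2"
        using power_mono[OF assms abs_ge_zero, of i 2] unfolding power2_abs .
      also have "\<dots> = K\<^sup>2 * (1 + (norm (a0 i))\<^sup>2)\<^sup>2" by (simp add: power_mult_distrib)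
      also have "\<dots> \<le> K\<^sup>2 * (2 * 1 + 2 * (norm (a0 i))^4)"
        using sum_squares_bound[of 1 "(norm (a0 i))\<^sup>2"]
        by (intro mult_left_mono) (simp_all add: power2_sum flip: power_mult)
      finally show ?thesis by (simp add: algebra_simps)
    qed
    show "eventually (\<lambda>m. norm (avg m (\<lambda>i. (\<alpha> i)\<^sup>2) / m) \<le>
        2 * K\<^sup>2 * (1 / m) + 2 * K\<^sup>2 * (avg m (\<lambda>i. (norm (a0 i))^4) / m)) sequentially"
    proof (intro always_eventually allI)
      fix m
      have "avg m (\<lambda>i. (\<alpha> i)\<^sup>2) \<le> 2 * K\<^sup>2 * avg m (\<lambda>i. 1) + 2 * K\<^sup>2 * avg m (\<lambda>i. (norm (a0 i))^4)"
        unfolding avg_mult_left[symmetric] avg_add[symmetric] by (intro avg_mono sq)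
      also have "\<dots> \<le> 2 * K\<^sup>2 * 1 + 2 * K\<^sup>2 * avg m (\<lambda>i. (norm (a0 i))^4)"
        by (intro add_right_mono mult_left_mono const) auto
      finally have "avg m (\<lambda>i. (\<alpha> i)\<^sup>2) / m \<le> (2 * K\<^sup>2 * 1 + 2 * K\<^sup>2 * avg m (\<lambda>i. (norm (a0 i))^4)) / m"
        by (rule divide_right_mono) simp
      then show "norm (avg m (\<lambda>i. (\<alpha> i)\<^sup>2) / m) \<le> 2 * K\<^sup>2 * (1 / m) + 2 * K\<^sup>2 * (avg m (\<lambda>i. (norm (a0 i))^4) / m)"
        by (simp add: avg_nonneg add_divide_distrib)
    qed
    have "(\<lambda>m. 2 * K\<^sup>2 * (1 / real m) + 2 * K\<^sup>2 * (avg m (\<lambda>i. (norm (a0 i))^4) / m)) \<longlonglongrightarrow> 2 * K\<^sup>2 * 0 + 2 * K\<^sup>2 * 0"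
      by (intro tendsto_intros avg_a0_pow4 lim_1_over_n)
    then show "(\<lambda>m. 2 * K\<^sup>2 * (1 / real m) + 2 * K\<^sup>2 * (avg m (\<lambda>i. (norm (a0 i))^4) / m)) \<longlonglongrightarrow> 0" by simp
  qed
qed

end

section \<open>Functions of polynomial growth\<close>

definition growth :: "nat \<Rightarrow> ('v::euclidean_space \<Rightarrow> real) \<Rightarrow> bool" where
  "growth d g \<longleftrightarrow> g \<in> borel_measurable borel \<and> (\<exists>K\<ge>0. \<forall>x. \<bar>g x\<bar> \<le> K * (1 + norm x) ^ d)"

lemma growthI:
  "g \<in> borel_measurable borel \<Longrightarrow> 0 \<le> K \<Longrightarrow> (\<And>x. \<bar>g x\<bar> \<le> K * (1 + norm x) ^ d) \<Longrightarrow> growth d g"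
  by (auto simp: growth_def)

lemma growth_measurable: "growth d g \<Longrightarrow> g \<in> borel_measurable borel"
  by (simp add: growth_def)

lemma growth_mono:
  fixes g :: "'v::euclidean_space \<Rightarrow> real"
  assumes "growth d g" "d \<le> e" shows "growth e g"
proof -
  obtain K where K: "0 \<le> K" "\<And>x. \<bar>g x\<bar> \<le> K * (1 + norm x) ^ d" using assms(1) by (auto simp: growth_def)
  show ?thesis
  proof (rule growthI[OF growth_measurable[OF assms(1)] K(1)])
    fix x :: 'v
    have "(1 + norm x) ^ d \<le> (1 + norm x) ^ e" using assms(2) by (intro power_increasing) auto
    then show "\<bar>g x\<bar> \<le> K * (1 + norm x) ^ e" using K by (meson mult_left_mono order_trans)
  qed
qed

lemma growth_mult: assumes "growth d f" "growth e g" shows "growth (d + e) (\<lambda>x. f x * g x)"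
proof -
  obtain K where K: "0 \<le> K" "\<And>x. \<bar>f x\<bar> \<le> K * (1 + norm x) ^ d" using assms(1) by (auto simp: growth_def)
  obtain L where L: "0 \<le> L" "\<And>x. \<bar>g x\<bar> \<le> L * (1 + norm x) ^ e" using assms(2) by (auto simp: growth_def)
  show ?thesis
  proof (rule growthI[of _ "K * L"])
    show "(\<lambda>x. f x * g x) \<in> borel_measurable borel" using assms by (intro borel_measurable_times growth_measurable)
    show "0 \<le> K * L" using K L by simp
    fix x
    have "\<bar>f x * g x\<bar> \<le> (K * (1 + norm x) ^ d) * (L * (1 + norm x) ^ e)"
      unfolding abs_mult using K L by (intro mult_mono) auto
    then show "\<bar>f x * g x\<bar> \<le> K * L * (1 + norm x) ^ (d + e)" by (simp add: power_add mult_ac)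
  qed
qed

lemma growth_power: "growth d g \<Longrightarrow> growth (k * d) (\<lambda>x. (g x) ^ k)"
proof (induction k)
  case 0 show ?case by (rule growthI[of _ 1]) auto
next
  case (Suc k) then show ?case using growth_mult[of d g "k * d" "\<lambda>x. g x ^ k"] by simp
qed

lemma growth_add: assumes "growth d f" "growth d g" shows "growth d (\<lambda>x. f x + g x)"
proof -
  obtain K where K: "0 \<le> K" "\<And>x. \<bar>f x\<bar> \<le> K * (1 + norm x) ^ d" using assms(1) by (auto simp: growth_def)
  obtain L where L: "0 \<le> L" "\<And>x. \<bar>g x\<bar> \<le> L * (1 + norm x) ^ d" using assms(2) by (auto simp: growth_def)
  show ?thesis
  proof (rule growthI[of _ "K + L"])
    show "(\<lambda>x. f x + g x) \<in> borel_measurable borel" using assms by (intro borel_measurable_add growth_measurable)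
    show "0 \<le> K + L" using K L by simp
    show "\<bar>f x + g x\<bar> \<le> (K + L) * (1 + norm x) ^ d" for x
      using K(2)[of x] L(2)[of x] abs_triangle_ineq[of "f x" "g x"] unfolding distrib_right by linarith
  qed
qed

lemma growth_const: "growth 0 (\<lambda>x. k)"
  by (rule growthI[of _ "\<bar>k\<bar>"]) auto

lemma growth_abs: "growth d g \<Longrightarrow> growth d (\<lambda>x. \<bar>g x\<bar>)"
  by (auto simp: growth_def)

lemma growth_norm_mult: "growth 1 (\<lambda>x. norm (A *v x))" for A :: "real^'k^'l"
proof (rule growthI[of _ "norm A"])
  show "(\<lambda>x. norm (A *v x)) \<in> borel_measurable borel" by measurable
  show "\<bar>norm (A *v x)\<bar> \<le> norm A * (1 + norm x) ^ 1" for x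
    using norm_matrix_vector_le[of A x] by (simp add: distrib_left add_increasing)
qed simp

lemma growth_inner_mult: "growth 1 (\<lambda>x. y \<bullet> (A *v x))" for A :: "real^'k^'l"
proof (rule growthI[of _ "norm A * norm y"])
  show "(\<lambda>x. y \<bullet> (A *v x)) \<in> borel_measurable borel" by measurable
  show "\<bar>y \<bullet> (A *v x)\<bar> \<le> norm A * norm y * (1 + norm x) ^ 1" for x
    using quadratic_form_bound[of y A x] by (simp add: distrib_left add_increasing)
qed simp

lemma growth_nth_mult: "growth 1 (\<lambda>x. (A *v x) $ j)" for A :: "real^'k^'l"
  using growth_inner_mult[of "axis j 1" A] by (simp add: inner_axis')

lemma avg_nth: "avg m f $ j = avg m (\<lambda>i. f i $ j)"
  by (simp add: avg_def)

context eiv_model begin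

section \<open>The model: moments of the errors\<close>

lemma growth_integrable:
  assumes g: "growth d g" and d: "d \<le> 4"
  shows "integrable M (\<lambda>\<omega>. g (c 1 \<omega>))"
proof -
  obtain K where K: "0 \<le> K" "\<And>x. \<bar>g x\<bar> \<le> K * (1 + norm x) ^ 4"
    using growth_mono[OF g d] by (auto simp: growth_def)
  have le: "(1 + t) ^ 4 \<le> 16 + 16 * t powr (4 + 2 * \<delta>)" if "0 \<le> t" for t :: real
  proof (cases "t \<le> 1")
    case True
    then have "(1 + t) ^ 4 \<le> 2 ^ 4" using that by (intro power_mono) auto
    then show ?thesis by simp (smt (verit) powr_ge_zero)
  next
    case False
    then have "(1 + t) ^ 4 \<le> (2 * t) ^ 4" by (intro power_mono) auto
    also have "\<dots> = 16 * t powr 4" using False by (simp add: power_mult_distrib powr_numeral)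
    also have "\<dots> \<le> 16 * t powr (4 + 2 * \<delta>)" using False delta by (intro mult_left_mono powr_mono) auto
    finally show ?thesis by simp
  qed
  show ?thesis
  proof (rule Bochner_Integration.integrable_bound)
    show "integrable M (\<lambda>\<omega>. K * (16 + 16 * norm (c 1 \<omega>) powr (4 + 2 * \<delta>)))"
      using moment by simp
    show "(\<lambda>\<omega>. g (c 1 \<omega>)) \<in> borel_measurable M"
      by (rule measurable_compose[OF c_measurable growth_measurable[OF g]]) simp
    have "\<bar>g x\<bar> \<le> \<bar>K * (16 + 16 * norm x powr (4 + 2 * \<delta>))\<bar>" for x
    proof -
      have "\<bar>g x\<bar> \<le> K * (16 + 16 * norm x powr (4 + 2 * \<delta>))"
        using K(2)[of x] mult_left_mono[OF le[OF norm_ge_zero[of x]] K(1)] by linarith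
      then show ?thesis by linarith
    qed
    then show "AE \<omega> in M. norm (g (c 1 \<omega>)) \<le> norm (K * (16 + 16 * norm (c 1 \<omega>) powr (4 + 2 * \<delta>)))"
      by simp
  qed
qed

lemma growth_ident:
  assumes g: "growth d g" and d: "d \<le> 4" and i: "1 \<le> i"
  shows "integrable M (\<lambda>\<omega>. g (c i \<omega>))" "expectation (\<lambda>\<omega>. g (c i \<omega>)) = expectation (\<lambda>\<omega>. g (c 1 \<omega>))"
  using integrable_ident[OF growth_measurable[OF g] i] growth_integrable[OF g d]
    expectation_ident[OF growth_measurable[OF g] i] by auto

lemma c_integrable: "integrable M (c 1)"
proof -
  have "integrable M (\<lambda>\<omega>. norm (mat 1 *v c 1 \<omega>))" by (rule growth_integrable[OF growth_norm_mult]) simp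
  moreover have "c 1 \<in> borel_measurable M" by (rule c_measurable) simp
  ultimately show ?thesis by (simp add: integrable_norm_iff)
qed

lemma first_moment: "expectation (\<lambda>\<omega>. x \<bullet> (A *v c 1 \<omega>)) = 0"
proof -
  have "bounded_linear (\<lambda>y. x \<bullet> (A *v y))"
    by (intro bounded_linear_compose[OF bounded_linear_inner_right] matrix_vector_mul_bounded_linear)
  from integral_bounded_linear[OF this c_integrable] show ?thesis by (simp add: mean del: One_nat_def)
qed

lemma second_moment: "expectation (\<lambda>\<omega>. (x \<bullet> (A *v c 1 \<omega>)) * (y \<bullet> (B *v c 1 \<omega>))) = \<sigma>\<^sup>2 * (x \<bullet> ((A ** transpose B) *v y))"
proof -
  have "integrable M (\<lambda>\<omega>. norm (outer (c 1 \<omega>) (c 1 \<omega>)))"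
    using growth_integrable[OF growth_power[OF growth_norm_mult, of 2 "mat 1"]]
    by (simp add: norm_outer power2_eq_square)
  moreover have "(\<lambda>\<omega>. outer (c 1 \<omega>) (c 1 \<omega>)) \<in> borel_measurable M"
    using c_measurable[of 1] by measurable
  ultimately have int: "integrable M (\<lambda>\<omega>. outer (c 1 \<omega>) (c 1 \<omega>))" by (simp add: integrable_norm_iff)
  have E: "(\<integral>\<omega>. outer (c 1 \<omega>) (c 1 \<omega>) \<partial>M) = \<sigma>\<^sup>2 *\<^sub>R mat 1"
    using cov by (simp add: cov_matrix_def Let_def mean del: One_nat_def)
  define T where "T Z = x \<bullet> ((A ** Z ** transpose B) *v y)" for Z
  have T: "bounded_linear T"
    unfolding T_def
    by (intro bounded_linear_compose[OF bounded_linear_inner_right]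
        bounded_linear_compose[OF bounded_bilinear.bounded_linear_left[OF bounded_bilinear_matrix_vector_mult]]
        bounded_linear_compose[OF bounded_bilinear.bounded_linear_left[OF bounded_bilinear_matrix_mult]]
        bounded_bilinear.bounded_linear_right[OF bounded_bilinear_matrix_mult])
  have "(x \<bullet> (A *v z)) * (y \<bullet> (B *v z)) = T (outer z z)" for z
    by (simp add: T_def matrix_mult_outer outer_mult_matrix outer_mult_vec inner_commute)
  then have "expectation (\<lambda>\<omega>. (x \<bullet> (A *v c 1 \<omega>)) * (y \<bullet> (B *v c 1 \<omega>))) = T (\<sigma>\<^sup>2 *\<^sub>R mat 1)"
    using integral_bounded_linear[OF T int] by (simp only: E)
  then show ?thesis by (simp add: T_def matrix_scaleR_left matrix_scaleR_right flip: scaleR_matrix_vector_assoc)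
qed

lemma second_moment_nth: "expectation (\<lambda>\<omega>. (A *v c 1 \<omega>) $ j * (B *v c 1 \<omega>) $ k) = \<sigma>\<^sup>2 * (A ** transpose B) $ j $ k"
  using second_moment[of "axis j 1" A "axis k 1" B]
  by (simp add: inner_axis' matrix_vector_mult_basis column_def)

text \<open>Hypothesis \<open>third\<close> concerns coordinates; it extends to linear forms by trilinearity.\<close>
lemma third_moment: "expectation (\<lambda>\<omega>. (x \<bullet> c 1 \<omega>) * (y \<bullet> c 1 \<omega>) * (z \<bullet> c 1 \<omega>)) = 0"
proof -
  have int: "integrable M (\<lambda>\<omega>. c 1 \<omega> $ p * c 1 \<omega> $ q * c 1 \<omega> $ r)" for p q r
    using growth_integrable[OF growth_mult[OF growth_mult[OF growth_nth_mult[of "mat 1" p] growth_nth_mult[of "mat 1" q]]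
      growth_nth_mult[of "mat 1" r]]] by simp
  have "(x \<bullet> u) * (y \<bullet> u) * (z \<bullet> u) = (\<Sum>p\<in>UNIV. \<Sum>q\<in>UNIV. \<Sum>r\<in>UNIV. x $ p * y $ q * z $ r * (u $ p * u $ q * u $ r))" for u
  proof -
    have xy: "(x \<bullet> u) * (y \<bullet> u) = (\<Sum>p\<in>UNIV. \<Sum>q\<in>UNIV. (x $ p * u $ p) * (y $ q * u $ q))"
      by (simp only: inner_vec_def inner_real_def sum_product)
    show ?thesis
      unfolding xy inner_vec_def[of z u] inner_real_def sum_distrib_right
      unfolding sum_distrib_left by (intro sum.cong refl) (simp add: mult_ac)
  qed
  then have "expectation (\<lambda>\<omega>. (x \<bullet> c 1 \<omega>) * (y \<bullet> c 1 \<omega>) * (z \<bullet> c 1 \<omega>)) =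
      (\<Sum>p\<in>UNIV. \<Sum>q\<in>UNIV. \<Sum>r\<in>UNIV. expectation (\<lambda>\<omega>. x $ p * y $ q * z $ r * (c 1 \<omega> $ p * c 1 \<omega> $ q * c 1 \<omega> $ r)))"
    using int by (simp only: Bochner_Integration.integral_sum Bochner_Integration.integrable_sum integrable_mult_right)
  then show ?thesis by (simp add: third del: One_nat_def)
qed

text \<open>The error vector \<open>c\<^sub>i\<close> enters only through linear images. \<open>Pm c\<^sub>i\<close> and \<open>Qm c\<^sub>i\<close> are the errors of \<open>a\<^sub>i\<close> and
  \<open>b\<^sub>i\<close>, \<open>Rm c\<^sub>i\<close> is the residual \<open>\<rho>\<^sub>i\<close> at \<open>X\<^sub>0\<close>, and \<open>Bm c\<^sub>i\<close> is the part of the error of \<open>a\<^sub>i\<close> that is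
  uncorrelated with \<open>\<rho>\<^sub>i\<close> (see \<open>Bm_Rm\<close>). Second moments of such images are products of these matrices.\<close>
definition Pm :: "real^('n + 'd)^'n" where "Pm = (\<chi> j p. if p = Inl j then 1 else 0)"
definition Qm :: "real^('n + 'd)^'d" where "Qm = (\<chi> k p. if p = Inr k then 1 else 0)"
definition Rm :: "real^('n + 'd)^'d" where "Rm = transpose X0 ** Pm - Qm"
definition Bm :: "real^('n + 'd)^'n" where "Bm = Pm - X0 ** matrix_inv (gram X0) ** Rm"

lemma Pm_mult: "Pm *v x = (\<chi> j. x $ Inl j)"
  by (simp add: vec_eq_iff Pm_def matrix_vector_mult_def if_distrib[of "\<lambda>u. u * _"] cong: if_cong)

lemma Qm_mult: "Qm *v x = (\<chi> k. x $ Inr k)"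
  by (simp add: vec_eq_iff Qm_def matrix_vector_mult_def if_distrib[of "\<lambda>u. u * _"] cong: if_cong)

lemma selection_products:
  "Pm ** transpose Pm = mat 1" "Pm ** transpose Qm = 0" "Qm ** transpose Pm = 0" "Qm ** transpose Qm = mat 1"
  by (simp_all add: vec_eq_iff Pm_def Qm_def matrix_matrix_mult_def transpose_def mat_def
      if_distrib[of "\<lambda>u. u * _"] cong: if_cong)

lemma Pm_Rm: "Pm ** transpose Rm = X0"
  by (simp add: Rm_def transpose_diff matrix_transpose_mul matrix_diff_ldistrib matrix_mul_assoc selection_products)

lemma Rm_Rm: "Rm ** transpose Rm = gram X0"
proof -
  have "Rm ** transpose Rm = transpose X0 ** (Pm ** transpose Rm) - Qm ** transpose Rm"
    by (simp add: Rm_def[of] matrix_diff_rdistrib matrix_mul_assoc)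
  also have "Qm ** transpose Rm = - mat 1"
    by (simp add: Rm_def transpose_diff matrix_transpose_mul matrix_diff_ldistrib matrix_mul_assoc selection_products
        bounded_bilinear.zero_left[OF bounded_bilinear_matrix_mult])
  finally show ?thesis by (simp add: Pm_Rm gram_def add.commute)
qed

lemma Bm_Rm: "Bm ** transpose Rm = 0"
  by (simp add: Bm_def matrix_diff_rdistrib Pm_Rm matrix_inv_mult pos_def_invertible pos_def_gram Rm_Rm
      flip: matrix_mul_assoc)

definition aobs :: "nat \<Rightarrow> 'w \<Rightarrow> real^'n" where "aobs i \<omega> = a0 i + Pm *v c i \<omega>"
definition bobs :: "nat \<Rightarrow> 'w \<Rightarrow> real^'d" where "bobs i \<omega> = transpose X0 *v a0 i + Qm *v c i \<omega>"

definition kap :: "real^('n + 'd) \<Rightarrow> real" where "kap x = w \<bullet> (Bm *v x)"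

lemma resid_obs: "resid X0 (aobs i \<omega>) (bobs i \<omega>) = Rm *v c i \<omega>"
  by (simp add: resid_def aobs_def bobs_def Rm_def matrix_vector_right_distrib matrix_vector_mult_diff_rdistrib
      matrix_vector_mul_assoc)

lemma est_fun_obs: "est_fun (aobs i \<omega>) (bobs i \<omega>) X0 = outer (a0 i + Bm *v c i \<omega>) (Rm *v c i \<omega>)"
  unfolding est_fun_eq resid_obs
  by (simp add: aobs_def Bm_def matrix_vector_mult_diff_rdistrib matrix_vector_mul_assoc matrix_mul_assoc
      algebra_simps)

lemma est_fun_obs_w: "transpose (est_fun (aobs i \<omega>) (bobs i \<omega>) X0) *v w = (w \<bullet> a0 i + kap (c i \<omega>)) *\<^sub>R (Rm *v c i \<omega>)"
  by (simp add: est_fun_obs transpose_outer outer_mult_vec kap_def inner_add_left inner_add_right inner_commute)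

lemma growth_kap: "growth 1 kap"
  unfolding kap_def[abs_def] by (rule growth_inner_mult)

lemma kap_rho_rho: "expectation (\<lambda>\<omega>. kap (c 1 \<omega>) * ((x \<bullet> (Rm *v c 1 \<omega>)) * (y \<bullet> (Rm *v c 1 \<omega>)))) = 0"
  using third_moment[of "transpose Bm *v w" "transpose Rm *v x" "transpose Rm *v y"]
  by (simp add: kap_def mult.assoc inner_transpose inner_commute)

lemma kap_rho: "expectation (\<lambda>\<omega>. kap (c 1 \<omega>) * (x \<bullet> (Rm *v c 1 \<omega>))) = 0"
  unfolding kap_def second_moment Bm_Rm by simp

definition Km :: "real^'d^'d" where
  "Km = (\<integral>\<omega>. (kap (c 1 \<omega>))\<^sup>2 *\<^sub>R outer (Rm *v c 1 \<omega>) (Rm *v c 1 \<omega>) \<partial>M)"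

lemma kap_sq_rho_rho: "expectation (\<lambda>\<omega>. (kap (c 1 \<omega>))\<^sup>2 * ((x \<bullet> (Rm *v c 1 \<omega>)) * (y \<bullet> (Rm *v c 1 \<omega>)))) = x \<bullet> (Km *v y)"
proof -
  have [measurable]: "c 1 \<in> borel_measurable M" by (rule c_measurable) simp
  have [measurable]: "kap \<in> borel_measurable borel" by (rule growth_measurable[OF growth_kap])
  have "integrable M (\<lambda>\<omega>. norm ((kap (c 1 \<omega>))\<^sup>2 *\<^sub>R outer (Rm *v c 1 \<omega>) (Rm *v c 1 \<omega>)))"
    using growth_integrable[OF growth_mult[OF growth_power[OF growth_kap, of 2] growth_power[OF growth_norm_mult, of 2 Rm]]]
    by (simp add: norm_outer power2_eq_square)
  moreover have "(\<lambda>\<omega>. (kap (c 1 \<omega>))\<^sup>2 *\<^sub>R outer (Rm *v c 1 \<omega>) (Rm *v c 1 \<omega>)) \<in> borel_measurable M" by measurable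
  ultimately have int: "integrable M (\<lambda>\<omega>. (kap (c 1 \<omega>))\<^sup>2 *\<^sub>R outer (Rm *v c 1 \<omega>) (Rm *v c 1 \<omega>))"
    by (simp only: integrable_norm_iff)
  have T: "bounded_linear (\<lambda>Z. x \<bullet> (Z *v y))"
    by (intro bounded_linear_compose[OF bounded_linear_inner_right]
        bounded_bilinear.bounded_linear_left[OF bounded_bilinear_matrix_vector_mult])
  have "(kap z)\<^sup>2 * ((x \<bullet> (Rm *v z)) * (y \<bullet> (Rm *v z))) = x \<bullet> (((kap z)\<^sup>2 *\<^sub>R outer (Rm *v z) (Rm *v z)) *v y)" for z
    by (simp add: outer_mult_vec inner_commute flip: scaleR_matrix_vector_assoc)
  then show ?thesis using integral_bounded_linear[OF T int] by (simp only: Km_def)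
qed

lemma Km_sym: "transpose Km = Km"
proof -
  have "x \<bullet> (Km *v y) = y \<bullet> (Km *v x)" for x y
    unfolding kap_sq_rho_rho[symmetric] by (simp add: mult.commute)
  from this[of "axis _ 1" "axis _ 1"] show ?thesis
    by (simp add: vec_eq_iff transpose_def inner_axis' matrix_vector_mult_basis column_def)
qed

lemma Km_nonneg: "0 \<le> x \<bullet> (Km *v x)"
  unfolding kap_sq_rho_rho[symmetric] by (intro Bochner_Integration.integral_nonneg) simp

text \<open>\<open>Sinf\<close> is the limit of the estimated matrix \<open>S_hat\<close>, \<open>\<Sigma>T\<close> that of \<open>Sigma_T_hat\<close> and of the average
  covariance of the score vectors.\<close>
definition Sinf :: "real^'d^'d" where "Sinf = (\<sigma>\<^sup>2 * (\<mu>a \<bullet> w)) *\<^sub>R gram X0 + Km"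
definition \<Sigma>T :: "real^'d^'d" where "\<Sigma>T = (\<sigma>\<^sup>2 * (1 - 2 * (\<mu>a \<bullet> w))) *\<^sub>R gram X0 + Sinf"

lemma \<Sigma>T_eq: "\<Sigma>T = (\<sigma>\<^sup>2 * (1 - \<mu>a \<bullet> w)) *\<^sub>R gram X0 + Km"
proof -
  have "\<sigma>\<^sup>2 * (1 - 2 * (\<mu>a \<bullet> w)) + \<sigma>\<^sup>2 * (\<mu>a \<bullet> w) = \<sigma>\<^sup>2 * (1 - \<mu>a \<bullet> w)"
    by (simp add: algebra_simps)
  then show ?thesis
    by (simp add: \<Sigma>T_def Sinf_def add.assoc[symmetric] scaleR_left_distrib[symmetric])
qed

lemma pos_def_\<Sigma>T: "pos_def \<Sigma>T"
proof -
  have "0 < \<sigma>\<^sup>2 * (1 - \<mu>a \<bullet> w)" using sigma mu_w_less_1 by simp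
  then have "0 < x \<bullet> (\<Sigma>T *v x)" if "x \<noteq> 0" for x
    using pos_def_pos[OF pos_def_gram that, of X0] Km_nonneg[of x]
    by (simp add: \<Sigma>T_eq matrix_vector_mult_add_rdistrib inner_add_right add_pos_nonneg flip: scaleR_matrix_vector_assoc)
  then show ?thesis by (simp add: pos_def_def \<Sigma>T_eq transpose_add transpose_scalar gram_sym Km_sym)
qed

section \<open>The model: limits of averages\<close>

definition averages_to :: "(nat \<Rightarrow> real^('n + 'd) \<Rightarrow> 'v::{banach, second_countable_topology}) \<Rightarrow> 'v \<Rightarrow> bool" where
  "averages_to f l \<longleftrightarrow> L1_null (\<lambda>m \<omega>. avg m (\<lambda>i. f i (c i \<omega>)) - l)"

lemma averages_to_add: "averages_to f l \<Longrightarrow> averages_to g k \<Longrightarrow> averages_to (\<lambda>i x. f i x + g i x) (l + k)"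
  using L1_null_add[of "\<lambda>m \<omega>. avg m (\<lambda>i. f i (c i \<omega>)) - l" "\<lambda>m \<omega>. avg m (\<lambda>i. g i (c i \<omega>)) - k"]
  by (simp add: averages_to_def avg_add algebra_simps)

lemma averages_to_vec:
  fixes f :: "nat \<Rightarrow> real^('n + 'd) \<Rightarrow> 'v::euclidean_space^'k"
  assumes "\<And>j. averages_to (\<lambda>i x. f i x $ j) (l $ j)"
  shows "averages_to f l"
  using assms unfolding averages_to_def by (intro L1_null_vec) (simp add: avg_nth)

lemma averages_to_mult:
  assumes g: "growth d g" "d \<le> 4" and \<alpha>: "\<And>i. \<bar>\<alpha> i\<bar> \<le> K * (1 + (norm (a0 i))\<^sup>2)"
    and lim: "(\<lambda>m. avg m \<alpha>) \<longlonglongrightarrow> A"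
    and e: "expectation (\<lambda>\<omega>. g (c 1 \<omega>)) = e"
  shows "averages_to (\<lambda>i x. \<alpha> i * g x) (A * e)"
proof -
  have "L1_null (\<lambda>m \<omega>. avg m (\<lambda>i. \<alpha> i * (g (c i \<omega>) - e)))"
    unfolding L1_null_def
  proof (intro conjI allI)
    show "integrable M (\<lambda>\<omega>. avg m (\<lambda>i. \<alpha> i * (g (c i \<omega>) - e)))" for m
      using growth_ident(1)[OF g] by (intro integrable_avg integrable_mult_right Bochner_Integration.integrable_diff) auto
    show "(\<lambda>m. expectation (\<lambda>\<omega>. norm (avg m (\<lambda>i. \<alpha> i * (g (c i \<omega>) - e))))) \<longlonglongrightarrow> 0"
      using weighted_lln[OF growth_measurable[OF g(1)] growth_integrable[OF g] weights[OF \<alpha>]] unfolding e by simp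
  qed
  moreover have "L1_null (\<lambda>m \<omega>. e * (avg m \<alpha> - A))"
  proof (rule L1_null_const)
    have "(\<lambda>m. e * (avg m \<alpha> - A)) \<longlonglongrightarrow> e * (A - A)" by (intro tendsto_intros lim)
    then show "(\<lambda>m. e * (avg m \<alpha> - A)) \<longlonglongrightarrow> 0" by simp
  qed
  ultimately have "L1_null (\<lambda>m \<omega>. avg m (\<lambda>i. \<alpha> i * (g (c i \<omega>) - e)) + e * (avg m \<alpha> - A))" by (rule L1_null_add)
  moreover have "avg m (\<lambda>i. \<alpha> i * (g (c i \<omega>) - e)) + e * (avg m \<alpha> - A) = avg m (\<lambda>i. \<alpha> i * g (c i \<omega>)) - A * e" for m \<omega>
    using avg_mult_left[of m e \<alpha>] by (simp add: right_diff_distrib avg_diff mult.commute)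
  ultimately show ?thesis by (simp add: averages_to_def)
qed

lemma avg_one: "(\<lambda>m. avg m (\<lambda>i. 1::real)) \<longlonglongrightarrow> 1"
  by (rule tendsto_eventually) (auto intro!: eventually_sequentiallyI[of 1] simp: avg_def)

lemma averages_to_iid:
  assumes "growth d g" "d \<le> 4" "expectation (\<lambda>\<omega>. g (c 1 \<omega>)) = e"
  shows "averages_to (\<lambda>i x. g x) e"
  using averages_to_mult[OF assms(1,2) _ avg_one assms(3), of 1] by simp

lemma weight_nth: "\<bar>a0 i $ j\<bar> \<le> 1 * (1 + (norm (a0 i))\<^sup>2)"
proof -
  have "\<bar>a0 i $ j\<bar> \<le> norm (a0 i)" by (rule component_le_norm_cart)
  also have "\<dots> \<le> 1 + (norm (a0 i))\<^sup>2" using sum_squares_bound[of 1 "norm (a0 i)"] by simp (smt (verit) norm_ge_zero)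
  finally show ?thesis by simp
qed

lemma weight_inner: "\<bar>x \<bullet> a0 i\<bar> \<le> norm x * (1 + (norm (a0 i))\<^sup>2)"
proof -
  have "\<bar>x \<bullet> a0 i\<bar> \<le> norm x * norm (a0 i)" by (rule Cauchy_Schwarz_ineq2)
  also have "\<dots> \<le> norm x * (1 + (norm (a0 i))\<^sup>2)"
    using sum_squares_bound[of 1 "norm (a0 i)"] by (intro mult_left_mono) (auto, smt (verit) norm_ge_zero)
  finally show ?thesis .
qed

lemma weight_inner_inner: "\<bar>(x \<bullet> a0 i) * (y \<bullet> a0 i)\<bar> \<le> (norm x * norm y) * (1 + (norm (a0 i))\<^sup>2)"
proof -
  have "\<bar>(x \<bullet> a0 i) * (y \<bullet> a0 i)\<bar> \<le> (norm x * norm (a0 i)) * (norm y * norm (a0 i))"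
    unfolding abs_mult by (intro mult_mono Cauchy_Schwarz_ineq2) auto
  also have "\<dots> = (norm x * norm y) * (norm (a0 i))\<^sup>2" by (simp add: power2_eq_square)
  also have "\<dots> \<le> (norm x * norm y) * (1 + (norm (a0 i))\<^sup>2)" by (intro mult_left_mono) auto
  finally show ?thesis .
qed

end

lemma axis_quadratic: "axis j 1 \<bullet> (A *v axis k 1) = A $ j $ k" for A :: "real^'n^'m"
  by (simp add: inner_axis' matrix_vector_mult_basis column_def)

lemma norm_add_pow4_le: "norm (x + y) ^ 4 \<le> 8 * norm x ^ 4 + 8 * norm y ^ 4"
  for x y :: "'a::real_normed_vector"
proof -
  have "norm (x + y) ^ 4 = ((norm (x + y))\<^sup>2)\<^sup>2" by (simp flip: power_mult)
  also have "\<dots> \<le> (2 * (norm x)\<^sup>2 + 2 * (norm y)\<^sup>2)\<^sup>2" by (intro power_mono norm_sq_add_le) auto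
  also have "\<dots> \<le> 8 * ((norm x)\<^sup>2)\<^sup>2 + 8 * ((norm y)\<^sup>2)\<^sup>2"
    using sum_squares_bound[of "(norm x)\<^sup>2" "(norm y)\<^sup>2"] by (simp add: power2_sum power_mult_distrib)
  finally show ?thesis by (simp flip: power_mult)
qed

context iid_vectors begin

lemma expectation_norm_avg_sq:
  fixes f :: "nat \<Rightarrow> 'c \<Rightarrow> 'v::euclidean_space"
  assumes f [measurable]: "\<And>i. f i \<in> borel_measurable borel"
    and sq: "\<And>i. 1 \<le> i \<Longrightarrow> integrable M (\<lambda>\<omega>. (norm (f i (c i \<omega>)))\<^sup>2)"
    and zero: "\<And>i b. 1 \<le> i \<Longrightarrow> b \<in> Basis \<Longrightarrow> expectation (\<lambda>\<omega>. f i (c i \<omega>) \<bullet> b) = 0"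
  shows "integrable M (\<lambda>\<omega>. m * (norm (avg m (\<lambda>i. f i (c i \<omega>))))\<^sup>2)"
    and "expectation (\<lambda>\<omega>. m * (norm (avg m (\<lambda>i. f i (c i \<omega>))))\<^sup>2) = avg m (\<lambda>i. expectation (\<lambda>\<omega>. (norm (f i (c i \<omega>)))\<^sup>2))"
proof -
  note [measurable] = c_measurable
  have norm_sq: "(norm x)\<^sup>2 = (\<Sum>b\<in>Basis. (x \<bullet> b)\<^sup>2)" for x :: 'v
    unfolding power2_norm_eq_inner by (subst euclidean_inner) (simp add: power2_eq_square)
  have sqb: "integrable M (\<lambda>\<omega>. (f i (c i \<omega>) \<bullet> b)\<^sup>2)" if "1 \<le> i" "b \<in> Basis" for i b
  proof (rule Bochner_Integration.integrable_bound[OF sq[OF that(1)]])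
    show "(\<lambda>\<omega>. (f i (c i \<omega>) \<bullet> b)\<^sup>2) \<in> borel_measurable M" using that by measurable
    have "(x \<bullet> b)\<^sup>2 \<le> (norm x)\<^sup>2" for x :: 'v
      using that(2) Basis_le_norm[of b x] by (metis abs_ge_zero power2_abs power_mono)
    then show "AE \<omega> in M. norm ((f i (c i \<omega>) \<bullet> b)\<^sup>2) \<le> norm ((norm (f i (c i \<omega>)))\<^sup>2)" by simp
  qed
  have eq: "m * (norm (avg m (\<lambda>i. f i (c i \<omega>))))\<^sup>2 = (1 / real m) * (\<Sum>b\<in>Basis. (\<Sum>i=1..m. f i (c i \<omega>) \<bullet> b)\<^sup>2)" for \<omega>
    unfolding norm_sq
    by (simp add: avg_def inner_sum_left power_divide sum_divide_distrib[symmetric] power2_eq_square[of "real m"])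
  have meas: "(\<lambda>x. f i x \<bullet> b) \<in> borel_measurable borel" for i b by measurable
  have s1: "integrable M (\<lambda>\<omega>. (\<Sum>i=1..m. f i (c i \<omega>) \<bullet> b)\<^sup>2)" if "b \<in> Basis" for b
    using expectation_sum_sq(1)[of "\<lambda>i x. f i x \<bullet> b", OF meas] sqb zero that by blast
  have s2: "expectation (\<lambda>\<omega>. (\<Sum>i=1..m. f i (c i \<omega>) \<bullet> b)\<^sup>2) = (\<Sum>i=1..m. expectation (\<lambda>\<omega>. (f i (c i \<omega>) \<bullet> b)\<^sup>2))"
    if "b \<in> Basis" for b
    using expectation_sum_sq(2)[of "\<lambda>i x. f i x \<bullet> b", OF meas] sqb zero that by blast
  show "integrable M (\<lambda>\<omega>. m * (norm (avg m (\<lambda>i. f i (c i \<omega>))))\<^sup>2)"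
    unfolding eq by (intro integrable_mult_right Bochner_Integration.integrable_sum s1)
  have "expectation (\<lambda>\<omega>. m * (norm (avg m (\<lambda>i. f i (c i \<omega>))))\<^sup>2) =
      (1 / real m) * (\<Sum>b\<in>Basis. \<Sum>i=1..m. expectation (\<lambda>\<omega>. (f i (c i \<omega>) \<bullet> b)\<^sup>2))"
    unfolding eq using s1 s2 by (simp add: Bochner_Integration.integral_sum)
  also have "(\<Sum>b\<in>Basis. \<Sum>i=1..m. expectation (\<lambda>\<omega>. (f i (c i \<omega>) \<bullet> b)\<^sup>2)) =
      (\<Sum>i=1..m. expectation (\<lambda>\<omega>. (norm (f i (c i \<omega>)))\<^sup>2))"
    unfolding norm_sq using sqb
    by (subst sum.swap) (intro sum.cong refl, simp add: Bochner_Integration.integral_sum)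
  finally show "expectation (\<lambda>\<omega>. m * (norm (avg m (\<lambda>i. f i (c i \<omega>))))\<^sup>2) = avg m (\<lambda>i. expectation (\<lambda>\<omega>. (norm (f i (c i \<omega>)))\<^sup>2))"
    by (simp add: avg_def)
qed

end

context eiv_model begin

lemma avg_a0_nth: "(\<lambda>m. avg m (\<lambda>i. a0 i $ j)) \<longlonglongrightarrow> \<mu>a $ j"
  unfolding avg_nth[symmetric] by (intro tendsto_intros lim_mean)

lemma avg_a0_nth_nth: "(\<lambda>m. avg m (\<lambda>i. a0 i $ j * a0 i $ k)) \<longlonglongrightarrow> V $ j $ k"
  using avg_a0_quadratic[of "axis j 1" "axis k 1"] unfolding axis_quadratic by (simp add: inner_axis')

lemma avg_a0_inner: "(\<lambda>m. avg m (\<lambda>i. x \<bullet> a0 i)) \<longlonglongrightarrow> x \<bullet> \<mu>a"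
proof -
  have "avg m (\<lambda>i. x \<bullet> a0 i) = x \<bullet> avg m a0" for m
    by (rule avg_linear[symmetric]) (rule bounded_linear.linear[OF bounded_linear_inner_right])
  then show ?thesis by (simp only:) (intro tendsto_intros lim_mean)
qed

lemma weight_nth_nth: "\<bar>a0 i $ j * a0 i $ k\<bar> \<le> 1 * (1 + (norm (a0 i))\<^sup>2)"
  using weight_inner_inner[of "axis j 1" i "axis k 1"] by (simp add: inner_axis')

lemma first_moment_nth: "expectation (\<lambda>\<omega>. (A *v c 1 \<omega>) $ k) = 0"
  using first_moment[of "axis k 1" A] by (simp add: inner_axis')

lemma growth_nth_nth: "growth 2 (\<lambda>x. (A *v x) $ j * (B *v x) $ k)" for A :: "real^'k^'l" and B :: "real^'k^'m"
  using growth_mult[OF growth_nth_mult growth_nth_mult] by (simp add: numeral_2_eq_2)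

lemma averages_aa: "averages_to (\<lambda>i x. outer (a0 i + Pm *v x) (a0 i + Pm *v x)) (V + \<sigma>\<^sup>2 *\<^sub>R mat 1)"
proof (intro averages_to_vec)
  fix j k
  have "averages_to (\<lambda>i x. (a0 i $ j * a0 i $ k) * 1 + a0 i $ j * (Pm *v x) $ k + a0 i $ k * (Pm *v x) $ j
      + (Pm *v x) $ j * (Pm *v x) $ k)
    (V $ j $ k * 1 + \<mu>a $ j * 0 + \<mu>a $ k * 0 + \<sigma>\<^sup>2 * (Pm ** transpose Pm) $ j $ k)"
    by (intro averages_to_add averages_to_mult[OF growth_const _ weight_nth_nth avg_a0_nth_nth]
        averages_to_mult[OF growth_nth_mult _ weight_nth avg_a0_nth first_moment_nth]
        averages_to_iid[OF growth_nth_nth _ second_moment_nth]) (simp_all add: prob_space)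
  then show "averages_to (\<lambda>i x. outer (a0 i + Pm *v x) (a0 i + Pm *v x) $ j $ k) ((V + \<sigma>\<^sup>2 *\<^sub>R mat 1) $ j $ k)"
    by (simp add: outer_def selection_products algebra_simps)
qed

lemma averages_ar: "averages_to (\<lambda>i x. outer (a0 i + Pm *v x) (Rm *v x)) (\<sigma>\<^sup>2 *\<^sub>R X0)"
proof (intro averages_to_vec)
  fix j k
  have "averages_to (\<lambda>i x. a0 i $ j * (Rm *v x) $ k + (Pm *v x) $ j * (Rm *v x) $ k)
    (\<mu>a $ j * 0 + \<sigma>\<^sup>2 * (Pm ** transpose Rm) $ j $ k)"
    by (intro averages_to_add averages_to_mult[OF growth_nth_mult _ weight_nth avg_a0_nth first_moment_nth]
        averages_to_iid[OF growth_nth_nth _ second_moment_nth]) simp_all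
  then show "averages_to (\<lambda>i x. outer (a0 i + Pm *v x) (Rm *v x) $ j $ k) ((\<sigma>\<^sup>2 *\<^sub>R X0) $ j $ k)"
    by (simp add: outer_def Pm_Rm algebra_simps)
qed

lemma averages_rr: "averages_to (\<lambda>i x. outer (Rm *v x) (Rm *v x)) (\<sigma>\<^sup>2 *\<^sub>R gram X0)"
proof (intro averages_to_vec)
  fix j k
  have "averages_to (\<lambda>i x. (Rm *v x) $ j * (Rm *v x) $ k) (\<sigma>\<^sup>2 * (Rm ** transpose Rm) $ j $ k)"
    by (intro averages_to_iid[OF growth_nth_nth _ second_moment_nth]) simp
  then show "averages_to (\<lambda>i x. outer (Rm *v x) (Rm *v x) $ j $ k) ((\<sigma>\<^sup>2 *\<^sub>R gram X0) $ j $ k)"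
    by (simp add: outer_def Rm_Rm)
qed

lemma averages_a: "averages_to (\<lambda>i x. a0 i + Pm *v x) \<mu>a"
proof (intro averages_to_vec)
  fix j
  have "averages_to (\<lambda>i x. a0 i $ j * 1 + (Pm *v x) $ j) (\<mu>a $ j * 1 + 0)"
    by (intro averages_to_add averages_to_mult[OF growth_const _ weight_nth avg_a0_nth]
        averages_to_iid[OF growth_nth_mult _ first_moment_nth]) (simp_all add: prob_space)
  then show "averages_to (\<lambda>i x. (a0 i + Pm *v x) $ j) (\<mu>a $ j)" by simp
qed

lemma growth_rr: "growth 2 (\<lambda>x. (y \<bullet> (Rm *v x)) * (z \<bullet> (Rm *v x)))"
  using growth_mult[OF growth_inner_mult growth_inner_mult] by (simp add: numeral_2_eq_2)

lemma growth_krr: "growth 3 (\<lambda>x. kap x * ((y \<bullet> (Rm *v x)) * (z \<bullet> (Rm *v x))))"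
  using growth_mult[OF growth_kap growth_rr] by (simp add: numeral_3_eq_3)

lemma growth_kkrr: "growth 4 (\<lambda>x. (kap x)\<^sup>2 * ((y \<bullet> (Rm *v x)) * (z \<bullet> (Rm *v x))))"
  using growth_mult[OF growth_power[OF growth_kap, of 2] growth_rr[of y z]] by simp

lemma w_V_w: "w \<bullet> (V *v w) = \<mu>a \<bullet> w"
  by (simp add: V_w inner_commute)

text \<open>Expanding the square of \<open>w\<^sup>T a\<^sup>0\<^sub>i + \<kappa>\<^sub>i\<close>, the mixed term has mean zero since third moments vanish.
  It need not be square integrable under the moment hypothesis, so a law of large numbers in \<open>L\<^sup>1\<close> is needed here.\<close>
lemma averages_qq:
  "averages_to (\<lambda>i x. outer ((w \<bullet> a0 i + kap x) *\<^sub>R (Rm *v x)) ((w \<bullet> a0 i + kap x) *\<^sub>R (Rm *v x))) Sinf"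
proof (intro averages_to_vec)
  fix j k
  let ?y = "axis j 1 :: real^'d" and ?z = "axis k 1 :: real^'d"
  let ?rr = "\<lambda>x. (?y \<bullet> (Rm *v x)) * (?z \<bullet> (Rm *v x))"
  have w2: "\<bar>2 * (w \<bullet> a0 i)\<bar> \<le> (2 * norm w) * (1 + (norm (a0 i))\<^sup>2)" for i
    using weight_inner[of w i] by simp
  have lim2: "(\<lambda>m. avg m (\<lambda>i. 2 * (w \<bullet> a0 i))) \<longlonglongrightarrow> 2 * (w \<bullet> \<mu>a)"
    unfolding avg_mult_left by (intro tendsto_intros avg_a0_inner)
  have "averages_to (\<lambda>i x. ((w \<bullet> a0 i) * (w \<bullet> a0 i)) * ?rr x + (2 * (w \<bullet> a0 i)) * (kap x * ?rr x) + (kap x)\<^sup>2 * ?rr x)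
     (w \<bullet> (V *v w) * (\<sigma>\<^sup>2 * (?y \<bullet> ((Rm ** transpose Rm) *v ?z))) + 2 * (w \<bullet> \<mu>a) * 0 + ?y \<bullet> (Km *v ?z))"
    by (intro averages_to_add averages_to_mult[OF growth_rr _ weight_inner_inner avg_a0_quadratic second_moment]
        averages_to_mult[OF growth_krr _ w2 lim2 kap_rho_rho] averages_to_iid[OF growth_kkrr _ kap_sq_rho_rho]) simp_all
  moreover have "((w \<bullet> a0 i) * (w \<bullet> a0 i)) * ?rr x + (2 * (w \<bullet> a0 i)) * (kap x * ?rr x) + (kap x)\<^sup>2 * ?rr x =
      outer ((w \<bullet> a0 i + kap x) *\<^sub>R (Rm *v x)) ((w \<bullet> a0 i + kap x) *\<^sub>R (Rm *v x)) $ j $ k" for i x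
    by (simp add: outer_def inner_axis' power2_eq_square algebra_simps)
  moreover have "w \<bullet> (V *v w) * (\<sigma>\<^sup>2 * (?y \<bullet> ((Rm ** transpose Rm) *v ?z))) + 2 * (w \<bullet> \<mu>a) * 0 + ?y \<bullet> (Km *v ?z)
      = Sinf $ j $ k"
    by (simp add: w_V_w Rm_Rm axis_quadratic Sinf_def)
  ultimately show "averages_to (\<lambda>i x. outer ((w \<bullet> a0 i + kap x) *\<^sub>R (Rm *v x)) ((w \<bullet> a0 i + kap x) *\<^sub>R (Rm *v x)) $ j $ k) (Sinf $ j $ k)"
    by simp
qed

lemma aobs_pow4_null: "L1_null (\<lambda>m \<omega>. avg m (\<lambda>i. norm (aobs i \<omega>) ^ 4) / m)"
proof -
  define e where "e = expectation (\<lambda>\<omega>. norm (Pm *v c 1 \<omega>) ^ 4)"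
  have g: "growth 4 (\<lambda>x. norm (Pm *v x) ^ 4)" using growth_power[OF growth_norm_mult, of 4 Pm] by simp
  note [measurable] = c_measurable
  have meas: "(\<lambda>\<omega>. norm (Pm *v c i \<omega>) ^ 4) \<in> borel_measurable M" if "1 \<le> i" for i using that by measurable
  have e_nonneg: "0 \<le> e" by (simp add: e_def)
  have 1: "L1_null (\<lambda>m \<omega>. avg m (\<lambda>i. norm (Pm *v c i \<omega>) ^ 4) / m)"
  proof (rule L1_null_bound)
    show "(\<lambda>\<omega>. avg m (\<lambda>i. norm (Pm *v c i \<omega>) ^ 4) / m) \<in> borel_measurable M" for m
      by (intro borel_measurable_divide borel_measurable_avg meas) auto
    have "averages_to (\<lambda>i x. norm (Pm *v x) ^ 4) e" by (rule averages_to_iid[OF g]) (simp_all add: e_def)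
    then have "L1_null (\<lambda>m \<omega>. avg m (\<lambda>i. norm (Pm *v c i \<omega>) ^ 4) - e)" by (simp add: averages_to_def)
    moreover have "L1_null (\<lambda>m \<omega>. e * (1 / real m))"
      by (rule L1_null_const) (use tendsto_mult_left[OF lim_1_over_n, of e] in simp)
    ultimately show "L1_null (\<lambda>m \<omega>. norm (avg m (\<lambda>i. norm (Pm *v c i \<omega>) ^ 4) - e) + e * (1 / real m))"
      by (intro L1_null_add L1_null_norm)
    fix m \<omega>
    define x where "x = avg m (\<lambda>i. norm (Pm *v c i \<omega>) ^ 4)"
    show "norm (avg m (\<lambda>i. norm (Pm *v c i \<omega>) ^ 4) / m) \<le> norm (norm (avg m (\<lambda>i. norm (Pm *v c i \<omega>) ^ 4) - e) + e * (1 / real m))"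
      unfolding x_def[symmetric]
    proof (cases "m = 0")
      case False
      then have m: "1 \<le> real m" by simp
      have "\<bar>x - e\<bar> / m \<le> \<bar>x - e\<bar> / 1" using m by (intro divide_left_mono) auto
      moreover have "\<bar>x\<bar> / m \<le> (\<bar>x - e\<bar> + e) / m" using e_nonneg by (intro divide_right_mono) auto
      ultimately show "norm (x / m) \<le> norm (norm (x - e) + e * (1 / real m))"
        using m e_nonneg by (simp add: add_divide_distrib)
    qed simp
  qed
  have 2: "L1_null (\<lambda>m \<omega>. avg m (\<lambda>i. norm (a0 i) ^ 4) / m)" by (rule L1_null_const[OF avg_a0_pow4])
  show ?thesis
  proof (rule L1_null_bound)
    show "(\<lambda>\<omega>. avg m (\<lambda>i. norm (aobs i \<omega>) ^ 4) / m) \<in> borel_measurable M" for m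
      unfolding aobs_def by (intro borel_measurable_divide borel_measurable_avg borel_measurable_const) measurable
    show "L1_null (\<lambda>m \<omega>. 8 * (avg m (\<lambda>i. norm (a0 i) ^ 4) / m) + 8 * (avg m (\<lambda>i. norm (Pm *v c i \<omega>) ^ 4) / m))"
      by (intro L1_null_add L1_null_cmult 1 2)
    fix m \<omega>
    have "avg m (\<lambda>i. norm (aobs i \<omega>) ^ 4) \<le> 8 * avg m (\<lambda>i. norm (a0 i) ^ 4) + 8 * avg m (\<lambda>i. norm (Pm *v c i \<omega>) ^ 4)"
      unfolding avg_mult_left[symmetric] avg_add[symmetric] aobs_def by (intro avg_mono norm_add_pow4_le)
    then have "avg m (\<lambda>i. norm (aobs i \<omega>) ^ 4) / m \<le>
        (8 * avg m (\<lambda>i. norm (a0 i) ^ 4) + 8 * avg m (\<lambda>i. norm (Pm *v c i \<omega>) ^ 4)) / m"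
      by (rule divide_right_mono) simp
    then show "norm (avg m (\<lambda>i. norm (aobs i \<omega>) ^ 4) / m) \<le>
        norm (8 * (avg m (\<lambda>i. norm (a0 i) ^ 4) / m) + 8 * (avg m (\<lambda>i. norm (Pm *v c i \<omega>) ^ 4) / m))"
      by (simp add: avg_nonneg add_divide_distrib)
  qed
qed

text \<open>The statistics that only have to stay bounded in mean. The last two are squared norms of normalised
  sums of centred independent vectors.\<close>
definition bounded_part :: "nat \<Rightarrow> 'w \<Rightarrow> real" where
  "bounded_part m \<omega> = avg m (\<lambda>i. norm (Rm *v c i \<omega>) ^ 4)
    + avg m (\<lambda>i. (norm (outer (a0 i + Bm *v c i \<omega>) (Rm *v c i \<omega>)))\<^sup>2)
    + m * (norm (avg m (\<lambda>i. outer (a0 i + Bm *v c i \<omega>) (Rm *v c i \<omega>))))\<^sup>2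
    + m * (norm (avg m (\<lambda>i. Rm *v c i \<omega>)))\<^sup>2"

lemma bounded_part: "integrable M (bounded_part m)" "\<exists>C. \<forall>m. expectation (bounded_part m) \<le> C"
proof -
  note [measurable] = c_measurable
  define e1 where "e1 = expectation (\<lambda>\<omega>. norm (Rm *v c 1 \<omega>) ^ 4)"
  define e2 where "e2 = expectation (\<lambda>\<omega>. (norm (Rm *v c 1 \<omega>))\<^sup>2)"
  define e3 where "e3 = expectation (\<lambda>\<omega>. (norm (Bm *v c 1 \<omega>))\<^sup>2 * (norm (Rm *v c 1 \<omega>))\<^sup>2)"
  have e: "0 \<le> e1" "0 \<le> e2" "0 \<le> e3" by (simp_all add: e1_def e2_def e3_def)
  have g1: "growth 4 (\<lambda>x. norm (Rm *v x) ^ 4)" using growth_power[OF growth_norm_mult, of 4 Rm] by simp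
  have g2: "growth 2 (\<lambda>x. (norm (Rm *v x))\<^sup>2)" using growth_power[OF growth_norm_mult, of 2 Rm] by simp
  have g3: "growth 4 (\<lambda>x. (norm (Bm *v x))\<^sup>2 * (norm (Rm *v x))\<^sup>2)"
    using growth_mult[OF growth_power[OF growth_norm_mult, of 2 Bm] g2] by simp
  note i1 = growth_ident[OF g1 order_refl]
  have i2: "integrable M (\<lambda>\<omega>. (norm (Rm *v c i \<omega>))\<^sup>2)" "expectation (\<lambda>\<omega>. (norm (Rm *v c i \<omega>))\<^sup>2) = e2" if "1 \<le> i" for i
    using growth_ident[OF g2 _ that] by (auto simp: e2_def)
  note i3 = growth_ident[OF g3 order_refl]
  have est_le: "(norm (outer (a0 i + Bm *v x) (Rm *v x)))\<^sup>2 \<le>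
      2 * (norm (a0 i))\<^sup>2 * (norm (Rm *v x))\<^sup>2 + 2 * ((norm (Bm *v x))\<^sup>2 * (norm (Rm *v x))\<^sup>2)" for i x
    using mult_right_mono[OF norm_sq_add_le[of "a0 i" "Bm *v x"], of "(norm (Rm *v x))\<^sup>2"]
    by (simp add: norm_outer power_mult_distrib algebra_simps)
  have est_int: "integrable M (\<lambda>\<omega>. (norm (outer (a0 i + Bm *v c i \<omega>) (Rm *v c i \<omega>)))\<^sup>2)"
    and est_E: "expectation (\<lambda>\<omega>. (norm (outer (a0 i + Bm *v c i \<omega>) (Rm *v c i \<omega>)))\<^sup>2) \<le> 2 * (norm (a0 i))\<^sup>2 * e2 + 2 * e3"
    if i: "1 \<le> i" for i
  proof -
    have int: "integrable M (\<lambda>\<omega>. 2 * (norm (a0 i))\<^sup>2 * (norm (Rm *v c i \<omega>))\<^sup>2 + 2 * ((norm (Bm *v c i \<omega>))\<^sup>2 * (norm (Rm *v c i \<omega>))\<^sup>2))"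
      using i2[OF i] i3[OF i] by simp
    show *: "integrable M (\<lambda>\<omega>. (norm (outer (a0 i + Bm *v c i \<omega>) (Rm *v c i \<omega>)))\<^sup>2)"
      by (rule Bochner_Integration.integrable_bound[OF int])
        (use i est_le in \<open>auto intro!: AE_I2 order_trans[OF est_le abs_ge_self]\<close>)
    have "expectation (\<lambda>\<omega>. (norm (outer (a0 i + Bm *v c i \<omega>) (Rm *v c i \<omega>)))\<^sup>2)
        \<le> expectation (\<lambda>\<omega>. 2 * (norm (a0 i))\<^sup>2 * (norm (Rm *v c i \<omega>))\<^sup>2 + 2 * ((norm (Bm *v c i \<omega>))\<^sup>2 * (norm (Rm *v c i \<omega>))\<^sup>2))"
      by (intro integral_mono * int est_le)
    also have "\<dots> = 2 * (norm (a0 i))\<^sup>2 * e2 + 2 * e3"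
      using i2[OF i] i3[OF i] by (simp add: e3_def)
    finally show "expectation (\<lambda>\<omega>. (norm (outer (a0 i + Bm *v c i \<omega>) (Rm *v c i \<omega>)))\<^sup>2) \<le> 2 * (norm (a0 i))\<^sup>2 * e2 + 2 * e3" .
  qed
  have est_zero: "expectation (\<lambda>\<omega>. outer (a0 i + Bm *v c i \<omega>) (Rm *v c i \<omega>) \<bullet> b) = 0" if i: "1 \<le> i" and b: "b \<in> Basis" for i b
  proof -
    obtain j k where b: "b = axis j (axis k 1)" using b by (auto simp: Basis_vec_def)
    have g: "growth 2 (\<lambda>x. (Bm *v x) $ j * (Rm *v x) $ k)" by (rule growth_nth_nth)
    have "expectation (\<lambda>\<omega>. a0 i $ j * (Rm *v c i \<omega>) $ k + (Bm *v c i \<omega>) $ j * (Rm *v c i \<omega>) $ k) = 0"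
      using growth_ident[OF growth_nth_mult[of Rm k] _ i] growth_ident[OF g _ i]
      by (simp add: first_moment_nth second_moment_nth Bm_Rm del: One_nat_def)
    then show ?thesis by (simp add: b inner_axis outer_def algebra_simps)
  qed
  have r_zero: "expectation (\<lambda>\<omega>. (Rm *v c i \<omega>) \<bullet> b) = 0" if i: "1 \<le> i" and b: "b \<in> Basis" for i b
    using growth_ident(2)[OF growth_inner_mult[of b Rm] _ i] first_moment[of b Rm]
    by (simp add: inner_commute del: One_nat_def)
  have b3: "integrable M (\<lambda>\<omega>. m * (norm (avg m (\<lambda>i. outer (a0 i + Bm *v c i \<omega>) (Rm *v c i \<omega>))))\<^sup>2)"
    "expectation (\<lambda>\<omega>. m * (norm (avg m (\<lambda>i. outer (a0 i + Bm *v c i \<omega>) (Rm *v c i \<omega>))))\<^sup>2)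
      = avg m (\<lambda>i. expectation (\<lambda>\<omega>. (norm (outer (a0 i + Bm *v c i \<omega>) (Rm *v c i \<omega>)))\<^sup>2))" for m
    using expectation_norm_avg_sq[of "\<lambda>i x. outer (a0 i + Bm *v x) (Rm *v x)", OF _ est_int est_zero] by auto
  have b4: "integrable M (\<lambda>\<omega>. m * (norm (avg m (\<lambda>i. Rm *v c i \<omega>)))\<^sup>2)"
    "expectation (\<lambda>\<omega>. m * (norm (avg m (\<lambda>i. Rm *v c i \<omega>)))\<^sup>2) = avg m (\<lambda>i. expectation (\<lambda>\<omega>. (norm (Rm *v c i \<omega>))\<^sup>2))" for m
    using expectation_norm_avg_sq[of "\<lambda>i x. Rm *v x", OF _ i2(1) r_zero] by auto
  have b1: "integrable M (\<lambda>\<omega>. avg m (\<lambda>i. norm (Rm *v c i \<omega>) ^ 4))"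
    "expectation (\<lambda>\<omega>. avg m (\<lambda>i. norm (Rm *v c i \<omega>) ^ 4)) = avg m (\<lambda>i. expectation (\<lambda>\<omega>. norm (Rm *v c i \<omega>) ^ 4))" for m
    by (rule integrable_avg expectation_avg, rule i1, assumption)+
  have b2: "integrable M (\<lambda>\<omega>. avg m (\<lambda>i. (norm (outer (a0 i + Bm *v c i \<omega>) (Rm *v c i \<omega>)))\<^sup>2))"
    "expectation (\<lambda>\<omega>. avg m (\<lambda>i. (norm (outer (a0 i + Bm *v c i \<omega>) (Rm *v c i \<omega>)))\<^sup>2))
      = avg m (\<lambda>i. expectation (\<lambda>\<omega>. (norm (outer (a0 i + Bm *v c i \<omega>) (Rm *v c i \<omega>)))\<^sup>2))" for m
    by (rule integrable_avg expectation_avg, rule est_int, assumption)+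
  show "integrable M (bounded_part m)" for m
    unfolding bounded_part_def by (intro Bochner_Integration.integrable_add b1 b2 b3 b4)
  have avg_const_le: "avg m (\<lambda>i. k) \<le> k" if "0 \<le> k" for m and k :: real using that by (simp add: avg_def)
  have est_avg: "avg m (\<lambda>i. expectation (\<lambda>\<omega>. (norm (outer (a0 i + Bm *v c i \<omega>) (Rm *v c i \<omega>)))\<^sup>2)) \<le> 2 * e2 * a0_sq_bound + 2 * e3" for m
  proof -
    have "avg m (\<lambda>i. expectation (\<lambda>\<omega>. (norm (outer (a0 i + Bm *v c i \<omega>) (Rm *v c i \<omega>)))\<^sup>2))
        \<le> avg m (\<lambda>i. 2 * e2 * (norm (a0 i))\<^sup>2 + 2 * e3)"
      using est_E by (intro avg_mono_ge_1) (simp add: mult_ac)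
    also have "\<dots> \<le> 2 * e2 * a0_sq_bound + 2 * e3"
      unfolding avg_add avg_mult_left[of m "2 * e2"] using e avg_norm_a0_le
      by (intro add_mono mult_left_mono avg_const_le) auto
    finally show ?thesis .
  qed
  have "expectation (bounded_part m) \<le> e1 + (2 * e2 * a0_sq_bound + 2 * e3) + (2 * e2 * a0_sq_bound + 2 * e3) + e2" for m
  proof -
    have "expectation (bounded_part m) = avg m (\<lambda>i. expectation (\<lambda>\<omega>. norm (Rm *v c i \<omega>) ^ 4))
        + avg m (\<lambda>i. expectation (\<lambda>\<omega>. (norm (outer (a0 i + Bm *v c i \<omega>) (Rm *v c i \<omega>)))\<^sup>2))
        + avg m (\<lambda>i. expectation (\<lambda>\<omega>. (norm (outer (a0 i + Bm *v c i \<omega>) (Rm *v c i \<omega>)))\<^sup>2))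
        + avg m (\<lambda>i. expectation (\<lambda>\<omega>. (norm (Rm *v c i \<omega>))\<^sup>2))"
      unfolding bounded_part_def using b1 b2 b3 b4
      by (simp only: Bochner_Integration.integral_add Bochner_Integration.integrable_add)
    moreover have "avg m (\<lambda>i. expectation (\<lambda>\<omega>. norm (Rm *v c i \<omega>) ^ 4)) = avg m (\<lambda>i. e1)"
      by (rule avg_cong) (unfold e1_def, rule i1(2))
    moreover have "avg m (\<lambda>i. expectation (\<lambda>\<omega>. (norm (Rm *v c i \<omega>))\<^sup>2)) = avg m (\<lambda>i. e2)"
      by (rule avg_cong) (rule i2(2))
    moreover note avg_const_le[OF e(1), of m] avg_const_le[OF e(2), of m]
    ultimately show ?thesis using est_avg[of m] by linarith
  qed
  then show "\<exists>C. \<forall>m. expectation (bounded_part m) \<le> C" by blast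
qed

lemma bounded_part_nonneg: "0 \<le> bounded_part m \<omega>"
  unfolding bounded_part_def by (intro add_nonneg_nonneg avg_nonneg mult_nonneg_nonneg) auto

end

context eiv_model begin

section \<open>The model: limit law of the statistic\<close>

text \<open>The statistics that have to converge, collected into one quantity that tends to zero in mean.\<close>
definition small_part :: "nat \<Rightarrow> 'w \<Rightarrow> real" where
  "small_part m \<omega> =
    norm (avg m (\<lambda>i. outer (aobs i \<omega>) (aobs i \<omega>)) - (V + \<sigma>\<^sup>2 *\<^sub>R mat 1))
    + norm (avg m (\<lambda>i. outer (aobs i \<omega>) (Rm *v c i \<omega>)) - \<sigma>\<^sup>2 *\<^sub>R X0)
    + norm (avg m (\<lambda>i. outer (Rm *v c i \<omega>) (Rm *v c i \<omega>)) - \<sigma>\<^sup>2 *\<^sub>R gram X0)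
    + norm (avg m (\<lambda>i. aobs i \<omega>) - \<mu>a)
    + norm (avg m (\<lambda>i. outer ((w \<bullet> a0 i + kap (c i \<omega>)) *\<^sub>R (Rm *v c i \<omega>)) ((w \<bullet> a0 i + kap (c i \<omega>)) *\<^sub>R (Rm *v c i \<omega>))) - Sinf)
    + norm (avg m (\<lambda>i. norm (aobs i \<omega>) ^ 4) / m)"

lemma small_part_null: "L1_null small_part"
proof -
  have "L1_null (\<lambda>m \<omega>. small_part m \<omega>)"
    unfolding small_part_def
    using averages_aa averages_ar averages_rr averages_a averages_qq
    unfolding averages_to_def aobs_def[symmetric]
    by (intro L1_null_add L1_null_norm aobs_pow4_null)
  then show ?thesis .
qed

lemma small_part_nonneg: "0 \<le> small_part m \<omega>"
  unfolding small_part_def by (intro add_nonneg_nonneg norm_ge_zero)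

text \<open>The average of the vectors \<open>u\<^sub>i\<close> that approximates \<open>T0_stat\<close>.\<close>
definition score :: "nat \<Rightarrow> 'w \<Rightarrow> real^'d" where
  "score m \<omega> = avg m (\<lambda>i. (w \<bullet> a0 i + kap (c i \<omega>) - 1) *\<^sub>R (Rm *v c i \<omega>))"

lemma score_eq:
  "score m \<omega> = avg m (\<lambda>i. transpose (est_fun (aobs i \<omega>) (bobs i \<omega>) X0) *v w - resid X0 (aobs i \<omega>) (bobs i \<omega>))"
  by (simp add: score_def est_fun_obs_w resid_obs algebra_simps)

definition white_score :: "nat \<Rightarrow> 'w \<Rightarrow> real^'d" where
  "white_score m \<omega> = inv_sqrt_matrix \<Sigma>T *v (sqrt m *\<^sub>R score m \<omega>)"

lemma norm_white_score: "(norm (white_score m \<omega>))\<^sup>2 = m * (score m \<omega> \<bullet> (matrix_inv \<Sigma>T *v score m \<omega>))"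
  unfolding white_score_def norm_inv_sqrt_matrix_mult[OF pos_def_\<Sigma>T]
  by (simp add: matrix_vector_mult_scaleR mult.assoc[symmetric])

lemma T2_close:
  assumes n: "strict_mono n" and small: "(\<lambda>k. small_part (n k) (\<omega> k)) \<longlonglongrightarrow> 0"
    and bdd: "\<And>k. bounded_part (n k) (\<omega> k) \<le> K"
    and Xh: "\<And>k. 1 \<le> n k \<longrightarrow>
      (\<exists>X da db. tls_solution (n k) (\<lambda>i. aobs i (\<omega> k)) (\<lambda>i. bobs i (\<omega> k)) X da db) \<longrightarrow>
      (\<exists>X da db. Xh k = Some X \<and> tls_solution (n k) (\<lambda>i. aobs i (\<omega> k)) (\<lambda>i. bobs i (\<omega> k)) X da db)"
  shows "eventually (\<lambda>k. T2_defined (n k) (\<lambda>i. aobs i (\<omega> k)) (\<lambda>i. bobs i (\<omega> k)) (Xh k)) sequentially"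
    and "(\<lambda>k. T2_stat (n k) (\<lambda>i. aobs i (\<omega> k)) (\<lambda>i. bobs i (\<omega> k)) (the (Xh k)) - (norm (white_score (n k) (\<omega> k)))\<^sup>2) \<longlonglongrightarrow> 0"
proof -
  define a where "a k i = aobs i (\<omega> k)" for k i
  define b where "b k i = bobs i (\<omega> k)" for k i
  define X where "X k = the (Xh k)" for k
  have null: "f \<longlonglongrightarrow> l" if "\<And>k. norm (f k - l) \<le> small_part (n k) (\<omega> k)" for f and l :: "'z::real_normed_vector"
  proof -
    have "(\<lambda>k. f k - l) \<longlonglongrightarrow> 0"
      by (rule Lim_null_comparison[OF _ small]) (use that in auto)
    then show ?thesis by (simp add: Lim_null[of f])
  qed
  have n_top: "filterlim n at_top sequentially" by (rule filterlim_subseq[OF n])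
  have Maa: "(\<lambda>k. avg (n k) (\<lambda>i. outer (a k i) (a k i))) \<longlonglongrightarrow> V + \<sigma>\<^sup>2 *\<^sub>R mat 1"
    by (rule null) (simp add: small_part_def a_def)
  have N: "(\<lambda>k. avg (n k) (\<lambda>i. outer (a k i) (resid X0 (a k i) (b k i)))) \<longlonglongrightarrow> \<sigma>\<^sup>2 *\<^sub>R X0"
    by (rule null) (simp add: small_part_def a_def b_def resid_obs)
  have R0: "(\<lambda>k. avg (n k) (\<lambda>i. outer (resid X0 (a k i) (b k i)) (resid X0 (a k i) (b k i)))) \<longlonglongrightarrow> \<sigma>\<^sup>2 *\<^sub>R gram X0"
    by (rule null) (simp add: small_part_def a_def b_def resid_obs)
  have mean': "(\<lambda>k. avg (n k) (a k)) \<longlonglongrightarrow> \<mu>a"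
    unfolding a_def[abs_def] by (rule null) (simp add: small_part_def)
  have S: "(\<lambda>k. avg (n k) (\<lambda>i. outer (transpose (est_fun (a k i) (b k i) X0) *v w)
      (transpose (est_fun (a k i) (b k i) X0) *v w))) \<longlonglongrightarrow> Sinf"
    by (rule null) (simp add: small_part_def a_def b_def est_fun_obs_w)
  have a4: "(\<lambda>k. avg (n k) (\<lambda>i. (norm (a k i))^4) / n k) \<longlonglongrightarrow> 0"
    by (rule null) (simp add: small_part_def a_def)
  have K: "0 \<le> K" using bdd[of 0] bounded_part_nonneg[of "n 0" "\<omega> 0"] by linarith
  define C where "C = 1 + K"
  have sqrt_le: "sqrt x * y \<le> C" if "x * y\<^sup>2 \<le> K" "0 \<le> y" for x y :: real
  proof -
    have "sqrt x * y = sqrt (x * y\<^sup>2)" using that(2) by (simp add: real_sqrt_mult)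
    also have "\<dots> \<le> sqrt K" using that(1) by simp
    also have "\<dots> \<le> 1 + K" using K by (intro real_le_lsqrt) (auto simp: power2_sum)
    finally show ?thesis by (simp add: C_def)
  qed
  have parts: "avg (n k) (\<lambda>i. (norm (resid X0 (a k i) (b k i)))^4) \<le> K"
    "avg (n k) (\<lambda>i. (norm (est_fun (a k i) (b k i) X0))\<^sup>2) \<le> K"
    "n k * (norm (avg (n k) (\<lambda>i. est_fun (a k i) (b k i) X0)))\<^sup>2 \<le> K"
    "n k * (norm (avg (n k) (\<lambda>i. resid X0 (a k i) (b k i))))\<^sup>2 \<le> K" for k
  proof -
    let ?b1 = "avg (n k) (\<lambda>i. (norm (resid X0 (a k i) (b k i)))^4)"
      and ?b2 = "avg (n k) (\<lambda>i. (norm (est_fun (a k i) (b k i) X0))\<^sup>2)"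
      and ?b3 = "n k * (norm (avg (n k) (\<lambda>i. est_fun (a k i) (b k i) X0)))\<^sup>2"
      and ?b4 = "n k * (norm (avg (n k) (\<lambda>i. resid X0 (a k i) (b k i))))\<^sup>2"
    have "?b1 + ?b2 + ?b3 + ?b4 \<le> K"
      using bdd[of k] by (simp add: bounded_part_def a_def b_def resid_obs est_fun_obs)
    moreover have "0 \<le> ?b1" "0 \<le> ?b2" by (auto intro: avg_nonneg)
    moreover have "0 \<le> ?b3" "0 \<le> ?b4" by auto
    ultimately show "?b1 \<le> K" "?b2 \<le> K" "?b3 \<le> K" "?b4 \<le> K" by linarith+
  qed
  have F: "eventually (\<lambda>k. sqrt (n k) * norm (avg (n k) (\<lambda>i. est_fun (a k i) (b k i) X0)) \<le> C) sequentially"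
    by (intro always_eventually allI sqrt_le parts(3) norm_ge_zero)
  have r1: "eventually (\<lambda>k. sqrt (n k) * norm (avg (n k) (\<lambda>i. resid X0 (a k i) (b k i))) \<le> C) sequentially"
    by (intro always_eventually allI sqrt_le parts(4) norm_ge_zero)
  have r4: "eventually (\<lambda>k. avg (n k) (\<lambda>i. (norm (resid X0 (a k i) (b k i)))^4) \<le> C) sequentially"
    and s2: "eventually (\<lambda>k. avg (n k) (\<lambda>i. (norm (est_fun (a k i) (b k i) X0))\<^sup>2) \<le> C) sequentially"
    using parts by (auto intro!: always_eventually add_increasing simp: C_def)
  have pd: "pos_def ((\<sigma>\<^sup>2 * (1 - 2 * (\<mu>a \<bullet> w))) *\<^sub>R gram X0 + Sinf)"
    using pos_def_\<Sigma>T by (simp add: \<Sigma>T_def)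
  have "eventually (\<lambda>k. 1 \<le> n k) sequentially" using n_top by (simp add: filterlim_at_top)
  then have ev: "eventually (\<lambda>k. Xh k = Some (X k) \<and> (\<exists>da db. tls_solution (n k) (a k) (b k) (X k) da db)) sequentially"
    using tls_consistency(1)[OF n_top Maa N R0 pos_def_V]
  proof eventually_elim
    case (elim k)
    then obtain X' da db where X': "Xh k = Some X'" "tls_solution (n k) (a k) (b k) X' da db"
      using Xh[of k] unfolding a_def[abs_def] b_def[abs_def] by blast
    then have "X k = X'" by (simp add: X_def)
    with X' show ?case by blast
  qed
  then have sol: "eventually (\<lambda>k. \<exists>da db. tls_solution (n k) (a k) (b k) (X k) da db) sequentially"
    by eventually_elim auto
  note facts = n_top Maa N R0 pos_def_V sol w_def mean' S F a4 r4 s2 r1 pd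
  show "eventually (\<lambda>k. T2_defined (n k) (\<lambda>i. aobs i (\<omega> k)) (\<lambda>i. bobs i (\<omega> k)) (Xh k)) sequentially"
    using T2_eventually_defined[OF facts] ev
    by eventually_elim (simp add: a_def[abs_def] b_def[abs_def])
  show "(\<lambda>k. T2_stat (n k) (\<lambda>i. aobs i (\<omega> k)) (\<lambda>i. bobs i (\<omega> k)) (the (Xh k)) - (norm (white_score (n k) (\<omega> k)))\<^sup>2) \<longlonglongrightarrow> 0"
    using T2_stat_expansion[OF facts]
    unfolding norm_white_score score_eq \<Sigma>T_def X_def a_def b_def .
qed

text \<open>A linear functional of the whitened score is a normalised sum of terms \<open>f\<^sub>i(c\<^sub>i)\<close> with
  \<open>f\<^sub>i = (w\<^sup>T a\<^sup>0\<^sub>i + \<kappa> - 1) (v \<bullet> \<rho>)\<close>; the weights \<open>\<gamma>\<^sub>i = 1 + \<parallel>w\<parallel> \<parallel>a\<^sup>0\<^sub>i\<parallel>\<close> separate the regressor from the error.\<close>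
lemma score_char:
  "(\<lambda>m. CLINT \<omega>|M. iexp (t \<bullet> white_score m \<omega>)) \<longlonglongrightarrow> complex_of_real (exp (- (norm t)\<^sup>2 / 2))"
proof -
  define v where "v = inv_sqrt_matrix \<Sigma>T *v t"
  define f where "f i x = (w \<bullet> a0 i + kap x - 1) * (v \<bullet> (Rm *v x))" for i x
  define G where "G x = (1 + \<bar>kap x\<bar>) * \<bar>v \<bullet> (Rm *v x)\<bar>" for x
  define \<gamma> where "\<gamma> i = 1 + norm w * norm (a0 i)" for i
  let ?R = "inv_sqrt_matrix \<Sigma>T"
  have R_sym: "transpose ?R = ?R" by (rule pos_def_sym[OF inv_sqrt_matrix(1)[OF pos_def_\<Sigma>T]])
  have t_eq: "t \<bullet> white_score m \<omega> = (\<Sum>i=1..m. f i (c i \<omega>)) / sqrt m" for m \<omega>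
  proof -
    have "t \<bullet> white_score m \<omega> = sqrt m * (v \<bullet> score m \<omega>)"
      by (simp add: white_score_def v_def sym_inner[OF R_sym])
    also have "v \<bullet> score m \<omega> = avg m (\<lambda>i. f i (c i \<omega>))"
      unfolding score_def
      by (subst avg_linear[OF bounded_linear.linear[OF bounded_linear_inner_right]]) (simp add: f_def)
    also have "sqrt m * avg m (\<lambda>i. f i (c i \<omega>)) = (sqrt m / m) * (\<Sum>i=1..m. f i (c i \<omega>))"
      by (simp add: avg_def)
    also have "sqrt m / m = 1 / sqrt m"
      by (metis div_by_1 divide_divide_eq_right mult_1 of_nat_0_le_iff real_div_sqrt inverse_eq_divide)
    finally show ?thesis by simp
  qed
  have gv: "growth 1 (\<lambda>x. v \<bullet> (Rm *v x))" by (rule growth_inner_mult)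
  have gG: "growth 2 G"
    using growth_mult[OF growth_add[OF growth_mono[OF growth_const] growth_abs[OF growth_kap]] growth_abs[OF gv], of 1]
    by (simp add: G_def[abs_def] numeral_2_eq_2)
  have gf: "growth 2 (f i)" for i
    using growth_mult[OF growth_add[OF growth_mono[OF growth_const] growth_kap] gv, of "w \<bullet> a0 i - 1"]
    by (simp add: f_def[abs_def] numeral_2_eq_2 algebra_simps)
  have zero: "expectation (\<lambda>\<omega>. f i (c i \<omega>)) = 0" if i: "1 \<le> i" for i
  proof -
    have g: "growth 2 (\<lambda>x. kap x * (v \<bullet> (Rm *v x)))"
      using growth_mult[OF growth_kap gv] by (simp add: numeral_2_eq_2)
    have "expectation (\<lambda>\<omega>. f i (c i \<omega>)) = expectation (\<lambda>\<omega>. (w \<bullet> a0 i - 1) * (v \<bullet> (Rm *v c 1 \<omega>)) + kap (c 1 \<omega>) * (v \<bullet> (Rm *v c 1 \<omega>)))"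
      using growth_ident(2)[OF gf _ i] by (simp add: f_def algebra_simps)
    also have "\<dots> = (w \<bullet> a0 i - 1) * expectation (\<lambda>\<omega>. v \<bullet> (Rm *v c 1 \<omega>)) + expectation (\<lambda>\<omega>. kap (c 1 \<omega>) * (v \<bullet> (Rm *v c 1 \<omega>)))"
      using growth_integrable[OF gv] growth_integrable[OF g] by simp
    finally show ?thesis by (simp add: first_moment kap_rho del: One_nat_def)
  qed
  have var_i: "expectation (\<lambda>\<omega>. (f i (c i \<omega>))\<^sup>2) =
      ((w \<bullet> a0 i) * (w \<bullet> a0 i) - 2 * (w \<bullet> a0 i) + 1) * (\<sigma>\<^sup>2 * (v \<bullet> (gram X0 *v v))) + v \<bullet> (Km *v v)" if i: "1 \<le> i" for i
  proof -
    let ?rr = "\<lambda>x. (v \<bullet> (Rm *v x)) * (v \<bullet> (Rm *v x))"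
    have g: "growth 4 (\<lambda>x. (f i x)\<^sup>2)" using growth_power[OF gf, of 2] by simp
    have eq: "(f i x)\<^sup>2 = ((w \<bullet> a0 i) * (w \<bullet> a0 i) - 2 * (w \<bullet> a0 i) + 1) * ?rr x
        + (2 * (w \<bullet> a0 i) - 2) * (kap x * ?rr x) + (kap x)\<^sup>2 * ?rr x" for x
      by (simp add: f_def power2_eq_square algebra_simps)
    have "expectation (\<lambda>\<omega>. (f i (c i \<omega>))\<^sup>2) = expectation (\<lambda>\<omega>. (f i (c 1 \<omega>))\<^sup>2)"
      by (rule growth_ident(2)[OF g _ i]) simp
    also have "\<dots> = ((w \<bullet> a0 i) * (w \<bullet> a0 i) - 2 * (w \<bullet> a0 i) + 1) * expectation (\<lambda>\<omega>. ?rr (c 1 \<omega>))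
        + (2 * (w \<bullet> a0 i) - 2) * expectation (\<lambda>\<omega>. kap (c 1 \<omega>) * ?rr (c 1 \<omega>)) + expectation (\<lambda>\<omega>. (kap (c 1 \<omega>))\<^sup>2 * ?rr (c 1 \<omega>))"
      unfolding eq using growth_integrable[OF growth_rr[of v v]] growth_integrable[OF growth_krr[of v v]]
        growth_integrable[OF growth_kkrr[of v v]]
      by (simp only: Bochner_Integration.integral_add integrable_mult_right Bochner_Integration.integrable_add
          integral_mult_right_zero le_numeral_extra numeral_le_iff semiring_norm order_refl)
    finally show ?thesis
      by (simp only: second_moment kap_rho_rho kap_sq_rho_rho Rm_Rm mult_zero_right add_0_right)
  qed
  have v_\<Sigma>: "v \<bullet> (\<Sigma>T *v v) = (norm t)\<^sup>2"
  proof -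
    have "?R ** (?R ** \<Sigma>T) = mat 1"
      by (simp add: matrix_mul_assoc inv_sqrt_matrix(2)[OF pos_def_\<Sigma>T] matrix_inv_mult[OF pos_def_invertible[OF pos_def_\<Sigma>T]])
    then have "(?R ** \<Sigma>T) ** ?R = mat 1" by (simp add: matrix_left_right_inverse)
    then have "?R *v (\<Sigma>T *v v) = t" by (simp add: v_def matrix_vector_mul_assoc matrix_mul_assoc)
    moreover have "v \<bullet> (\<Sigma>T *v v) = t \<bullet> (?R *v (\<Sigma>T *v v))"
      by (simp add: v_def sym_inner[OF R_sym])
    ultimately show ?thesis by (simp add: power2_norm_eq_inner)
  qed
  have var: "(\<lambda>m. avg m (\<lambda>i. expectation (\<lambda>\<omega>. (f i (c i \<omega>))\<^sup>2))) \<longlonglongrightarrow> (norm t)\<^sup>2"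
  proof -
    let ?g = "\<sigma>\<^sup>2 * (v \<bullet> (gram X0 *v v))" and ?k = "v \<bullet> (Km *v v)"
    have "(\<lambda>m. ?g * (avg m (\<lambda>i. (w \<bullet> a0 i) * (w \<bullet> a0 i)) - 2 * avg m (\<lambda>i. w \<bullet> a0 i) + avg m (\<lambda>i. 1)) + ?k * avg m (\<lambda>i. 1))
        \<longlonglongrightarrow> ?g * (w \<bullet> (V *v w) - 2 * (w \<bullet> \<mu>a) + 1) + ?k * 1"
      by (intro tendsto_intros avg_a0_quadratic avg_a0_inner avg_one)
    moreover have "?g * (w \<bullet> (V *v w) - 2 * (w \<bullet> \<mu>a) + 1) + ?k * 1 = v \<bullet> (\<Sigma>T *v v)"
      unfolding w_V_w \<Sigma>T_eq by (simp add: matrix_vector_mult_add_rdistrib inner_add_right inner_commute[of w \<mu>a] algebra_simps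
        flip: scaleR_matrix_vector_assoc)
    moreover have "avg m (\<lambda>i. expectation (\<lambda>\<omega>. (f i (c i \<omega>))\<^sup>2)) =
        ?g * (avg m (\<lambda>i. (w \<bullet> a0 i) * (w \<bullet> a0 i)) - 2 * avg m (\<lambda>i. w \<bullet> a0 i) + avg m (\<lambda>i. 1)) + ?k * avg m (\<lambda>i. 1)" for m
    proof -
      have "avg m (\<lambda>i. expectation (\<lambda>\<omega>. (f i (c i \<omega>))\<^sup>2)) =
          avg m (\<lambda>i. ?g * ((w \<bullet> a0 i) * (w \<bullet> a0 i) - 2 * (w \<bullet> a0 i) + 1) + ?k * 1)"
        by (rule avg_cong) (simp add: var_i mult_ac)
      then show ?thesis by (simp only: avg_add avg_diff avg_mult_left)
    qed
    ultimately show ?thesis by (simp only: v_\<Sigma>)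
  qed
  \<comment> \<open>\<open>\<gamma>\<^sub>i \<le> \<epsilon>\<^sub>m \<surd>m\<close> for \<open>i \<le> m\<close>: the constant \<open>1\<close> and the regressor are divided by \<open>\<surd>m\<close> separately.\<close>
  define \<epsilon> where "\<epsilon> m = 1 / sqrt (real m) + norm w * max_rate m" for m
  have \<epsilon>: "\<epsilon> \<longlonglongrightarrow> 0"
  proof -
    have "(\<lambda>m. sqrt (1 / real m) + norm w * max_rate m) \<longlonglongrightarrow> sqrt 0 + norm w * 0"
      by (intro tendsto_intros max_rate_null lim_1_over_n)
    then show ?thesis by (simp add: \<epsilon>_def[abs_def] real_sqrt_divide)
  qed
  have "(\<lambda>m. CLINT \<omega>|M. iexp ((\<Sum>i=1..m. f i (c i \<omega>)) / sqrt m)) \<longlonglongrightarrow> complex_of_real (exp (- (norm t)\<^sup>2 / 2))"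
  proof (rule weighted_clt[where G=G and \<gamma>=\<gamma> and \<epsilon>=\<epsilon> and A="2 + 2 * (norm w)\<^sup>2 * a0_sq_bound"])
    show "f i \<in> borel_measurable borel" for i by (rule growth_measurable[OF gf])
    show "G \<in> borel_measurable borel" by (rule growth_measurable[OF gG])
    show "0 \<le> G x" for x by (simp add: G_def)
    show "\<bar>f i x\<bar> \<le> \<gamma> i * G x" for i x
    proof -
      have "\<bar>w \<bullet> a0 i + kap x - 1\<bar> \<le> norm w * norm (a0 i) + \<bar>kap x\<bar> + 1"
        using Cauchy_Schwarz_ineq2[of w "a0 i"] by linarith
      also have "\<dots> \<le> \<gamma> i * (1 + \<bar>kap x\<bar>)"
        by (simp add: \<gamma>_def algebra_simps)
      finally have "\<bar>w \<bullet> a0 i + kap x - 1\<bar> * \<bar>v \<bullet> (Rm *v x)\<bar> \<le> \<gamma> i * (1 + \<bar>kap x\<bar>) * \<bar>v \<bullet> (Rm *v x)\<bar>"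
        by (rule mult_right_mono) simp
      then show ?thesis by (simp add: f_def G_def abs_mult mult.assoc)
    qed
    show "integrable M (\<lambda>\<omega>. (G (c 1 \<omega>))\<^sup>2)"
      by (rule growth_integrable[of 4]) (use growth_power[OF gG, of 2] in simp_all)
    show "expectation (\<lambda>\<omega>. f i (c i \<omega>)) = 0" if "1 \<le> i" for i by (rule zero[OF that])
    show "0 \<le> \<gamma> i" for i by (simp add: \<gamma>_def)
    show "avg m (\<lambda>i. (\<gamma> i)\<^sup>2) \<le> 2 + 2 * (norm w)\<^sup>2 * a0_sq_bound" for m
    proof -
      have "(\<gamma> i)\<^sup>2 \<le> 2 * 1 + 2 * (norm w)\<^sup>2 * (norm (a0 i))\<^sup>2" for i
        using sum_squares_bound[of 1 "norm w * norm (a0 i)"] by (simp add: \<gamma>_def power2_sum power_mult_distrib mult.commute)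
      then have "avg m (\<lambda>i. (\<gamma> i)\<^sup>2) \<le> 2 * avg m (\<lambda>i. 1) + 2 * (norm w)\<^sup>2 * avg m (\<lambda>i. (norm (a0 i))\<^sup>2)"
        unfolding avg_mult_left[symmetric] avg_add[symmetric] by (rule avg_mono)
      also have "\<dots> \<le> 2 * 1 + 2 * (norm w)\<^sup>2 * a0_sq_bound"
        by (intro add_mono mult_left_mono avg_norm_a0_le) (auto simp: avg_def)
      finally show ?thesis by simp
    qed
    show "\<gamma> i \<le> \<epsilon> m * sqrt m" if i: "1 \<le> i" "i \<le> m" for m i
    proof -
      have m: "0 < sqrt (real m)" using i by simp
      have "norm w * norm (a0 i) \<le> norm w * (max_rate m * sqrt m)"
        by (intro mult_left_mono norm_a0_le i) auto
      moreover have "\<epsilon> m * sqrt m = 1 + norm w * (max_rate m * sqrt m)"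
        using m by (simp add: \<epsilon>_def distrib_right)
      ultimately show ?thesis by (simp add: \<gamma>_def)
    qed
  qed (fact \<epsilon> var)+
  then show ?thesis by (simp only: t_eq)
qed

lemma white_score_measurable: "white_score m \<in> borel_measurable M"
proof -
  note [measurable] = c_measurable borel_measurable_avg growth_measurable[OF growth_kap]
  show ?thesis unfolding white_score_def[abs_def] score_def by measurable
qed

end

theorem theorem14:
  fixes M :: "'w measure"
    and X0 :: "real^'d^'n"
    and a0 :: "nat \<Rightarrow> real^'n"
    and c :: "nat \<Rightarrow> 'w \<Rightarrow> real^('n + 'd)"
    and a :: "nat \<Rightarrow> 'w \<Rightarrow> real^'n"
    and b :: "nat \<Rightarrow> 'w \<Rightarrow> real^'d"
    and est :: "nat \<Rightarrow> (nat \<Rightarrow> (real^'n) \<times> (real^'d)) \<Rightarrow> (real^'d^'n) option"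
    and Xhat :: "nat \<Rightarrow> 'w \<Rightarrow> (real^'d^'n) option"
    and Z T2 :: "nat \<Rightarrow> 'w \<Rightarrow> real"
    and \<sigma> \<delta> :: real
    and \<mu>a :: "real^'n"
    and Sa :: "real^'n^'n"
  assumes prob: "prob_space M"
    \<comment> \<open>model\<close>
    and obs_a: "\<And>i \<omega>. a i \<omega> = a0 i + (\<chi> p. c i \<omega> $ Inl p)"
    and obs_b: "\<And>i \<omega>. b i \<omega> = transpose X0 *v a0 i + (\<chi> q. c i \<omega> $ Inr q)"
    \<comment> \<open>estimator\<close>
    and est: "\<And>m. 1 \<le> m \<Longrightarrow> tls_estimator m (est m)"
    and Xhat: "\<And>m \<omega>. Xhat m \<omega> = est m (\<lambda>i\<in>{1..m}. (a i \<omega>, b i \<omega>))"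
    \<comment> \<open>test statistic, with arbitrary measurable values where it is undefined\<close>
    and Z: "\<And>m. Z m \<in> borel_measurable M"
    and T2: "\<And>m \<omega>. T2 m \<omega> =
          (if T2_defined m (\<lambda>i. a i \<omega>) (\<lambda>i. b i \<omega>) (Xhat m \<omega>)
           then T2_stat m (\<lambda>i. a i \<omega>) (\<lambda>i. b i \<omega>) (the (Xhat m \<omega>))
           else Z m \<omega>)"
    \<comment> \<open>(1)\<close>
    and indep: "prob_space.indep_vars M (\<lambda>_. borel) c {1..}"
    and ident: "\<And>i. 1 \<le> i \<Longrightarrow> distr M borel (c i) = distr M borel (c 1)"
    and mean: "(\<integral>\<omega>. c 1 \<omega> \<partial>M) = 0"
    and sigma: "0 < \<sigma>"
    and cov: "cov_matrix M (c 1) = \<sigma>\<^sup>2 *\<^sub>R mat 1"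
    \<comment> \<open>(2)\<close>
    and delta: "0 < \<delta>"
    and moment: "integrable M (\<lambda>\<omega>. norm (c 1 \<omega>) powr (4 + 2 * \<delta>))"
    and regressors: "(\<lambda>m. 1 / real m powr (1 + \<delta> / 2) * (\<Sum>i=1..m. norm (a0 i) powr (2 + \<delta>)))
          \<longlonglongrightarrow> 0"
    \<comment> \<open>(3)\<close>
    and third: "\<And>p q r. (\<integral>\<omega>. c 1 \<omega> $ p * c 1 \<omega> $ q * c 1 \<omega> $ r \<partial>M) = 0"
    \<comment> \<open>(4)\<close>
    and lim_mean: "(\<lambda>m. avg m a0) \<longlonglongrightarrow> \<mu>a"
    \<comment> \<open>(5)\<close>
    and lim_cov: "(\<lambda>m. avg m (\<lambda>i. outer (a0 i - \<mu>a) (a0 i - \<mu>a))) \<longlonglongrightarrow> Sa"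
    and nonsing: "invertible Sa"
  shows "(\<forall>m\<ge>1. T2 m \<in> borel_measurable M) \<and>
         weak_conv_m (\<lambda>m. distr M borel (T2 m)) (chi_squared CARD('d))"
proof -
  interpret prob_space M by (rule prob)
  interpret eiv_model M c X0 a0 \<sigma> \<delta> \<mu>a Sa
    by unfold_locales
      (fact indep ident mean sigma cov delta moment regressors third lim_mean lim_cov nonsing)+
  have a: "a = aobs" and b: "b = bobs"
    by (auto simp: fun_eq_iff obs_a obs_b aobs_def bobs_def Pm_mult Qm_mult)
  have am: "a i \<in> borel_measurable M" and bm: "b i \<in> borel_measurable M" if "1 \<le> i" for i
    using c_measurable[OF that] unfolding a b aobs_def[abs_def] bobs_def[abs_def] by measurable
  have T2_meas: "T2 m \<in> borel_measurable M" for m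
  proof (cases "1 \<le> m")
    case True
    have "Xhat m \<in> measurable M borel_infty"
      unfolding Xhat[abs_def] by (rule est_measurable[OF est[OF True] am bm])
    from T2_measurable[where m=m, OF am bm this Z[of m]] show ?thesis unfolding T2[abs_def] .
  next
    case False
    then have "T2 m = Z m" by (auto simp: fun_eq_iff T2 T2_defined_def)
    then show ?thesis using Z by simp
  qed
  obtain C where C: "\<And>m. expectation (bounded_part m) \<le> C" using bounded_part(2) by blast
  have close: "(\<lambda>m. prob {\<omega>\<in>space M. \<epsilon> \<le> \<bar>T2 m \<omega> - (norm (white_score m \<omega>))\<^sup>2\<bar>}) \<longlonglongrightarrow> 0" if "0 < \<epsilon>" for \<epsilon>
  proof (rule null_in_probI[OF _ small_part_nonneg _ bounded_part(1) bounded_part_nonneg C _ _ that])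
    show "integrable M (small_part m)" for m using small_part_null by (simp add: L1_null_def)
    show "(\<lambda>m. expectation (small_part m)) \<longlonglongrightarrow> 0"
      using small_part_null small_part_nonneg by (simp add: L1_null_def)
    show "(\<lambda>\<omega>. T2 m \<omega> - (norm (white_score m \<omega>))\<^sup>2) \<in> borel_measurable M" for m
      using T2_meas[of m] white_score_measurable[of m] by measurable
    fix n :: "nat \<Rightarrow> nat" and \<omega> :: "nat \<Rightarrow> 'w" and K
    assume n: "strict_mono n" and small: "(\<lambda>k. small_part (n k) (\<omega> k)) \<longlonglongrightarrow> 0"
      and bdd: "\<And>k. bounded_part (n k) (\<omega> k) \<le> K"
    have Xh: "1 \<le> n k \<longrightarrow> (\<exists>X da db. tls_solution (n k) (\<lambda>i. aobs i (\<omega> k)) (\<lambda>i. bobs i (\<omega> k)) X da db) \<longrightarrow>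
      (\<exists>X da db. Xhat (n k) (\<omega> k) = Some X \<and> tls_solution (n k) (\<lambda>i. aobs i (\<omega> k)) (\<lambda>i. bobs i (\<omega> k)) X da db)" for k
      unfolding Xhat a b by (intro impI tls_estimator_solution est)
    note det = T2_close[where Xh="\<lambda>k. Xhat (n k) (\<omega> k)", OF n small bdd Xh]
    have "eventually (\<lambda>k. T2_stat (n k) (\<lambda>i. aobs i (\<omega> k)) (\<lambda>i. bobs i (\<omega> k)) (the (Xhat (n k) (\<omega> k))) - (norm (white_score (n k) (\<omega> k)))\<^sup>2
        = T2 (n k) (\<omega> k) - (norm (white_score (n k) (\<omega> k)))\<^sup>2) sequentially"
      using det(1) by eventually_elim (simp add: T2 a b)
    with det(2) show "(\<lambda>k. T2 (n k) (\<omega> k) - (norm (white_score (n k) (\<omega> k)))\<^sup>2) \<longlonglongrightarrow> 0"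
      by (rule Lim_transform_eventually)
  qed
  have "weak_conv_m (\<lambda>m. distr M borel (T2 m)) (chi_squared CARD('d))"
    by (rule weak_conv_chi_squaredI[OF white_score_measurable T2_meas score_char close])
  then show ?thesis using T2_meas by blast
qed

end
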